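(* The jet transcendence degree of a real-analytic Levi-nondegenerate hypersurface is invariant under local biholomorphisms: if $M,\tilde M\subset\mathbb{C}^{n+1}$, $n\ge 1$, are real-analytic Levi-nondegenerate hypersurfaces through the origin and there is a local biholomorphism $(\mathbb{C}^{n+1},0)\to(\mathbb{C}^{n+1},0)$ mapping $(M,0)$ onto $(\tilde M,0)$, then the jet transcendence degrees of $M$ and $\tilde M$ (at $0$) coincide.
   Context: **Transcendence degree in part of the variables.** Let $F(x,y)=(f_1,\dots,f_s)$ be holomorphic near a base point of $\mathbb{C}^m\times\mathbb{C}^n$. Let $\mathcal K$ be the field of fractions of the algebra of germs at the base point of functions that are holomorphic in $x$ and polynomial in $y$, and let $\mathcal L=\mathcal K(f_1,\dots,f_s)$ (inside the field of germs of meromorphic functions). The transcendence degree of $F$ in $y$ is the transcendence degree of the extension $\mathcal L/\mathcal K$. **Associated system of differential equations.** Let $(z,w)=(z_1,\dots,z_n,w)$ be coordinates in $\mathbb{C}^{n+1}$ and let $M\subset\mathbb{C}^{n+1}$ be a real-analytic Levi-nondegenerate hypersurface through $0$. The coordinates are such that the real defining equation of $M$ near $0$ can be solved for $w$ by the holomorphic implicit function theorem, giving the complex defining equation $w=\rho(z,\bar z,\bar w)$ with $\rho$ holomorphic. The Segre variety of a point $(a,b)\in\mathbb{C}^n\times\mathbb{C}$ near $0$ is the graph $w(z)=\rho(z,\bar a,\bar b)$. Write $w'=(w_{z_1},\dots,w_{z_n})$. By Levi-nondegeneracy, the system $w=\rho(z,\bar a,\bar b)$, $w_{z_j}=\rho_{z_j}(z,\bar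 a,\bar b)$, $j=1,\dots,n$, can be solved holomorphically as $\bar a=A(z,w,w')$, $\bar b=B(z,w,w')$ near the point $(z,w,w')=(0,0,\rho_z(0,0,0))$. The system associated with $M$ is $$w_{z_kz_l}=\Phi_{kl}(z,w,w'):=\rho_{z_kz_l}(z,A(z,w,w'),B(z,w,w')),\quad k,l=1,\dots,n$$ (a single second order ODE $w''=\Phi(z,w,w')$ if $n=1$). Put $\Phi=\{\Phi_{kl}\}_{k,l=1}^n$. **Jet transcendence degree.** The jet transcendence degree of $M$ is the transcendence degree of $\Phi$ in $y=w'$, with $x=(z,w)$. *)

theory Defs
  imports "HOL-Complex_Analysis.Complex_Analysis"
    "HOL-Computational_Algebra.Fraction_Field"
    "HOL-Library.Extended_Nat"
begin

unbundle no fps_syntax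

section \<open>Complex normed spaces\<close>

class scaleC =
  fixes scaleC :: "complex \<Rightarrow> 'a \<Rightarrow> 'a"  (infixr \<open>*\<^sub>C\<close> 75)

class complex_normed_space = real_normed_vector + scaleC +
  assumes scaleC_add_right: "c *\<^sub>C (x + y) = c *\<^sub>C x + c *\<^sub>C y"
    and scaleC_add_left: "(c + d) *\<^sub>C x = c *\<^sub>C x + d *\<^sub>C x"
    and scaleC_scaleC: "c *\<^sub>C d *\<^sub>C x = (c * d) *\<^sub>C x"
    and scaleC_one: "1 *\<^sub>C x = x"
    and scaleR_scaleC: "r *\<^sub>R x = complex_of_real r *\<^sub>C x"
    and norm_scaleC: "norm (c *\<^sub>C x) = cmod c * norm x"

instantiation complex :: complex_normed_space
begin
definition scaleC_complex :: "complex \<Rightarrow> complex \<Rightarrow> complex"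
  where "scaleC_complex c x = c * x"
instance
  by standard (auto simp: scaleC_complex_def algebra_simps norm_mult scaleR_conv_of_real)
end

instantiation prod :: (complex_normed_space, complex_normed_space) complex_normed_space
begin
definition scaleC_prod :: "complex \<Rightarrow> 'a \<times> 'b \<Rightarrow> 'a \<times> 'b"
  where "scaleC_prod c x = (c *\<^sub>C fst x, c *\<^sub>C snd x)"
instance
proof
  fix c :: complex and x :: "'a \<times> 'b"
  have "norm (c *\<^sub>C x) = sqrt ((cmod c)\<^sup>2 * ((norm (fst x))\<^sup>2 + (norm (snd x))\<^sup>2))"
    by (simp add: scaleC_prod_def norm_prod_def norm_scaleC power_mult_distrib distrib_left)
  then show "norm (c *\<^sub>C x) = cmod c * norm x"
    by (simp add: real_sqrt_mult norm_prod_def)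
qed (auto simp: scaleC_prod_def scaleC_add_right scaleC_add_left scaleC_scaleC scaleC_one
    scaleR_prod_def scaleR_scaleC)
end

instantiation vec :: (complex_normed_space, finite) complex_normed_space
begin
definition scaleC_vec :: "complex \<Rightarrow> 'a ^ 'b \<Rightarrow> 'a ^ 'b"
  where "scaleC_vec c x = (\<chi> i. c *\<^sub>C x $ i)"
instance
proof
  fix c :: complex and x :: "'a ^ 'b"
  show "norm (c *\<^sub>C x) = cmod c * norm x"
    by (simp add: scaleC_vec_def norm_vec_def norm_scaleC L2_set_right_distrib)
qed (auto simp: scaleC_vec_def vec_eq_iff scaleC_add_right scaleC_add_left scaleC_scaleC
    scaleC_one scaleR_scaleC)
end


section \<open>Holomorphic maps of several variables\<close>

text \<open>The set \<open>U\<close> is meant to be open: the derivative is not taken within \<open>U\<close>.\<close>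

definition holomorphic_map_on ::
    "('a::complex_normed_space \<Rightarrow> 'b::complex_normed_space) \<Rightarrow> 'a set \<Rightarrow> bool"
  where "holomorphic_map_on f U \<longleftrightarrow>
    (\<forall>x\<in>U. \<exists>D. (f has_derivative D) (at x) \<and> (\<forall>c v. D (c *\<^sub>C v) = c *\<^sub>C D v))"

definition holomorphic_at ::
    "('a::complex_normed_space \<Rightarrow> 'b::complex_normed_space) \<Rightarrow> 'a \<Rightarrow> bool"
  where "holomorphic_at f p \<longleftrightarrow> (\<exists>U. open U \<and> p \<in> U \<and> holomorphic_map_on f U)"

lemma holomorphic_map_on_subset:
  "holomorphic_map_on f U \<Longrightarrow> V \<subseteq> U \<Longrightarrow> holomorphic_map_on f V"
  by (auto simp: holomorphic_map_on_def)

lemma holomorphic_map_onE: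
  assumes "holomorphic_map_on f U" "x \<in> U"
  obtains D where "(f has_derivative D) (at x)" "\<forall>c v. D (c *\<^sub>C v) = c *\<^sub>C D v"
  using bspec[OF assms(1)[unfolded holomorphic_map_on_def] assms(2)] by (elim exE conjE)

lemma holomorphic_at_const:
  fixes k :: "'b::complex_normed_space"
  shows "holomorphic_at (\<lambda>_. k) p"
proof -
  have "c *\<^sub>C (0::'b) = 0" for c
    using norm_scaleC[of c "0::'b"] by simp
  then show ?thesis
    unfolding holomorphic_at_def holomorphic_map_on_def
    by (intro exI[of _ UNIV]) (auto intro!: exI[of _ "\<lambda>_. 0"])
qed

lemma holomorphic_at_common_nhd:
  assumes "holomorphic_at f p" "holomorphic_at g p"
  obtains U where "open U" "p \<in> U" "holomorphic_map_on f U" "holomorphic_map_on g U"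
proof -
  obtain U V where "open U" "p \<in> U" "holomorphic_map_on f U"
      "open V" "p \<in> V" "holomorphic_map_on g V"
    using assms by (auto simp: holomorphic_at_def)
  then show ?thesis
    by (intro that[of "U \<inter> V"]) (auto intro: holomorphic_map_on_subset)
qed

lemma holomorphic_at_add:
  fixes f g :: "'a::complex_normed_space \<Rightarrow> complex"
  assumes "holomorphic_at f p" "holomorphic_at g p"
  shows "holomorphic_at (\<lambda>x. f x + g x) p"
proof -
  obtain U where U: "open U" "p \<in> U" "holomorphic_map_on f U" "holomorphic_map_on g U"
    by (rule holomorphic_at_common_nhd[OF assms])
  have "\<exists>D. ((\<lambda>x. f x + g x) has_derivative D) (at x) \<and> (\<forall>c v. D (c *\<^sub>C v) = c *\<^sub>C D v)"
    if x: "x \<in> U" for x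
  proof -
    obtain D where D: "(f has_derivative D) (at x)" "\<forall>c v. D (c *\<^sub>C v) = c *\<^sub>C D v"
      by (rule holomorphic_map_onE[OF U(3) x])
    obtain E where E: "(g has_derivative E) (at x)" "\<forall>c v. E (c *\<^sub>C v) = c *\<^sub>C E v"
      by (rule holomorphic_map_onE[OF U(4) x])
    show ?thesis
    proof (intro exI conjI allI)
      show "((\<lambda>x. f x + g x) has_derivative (\<lambda>v. D v + E v)) (at x)"
        using D(1) E(1) by (rule has_derivative_add)
      show "D (c *\<^sub>C v) + E (c *\<^sub>C v) = c *\<^sub>C (D v + E v)" for c v
        using D(2) E(2) by (simp add: scaleC_add_right)
    qed
  qed
  then show ?thesis
    using U by (auto simp: holomorphic_at_def holomorphic_map_on_def)
qed

lemma holomorphic_at_mult: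
  fixes f g :: "'a::complex_normed_space \<Rightarrow> complex"
  assumes "holomorphic_at f p" "holomorphic_at g p"
  shows "holomorphic_at (\<lambda>x. f x * g x) p"
proof -
  obtain U where U: "open U" "p \<in> U" "holomorphic_map_on f U" "holomorphic_map_on g U"
    by (rule holomorphic_at_common_nhd[OF assms])
  have "\<exists>D. ((\<lambda>x. f x * g x) has_derivative D) (at x) \<and> (\<forall>c v. D (c *\<^sub>C v) = c *\<^sub>C D v)"
    if x: "x \<in> U" for x
  proof -
    obtain D where D: "(f has_derivative D) (at x)" "\<forall>c v. D (c *\<^sub>C v) = c *\<^sub>C D v"
      by (rule holomorphic_map_onE[OF U(3) x])
    obtain E where E: "(g has_derivative E) (at x)" "\<forall>c v. E (c *\<^sub>C v) = c *\<^sub>C E v"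
      by (rule holomorphic_map_onE[OF U(4) x])
    show ?thesis
    proof (intro exI conjI allI)
      show "((\<lambda>x. f x * g x) has_derivative (\<lambda>v. f x * E v + D v * g x)) (at x)"
        using D(1) E(1) by (rule has_derivative_mult)
      show "f x * E (c *\<^sub>C v) + D (c *\<^sub>C v) * g x = c *\<^sub>C (f x * E v + D v * g x)" for c v
      proof -
        have "D (c *\<^sub>C v) = c * D v" "E (c *\<^sub>C v) = c * E v"
          using D(2) E(2) by (simp_all add: scaleC_complex_def)
        then show ?thesis
          by (simp only: scaleC_complex_def) (simp add: algebra_simps)
      qed
    qed
  qed
  then show ?thesis
    using U by (auto simp: holomorphic_at_def holomorphic_map_on_def)
qed

lemma holomorphic_at_minus:
  fixes f :: "'a::complex_normed_space \<Rightarrow> complex"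
  assumes "holomorphic_at f p"
  shows "holomorphic_at (\<lambda>x. - f x) p"
  using holomorphic_at_mult[OF holomorphic_at_const[of "-1"] assms] by simp

lemma bounded_linear_scaleC_left:
  fixes v :: "'a::complex_normed_space"
  shows "bounded_linear (\<lambda>t. t *\<^sub>C v)"
proof (rule bounded_linear_intro[where K = "norm v"])
  show "(r *\<^sub>R t) *\<^sub>C v = r *\<^sub>R t *\<^sub>C v" for r t
    by (simp only: scaleR_scaleC[where 'a='a] scaleC_scaleC scaleR_conv_of_real)
qed (simp_all only: scaleC_add_left norm_scaleC order_refl)

lemma holomorphic_map_on_line:
  fixes f :: "'a::complex_normed_space \<Rightarrow> complex"
  assumes "holomorphic_map_on f U"
  shows "(\<lambda>t. f (x + t *\<^sub>C v)) holomorphic_on {t. x + t *\<^sub>C v \<in> U}"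
proof (unfold holomorphic_on_def, intro ballI)
  fix t assume "t \<in> {t. x + t *\<^sub>C v \<in> U}"
  then have "x + t *\<^sub>C v \<in> U" by simp
  then obtain D where D: "(f has_derivative D) (at (x + t *\<^sub>C v))"
      "\<forall>c v. D (c *\<^sub>C v) = c *\<^sub>C D v"
    by (rule holomorphic_map_onE[OF assms])
  note bounded_linear_scaleC_left[of v]
  then have "((\<lambda>t. x + t *\<^sub>C v) has_derivative (\<lambda>s. s *\<^sub>C v)) (at t)"
    using has_derivative_add[OF has_derivative_const bounded_linear_imp_has_derivative] by fastforce
  from has_derivative_compose[OF this D(1)]
  have "((\<lambda>t. f (x + t *\<^sub>C v)) has_field_derivative D v) (at t)"
    by (rule has_derivative_imp_has_field_derivative) (simp add: D(2) scaleC_complex_def mult.commute)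
  then show "(\<lambda>t. f (x + t *\<^sub>C v)) field_differentiable at t within {t. x + t *\<^sub>C v \<in> U}"
    using field_differentiable_at_within field_differentiable_def by blast
qed

lemma continuous_on_holomorphic_map:
  "holomorphic_map_on f U \<Longrightarrow> continuous_on U f"
  by (rule continuous_at_imp_continuous_on)
    (auto elim!: holomorphic_map_onE intro: has_derivative_continuous)

lemma holomorphic_map_on_ball_identity:
  fixes f :: "'a::complex_normed_space \<Rightarrow> complex"
  assumes f: "holomorphic_map_on f (ball p e)" and V: "open V" "q \<in> V" "q \<in> ball p e"
    and zero: "\<And>x. x \<in> V \<Longrightarrow> f x = 0" and x: "x \<in> ball p e"
  shows "f x = 0"
proof -
  define v where "v = x - q"
  define L where "L = (\<lambda>t::complex. q + t *\<^sub>C v)"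
  note bounded_linear_scaleC_left[of v]
  then have lin: "linear (\<lambda>t. t *\<^sub>C v)" and "continuous_on UNIV (\<lambda>t. t *\<^sub>C v)"
    by (simp_all only: bounded_linear.linear linear_continuous_on)
  then have cont: "continuous_on UNIV L"
    unfolding L_def by (intro continuous_on_add continuous_on_const)
  have L0: "L 0 = q" using linear_0[OF lin] by (simp add: L_def)
  have L1: "L 1 = x" by (simp add: L_def v_def scaleC_one)
  define S where "S = {t. L t \<in> ball p e}"
  have S: "open S" "convex S"
  proof -
    show "open S"
      using open_vimage[OF open_ball cont] by (simp add: S_def vimage_def)
    have "S = (\<lambda>t. t *\<^sub>C v) -` ball (p - q) e"
      by (simp add: S_def L_def vimage_def dist_norm diff_diff_eq)
    then show "convex S"
      using convex_linear_vimage[OF lin convex_ball] by simp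
  qed
  define W where "W = S \<inter> L -` V"
  have "open W" using S open_vimage[OF V(1) cont] by (auto simp: W_def)
  have "(f \<circ> L) 1 = 0"
  proof (rule analytic_continuation_open[where s = W and s' = S and f = "f \<circ> L" and g = "\<lambda>_. 0"])
    show "(f \<circ> L) holomorphic_on S"
      using holomorphic_map_on_line[OF f, of q v] by (simp add: S_def L_def o_def)
    have "0 \<in> W" using V L0 by (simp add: W_def S_def)
    then show "W \<noteq> {}" by blast
    show "connected S" using S convex_connected by blast
  qed (use S \<open>open W\<close> zero x L1 in \<open>auto simp: W_def S_def\<close>)
  then show ?thesis by (simp add: L1)
qed


section \<open>Germs of holomorphic and meromorphic functions\<close>

text \<open>
  Germs are taken at the origin so that they form a type; a germ at another point is
  translated there by \<open>germ_at\<close> below.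
\<close>

definition germ_rel ::
    "('a::complex_normed_space \<Rightarrow> complex) \<Rightarrow> ('a \<Rightarrow> complex) \<Rightarrow> bool"
  where "germ_rel f g \<longleftrightarrow>
    holomorphic_at f 0 \<and> holomorphic_at g 0 \<and> (\<forall>\<^sub>F x in nhds 0. f x = g x)"

lemma germ_rel_binop:
  fixes b :: "complex \<Rightarrow> complex \<Rightarrow> complex" and f g :: "'a::complex_normed_space \<Rightarrow> complex"
  assumes "germ_rel f f'" "germ_rel g g'"
    and "\<And>f g :: 'a \<Rightarrow> complex. holomorphic_at f 0 \<Longrightarrow>
      holomorphic_at g 0 \<Longrightarrow> holomorphic_at (\<lambda>x. b (f x) (g x)) 0"
  shows "germ_rel (\<lambda>x. b (f x) (g x)) (\<lambda>x. b (f' x) (g' x))"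
proof -
  have "\<forall>\<^sub>F x in nhds 0. f x = f' x" "\<forall>\<^sub>F x in nhds 0. g x = g' x"
    using assms(1,2) by (auto simp: germ_rel_def)
  then have "\<forall>\<^sub>F x in nhds 0. b (f x) (g x) = b (f' x) (g' x)"
    by eventually_elim simp
  moreover have "holomorphic_at (\<lambda>x. b (f x) (g x)) 0" "holomorphic_at (\<lambda>x. b (f' x) (g' x)) 0"
    using assms(1,2) by (auto simp: germ_rel_def intro: assms(3))
  ultimately show ?thesis
    by (simp add: germ_rel_def)
qed

quotient_type (overloaded) 'a germ = "'a::complex_normed_space \<Rightarrow> complex" / partial: germ_rel
proof (rule part_equivpI)
  show "\<exists>f::'a \<Rightarrow> complex. germ_rel f f"
    using holomorphic_at_const by (auto simp: germ_rel_def)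
  show "symp (germ_rel :: ('a \<Rightarrow> complex) \<Rightarrow> _)"
    by (auto simp: symp_def germ_rel_def elim: eventually_mono)
  show "transp (germ_rel :: ('a \<Rightarrow> complex) \<Rightarrow> _)"
  proof (rule transpI)
    fix f g h :: "'a \<Rightarrow> complex"
    assume *: "germ_rel f g" "germ_rel g h"
    then have "\<forall>\<^sub>F x in nhds 0. f x = g x" "\<forall>\<^sub>F x in nhds 0. g x = h x"
      by (auto simp: germ_rel_def)
    then have "\<forall>\<^sub>F x in nhds 0. f x = h x"
      by eventually_elim simp
    then show "germ_rel f h"
      using * by (simp add: germ_rel_def)
  qed
qed

instantiation germ :: (complex_normed_space) comm_ring_1
begin

lift_definition zero_germ :: "'a germ" is "\<lambda>_. 0"
  by (simp add: germ_rel_def holomorphic_at_const)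
lift_definition one_germ :: "'a germ" is "\<lambda>_. 1"
  by (simp add: germ_rel_def holomorphic_at_const)
lift_definition plus_germ :: "'a germ \<Rightarrow> 'a germ \<Rightarrow> 'a germ" is "\<lambda>f g x. f x + g x"
  by (rule germ_rel_binop[OF _ _ holomorphic_at_add])
lift_definition times_germ :: "'a germ \<Rightarrow> 'a germ \<Rightarrow> 'a germ" is "\<lambda>f g x. f x * g x"
  by (rule germ_rel_binop[OF _ _ holomorphic_at_mult])
lift_definition uminus_germ :: "'a germ \<Rightarrow> 'a germ" is "\<lambda>f x. - f x"
  by (auto simp: germ_rel_def holomorphic_at_minus elim: eventually_mono)
definition minus_germ :: "'a germ \<Rightarrow> 'a germ \<Rightarrow> 'a germ" where "minus_germ f g = f + - g"

instance
proof
  fix a b c :: "'a germ"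
  show "a + b + c = a + (b + c)"
    by transfer (auto simp: germ_rel_def holomorphic_at_add add.assoc)
  show "a + b = b + a"
    by transfer (auto simp: germ_rel_def holomorphic_at_add add.commute)
  show "0 + a = a"
    by transfer (auto simp: germ_rel_def)
  show "- a + a = 0"
    by transfer (auto simp: germ_rel_def holomorphic_at_const)
  show "a - b = a + - b"
    by (simp add: minus_germ_def)
  show "a * b * c = a * (b * c)"
    by transfer (auto simp: germ_rel_def holomorphic_at_mult mult.assoc)
  show "a * b = b * a"
    by transfer (auto simp: germ_rel_def holomorphic_at_mult mult.commute)
  show "1 * a = a"
    by transfer (auto simp: germ_rel_def)
  show "(a + b) * c = a * c + b * c"
    by transfer (auto simp: germ_rel_def holomorphic_at_mult holomorphic_at_add distrib_right)
  show "(0::'a germ) \<noteq> 1"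
    by transfer (auto simp: germ_rel_def)
qed

end

instance germ :: (complex_normed_space) idom
proof
  fix a b :: "'a germ"
  assume "a \<noteq> 0" "b \<noteq> 0"
  then show "a * b \<noteq> 0"
  proof (transfer, goal_cases)
    case (1 f g)
    show ?case
    proof
      assume *: "germ_rel (\<lambda>x. f x * g x) (\<lambda>_. 0)"
      obtain U where U: "open U" "0 \<in> U" "holomorphic_map_on f U" "holomorphic_map_on g U"
        using 1 holomorphic_at_common_nhd[of f 0 g] by (auto simp: germ_rel_def)
      obtain V where V: "open V" "0 \<in> V" "\<And>x. x \<in> V \<Longrightarrow> f x * g x = 0"
        using * by (auto simp: germ_rel_def eventually_nhds)
      obtain e where e: "e > 0" "ball 0 e \<subseteq> U \<inter> V"
        using U V open_contains_ball[of "U \<inter> V"] by blast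
      have fg: "holomorphic_map_on f (ball 0 e)" "holomorphic_map_on g (ball 0 e)"
        using U e by (auto intro: holomorphic_map_on_subset)
      have near: "\<forall>\<^sub>F x in nhds 0. x \<in> ball 0 e"
        using e by (intro eventually_nhds_in_open) auto
      have "\<exists>q\<in>ball 0 e. f q \<noteq> 0"
      proof (rule ccontr)
        assume "\<not> ?thesis"
        then have "\<forall>\<^sub>F x in nhds 0. f x = 0"
          using near by (auto elim: eventually_mono)
        then show False
          using 1 by (auto simp: germ_rel_def holomorphic_at_const)
      qed
      then obtain q where q: "q \<in> ball 0 e" "f q \<noteq> 0" by blast
      have "open {x \<in> ball 0 e. f x \<noteq> 0}"
        using continuous_open_preimage[OF continuous_on_holomorphic_map[OF fg(1)] open_ball,
            of "- {0}"]
        by (auto simp: vimage_def Int_def open_Compl)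
      moreover have "g x = 0" if "x \<in> {x \<in> ball 0 e. f x \<noteq> 0}" for x
      proof -
        have "f x * g x = 0" using that e by (intro V(3)) blast
        then show ?thesis using that by simp
      qed
      ultimately have "g x = 0" if "x \<in> ball 0 e" for x
        using holomorphic_map_on_ball_identity[OF fg(2), of "{x \<in> ball 0 e. f x \<noteq> 0}" q x] q that
        by blast
      then have "\<forall>\<^sub>F x in nhds 0. g x = 0"
        using near by (auto elim: eventually_mono)
      then show False
        using 1 by (auto simp: germ_rel_def holomorphic_at_const)
    qed
  qed
qed

text \<open>The quotient field of the ring of germs is the field of germs of meromorphic functions.\<close>

type_synonym 'a meromorphic_germ = "'a germ fract"

definition germ_at ::
    "'a::complex_normed_space \<Rightarrow> ('a \<Rightarrow> complex) \<Rightarrow> 'a germ"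
  where "germ_at p f = abs_germ (\<lambda>v. f (p + v))"


section \<open>Transcendence degree\<close>

definition is_subfield :: "'k::field set \<Rightarrow> bool"
  where "is_subfield K \<longleftrightarrow> 0 \<in> K \<and> 1 \<in> K \<and>
    (\<forall>x\<in>K. \<forall>y\<in>K. x - y \<in> K \<and> x * y \<in> K) \<and> (\<forall>x\<in>K. inverse x \<in> K)"

definition field_adjoin :: "'k::field set \<Rightarrow> 'k set \<Rightarrow> 'k set"
  where "field_adjoin K S = \<Inter>{L. is_subfield L \<and> K \<union> S \<subseteq> L}"

definition algebraically_independent :: "'k::field set \<Rightarrow> 'k set \<Rightarrow> bool"
  where "algebraically_independent K S \<longleftrightarrow>
    (\<forall>T A c. finite T \<and> T \<subseteq> S \<and> finite A \<and> A \<subseteq> (T \<rightarrow>\<^sub>E (UNIV::nat set)) \<and> c \<in> A \<rightarrow> K \<and>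
       (\<Sum>\<alpha>\<in>A. c \<alpha> * (\<Prod>t\<in>T. t ^ \<alpha> t)) = 0 \<longrightarrow> (\<forall>\<alpha>\<in>A. c \<alpha> = 0))"

definition transcendence_degree :: "'k::field set \<Rightarrow> 'k set \<Rightarrow> enat"
  where "transcendence_degree K L =
    (SUP S \<in> {S. S \<subseteq> L \<and> finite S \<and> algebraically_independent K S}. enat (card S))"

definition polynomial_in_y ::
    "'x \<Rightarrow> ('x::complex_normed_space \<times> (complex ^ 'k) \<Rightarrow> complex) \<Rightarrow> bool"
  where "polynomial_in_y x\<^sub>0 f \<longleftrightarrow>
    (\<exists>(A :: ('k \<Rightarrow> nat) set) c. finite A \<and> (\<forall>\<alpha>\<in>A. holomorphic_at (c \<alpha>) x\<^sub>0) \<and>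
       f = (\<lambda>(x, y). \<Sum>\<alpha>\<in>A. c \<alpha> x * (\<Prod>i\<in>UNIV. y $ i ^ \<alpha> i)))"

definition partially_rational_germs ::
    "'x::complex_normed_space \<times> (complex ^ 'k) \<Rightarrow> ('x \<times> (complex ^ 'k)) meromorphic_germ set"
  where "partially_rational_germs p =
    {Fract (germ_at p f) (germ_at p g) | f g.
       polynomial_in_y (fst p) f \<and> polynomial_in_y (fst p) g \<and> germ_at p g \<noteq> 0}"

definition transcendence_degree_in_y ::
    "'x::complex_normed_space \<times> (complex ^ 'k) \<Rightarrow> ('x \<times> (complex ^ 'k) \<Rightarrow> complex) set \<Rightarrow> enat"
  where "transcendence_degree_in_y p F =
    (let K = partially_rational_germs p
     in transcendence_degree K (field_adjoin K ((\<lambda>f. Fract (germ_at p f) 1) ` F)))"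


section \<open>Levi-nondegenerate real-analytic hypersurfaces\<close>

definition real_analytic_on :: "('a::euclidean_space \<Rightarrow> real) \<Rightarrow> 'a set \<Rightarrow> bool"
  where "real_analytic_on f U \<longleftrightarrow>
    (\<forall>p\<in>U. \<exists>e>0. \<exists>c. \<forall>x\<in>ball p e.
       ((\<lambda>\<alpha>. c \<alpha> * (\<Prod>b\<in>Basis. ((x - p) \<bullet> b) ^ \<alpha> b)) has_sum f x)
         (Basis \<rightarrow>\<^sub>E (UNIV::nat set)))"

definition wirtinger ::
    "'a::complex_normed_space \<Rightarrow> ('a \<Rightarrow> complex) \<Rightarrow> 'a \<Rightarrow> complex"
  where "wirtinger v f p =
    (frechet_derivative f (at p) v - \<i> * frechet_derivative f (at p) (\<i> *\<^sub>C v)) / 2"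

definition wirtinger_conj ::
    "'a::complex_normed_space \<Rightarrow> ('a \<Rightarrow> complex) \<Rightarrow> 'a \<Rightarrow> complex"
  where "wirtinger_conj v f p =
    (frechet_derivative f (at p) v + \<i> * frechet_derivative f (at p) (\<i> *\<^sub>C v)) / 2"

text \<open>
  In coordinates, \<open>levi_form r p u v\<close> is the sum over \<open>j, k\<close> of
  \<open>(\<partial>\<^sup>2 r / \<partial>Z\<^sub>j \<partial>cnj Z\<^sub>k)(p) u\<^sub>j (cnj v\<^sub>k)\<close>.
\<close>

definition levi_form ::
    "('a::complex_normed_space \<Rightarrow> real) \<Rightarrow> 'a \<Rightarrow> 'a \<Rightarrow> 'a \<Rightarrow> complex"
  where "levi_form r p u v = wirtinger u (wirtinger_conj v (\<lambda>q. complex_of_real (r q))) p"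

definition complex_tangent_space ::
    "('a::complex_normed_space \<Rightarrow> real) \<Rightarrow> 'a \<Rightarrow> 'a set"
  where "complex_tangent_space r p = {v. wirtinger v (\<lambda>q. complex_of_real (r q)) p = 0}"

definition local_defining_function ::
    "'a::{complex_normed_space, euclidean_space} set \<Rightarrow> 'a \<Rightarrow> 'a set \<Rightarrow> ('a \<Rightarrow> real) \<Rightarrow> bool"
  where "local_defining_function M p U r \<longleftrightarrow>
    open U \<and> p \<in> U \<and> real_analytic_on r U \<and> M \<inter> U = {q \<in> U. r q = 0} \<and>
    (\<forall>q\<in>U. frechet_derivative r (at q) \<noteq> (\<lambda>_. 0))"

definition real_analytic_hypersurface ::
    "'a::{complex_normed_space, euclidean_space} set \<Rightarrow> bool"
  where "real_analytic_hypersurface M \<longleftrightarrow> (\<forall>p\<in>M. \<exists>U r. local_defining_function M p U r)"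

text \<open>
  Nondegeneracy of the Levi form does not depend on the defining function, so quantifying
  over all of them is the same as requiring it for one.
\<close>

definition levi_nondegenerate ::
    "'a::{complex_normed_space, euclidean_space} set \<Rightarrow> bool"
  where "levi_nondegenerate M \<longleftrightarrow>
    (\<forall>p\<in>M. \<forall>U r. local_defining_function M p U r \<longrightarrow>
       (\<forall>u\<in>complex_tangent_space r p.
          (\<forall>v\<in>complex_tangent_space r p. levi_form r p u v = 0) \<longrightarrow> u = 0))"

definition local_biholomorphism ::
    "('a::complex_normed_space \<Rightarrow> 'a) \<Rightarrow> 'a set \<Rightarrow> 'a set \<Rightarrow> bool"
  where "local_biholomorphism H U V \<longleftrightarrow>
    open U \<and> open V \<and> 0 \<in> U \<and> H 0 = 0 \<and> bij_betw H U V \<and>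
    holomorphic_map_on H U \<and> holomorphic_map_on (inv_into U H) V"


section \<open>The associated system of differential equations\<close>

text \<open>
  The ambient space with coordinates \<open>(z, w)\<close> and the jet space with coordinates
  \<open>((z, w), w')\<close>, where \<open>z\<close> and \<open>w'\<close> have \<open>n = CARD('n)\<close> components.
\<close>

type_synonym 'n ambient = "(complex ^ 'n) \<times> complex"
type_synonym 'n jet = "'n ambient \<times> (complex ^ 'n)"

definition conj_point :: "'n::finite ambient \<Rightarrow> 'n ambient"
  where "conj_point Z = ((\<chi> i. cnj (fst Z $ i)), cnj (snd Z))"

text \<open>
  The condition \<open>r\<^sub>w(0) \<noteq> 0\<close> under which the implicit function theorem solves the real
  defining equation \<open>r = 0\<close>, complexified, for \<open>w\<close>.
\<close>

definition solvable_for_w :: "'n::finite ambient set \<Rightarrow> bool"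
  where "solvable_for_w M \<longleftrightarrow>
    (\<exists>U r. local_defining_function M 0 U r \<and>
       wirtinger (0, 1) (\<lambda>Z. complex_of_real (r Z)) 0 \<noteq> 0)"

text \<open>
  Here \<open>R(Z, \<zeta>)\<close> is the complexification of the real-analytic function \<open>r(Z)\<close>, with \<open>\<zeta>\<close> in
  the place of \<open>conj Z\<close>, and \<open>\<rho>(z, (a, b))\<close> is the solution \<open>w\<close> of \<open>R((z, w), (a, b)) = 0\<close>.
\<close>

definition complex_defining_function ::
    "'n::finite ambient set \<Rightarrow> ((complex ^ 'n) \<times> 'n ambient \<Rightarrow> complex) \<Rightarrow> bool"
  where "complex_defining_function M \<rho> \<longleftrightarrow>
    holomorphic_at \<rho> 0 \<and> \<rho> 0 = 0 \<and>
    (\<exists>U r R. local_defining_function M 0 U r \<and> holomorphic_at R 0 \<and>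
       (\<forall>\<^sub>F Z in nhds 0. R (Z, conj_point Z) = complex_of_real (r Z)) \<and>
       (\<forall>\<^sub>F ((z, w), \<zeta>) in nhds 0. R ((z, w), \<zeta>) = 0 \<longleftrightarrow> w = \<rho> (z, \<zeta>)))"

definition partial_z ::
    "'n \<Rightarrow> ((complex ^ 'n) \<times> 'n::finite ambient \<Rightarrow> complex) \<Rightarrow> (complex ^ 'n) \<times> 'n ambient \<Rightarrow> complex"
  where "partial_z k f = (\<lambda>(z, \<zeta>). deriv (\<lambda>t. f (z + axis k t, \<zeta>)) 0)"

definition jet_base_point :: "((complex ^ 'n) \<times> 'n::finite ambient \<Rightarrow> complex) \<Rightarrow> 'n jet"
  where "jet_base_point \<rho> = (0, \<chi> j. partial_z j \<rho> 0)"

definition segre_parameters ::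
    "((complex ^ 'n) \<times> 'n::finite ambient \<Rightarrow> complex) \<Rightarrow>
     ('n jet \<Rightarrow> complex ^ 'n) \<Rightarrow> ('n jet \<Rightarrow> complex) \<Rightarrow> bool"
  where "segre_parameters \<rho> A B \<longleftrightarrow>
    holomorphic_at A (jet_base_point \<rho>) \<and> holomorphic_at B (jet_base_point \<rho>) \<and>
    A (jet_base_point \<rho>) = 0 \<and> B (jet_base_point \<rho>) = 0 \<and>
    (\<forall>\<^sub>F ((z, w), w') in nhds (jet_base_point \<rho>).
       w = \<rho> (z, (A ((z, w), w'), B ((z, w), w'))) \<and>
       (\<forall>j. w' $ j = partial_z j \<rho> (z, (A ((z, w), w'), B ((z, w), w')))))"

definition associated_system ::
    "((complex ^ 'n) \<times> 'n::finite ambient \<Rightarrow> complex) \<Rightarrow>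
     ('n jet \<Rightarrow> complex ^ 'n) \<Rightarrow> ('n jet \<Rightarrow> complex) \<Rightarrow> 'n \<Rightarrow> 'n \<Rightarrow> 'n jet \<Rightarrow> complex"
  where "associated_system \<rho> A B k l =
    (\<lambda>((z, w), w'). partial_z l (partial_z k \<rho>) (z, (A ((z, w), w'), B ((z, w), w'))))"

text \<open>
  For a Levi-nondegenerate \<open>M\<close> with \<open>solvable_for_w M\<close>, the germs of \<open>\<rho>\<close>, \<open>A\<close> and \<open>B\<close> exist and
  are determined by \<open>M\<close>; only their representatives are chosen here.
\<close>

definition jet_transcendence_degree :: "'n::finite ambient set \<Rightarrow> enat"
  where "jet_transcendence_degree M =
    (let \<rho> = (SOME \<rho>. complex_defining_function M \<rho>);
         (A, B) = (SOME (A, B). segre_parameters \<rho> A B)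
     in transcendence_degree_in_y (jet_base_point \<rho>)
          {associated_system \<rho> A B k l | k l. True})"

end

theory Submission
  imports Defs
begin

text \<open>
  The proof replaces the jet coordinates \<open>(z, w, w')\<close> by the parameters \<open>x = (z, \<zeta>)\<close> of the
  family of Segre varieties \<open>w = \<rho> (z, \<zeta>)\<close>, \<open>\<zeta> = (a, b)\<close>. Levi-nondegeneracy says exactly that
  the jet map \<open>(z, \<zeta>) \<mapsto> (z, \<rho>, \<rho>\<^sub>z)\<close> is a local biholomorphism (\<open>jet_map_immersion\<close>); its
  inverse consists of \<open>z\<close> and the Segre parameters \<open>A\<close>, \<open>B\<close>. Read on \<open>x\<close>-space, the coordinates
  \<open>w'\<close> are the first derivatives of \<open>\<rho>\<close> in \<open>z\<close> and the functions \<open>\<Phi>\<^sub>k\<^sub>l\<close> are the second ones.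

  A biholomorphism \<open>H\<close> from \<open>M\<close> to \<open>M'\<close> maps Segre varieties to Segre varieties
  (\<open>segre_correspondence\<close>): with \<open>H = (F, g)\<close>, \<open>Z = (z, \<rho> (z, \<zeta>))\<close> and the conjugate map \<open>H\<^sup>*\<close>,
  one has \<open>g Z = \<rho>' (\<theta> (z, \<zeta>))\<close> where \<open>\<theta> (z, \<zeta>) = (F Z, H\<^sup>* \<zeta>)\<close>. The identity holds first on
  the points \<open>(Z, conj Z)\<close> with \<open>Z\<close> in \<open>M\<close>, and these form a maximal totally real submanifold of the
  complexified hypersurface.

  Differentiating this identity along \<open>z\<close> gives the prolongation formulas. The first derivatives
  are a linear system for the functions \<open>\<rho>'\<^sub>z \<circ> \<theta>\<close>, whose coefficients are holomorphic in \<open>(z, w)\<close>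
  and polynomial in \<open>w'\<close>; hence the prolongation of \<open>H\<close> to jets is rational in \<open>w'\<close>
  (\<open>slope_K\<close>). The second derivatives are a linear system for the functions
  \<open>\<Phi>'\<^sub>k\<^sub>l\<close> along the prolongation, whose right-hand side involves \<open>w'\<close> rationally and \<open>\<Phi>\<close> linearly
  (\<open>curvature_L\<close>). The coefficient matrix is invertible because the Jacobian matrix of the
  transformation induced by the inverse of \<open>H\<close> inverts it, and Cramer's rule keeps the solutions in the field.

  So composition with the prolongation of \<open>H\<close> is a homomorphism of the fields of meromorphic germs
  that carries \<open>\<K>'\<close> into \<open>\<K>\<close> and \<open>\<L>'\<close> into \<open>\<L>\<close>. The prolongation of the inverse of \<open>H\<close> gives
  the inverse homomorphism, with the roles exchanged, and the transcendence degrees agree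
  (\<open>transcendence_degree_le\<close>).

  The analytic tools come from complex analysis on lines and from the real inverse function theorem:
  derivatives of holomorphic functions are holomorphic, local inverses of holomorphic maps are
  holomorphic, and real-analytic functions have holomorphic complexifications.
\<close>

section \<open>Scalar multiplication\<close>

lemma scaleC_0_left [simp]: "0 *\<^sub>C (x::'a::complex_normed_space) = 0"
  using norm_scaleC[of 0 x] by simp

lemma scaleC_0_right [simp]: "c *\<^sub>C (0::'a::complex_normed_space) = 0"
  using norm_scaleC[of c "0::'a"] by simp

lemma scaleC_minus_right: "c *\<^sub>C (- x :: 'a::complex_normed_space) = - (c *\<^sub>C x)"
  using scaleC_add_right[of c x "- x"] by (simp add: eq_neg_iff_add_eq_0 add.commute)

lemma scaleC_diff_right: "c *\<^sub>C (x - y :: 'a::complex_normed_space) = c *\<^sub>C x - c *\<^sub>C y"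
  using scaleC_add_right[of c x "- y"] by (simp add: scaleC_minus_right)

lemma scaleC_minus_left: "(- c) *\<^sub>C (x :: 'a::complex_normed_space) = - (c *\<^sub>C x)"
  using scaleC_add_left[of c "- c" x] by (simp add: eq_neg_iff_add_eq_0 add.commute)

lemma scaleC_sum_right: "c *\<^sub>C (\<Sum>i\<in>I. f i :: 'a::complex_normed_space) = (\<Sum>i\<in>I. c *\<^sub>C f i)"
  by (induction I rule: infinite_finite_induct) (simp_all add: scaleC_add_right)

lemma scaleC_complex_eq [simp]: "c *\<^sub>C (x::complex) = c * x"
  by (simp add: scaleC_complex_def)

lemma scaleC_Pair [simp]: "c *\<^sub>C (x, y) = (c *\<^sub>C x, c *\<^sub>C y)"
  by (simp add: scaleC_prod_def)

lemma fst_scaleC [simp]: "fst (c *\<^sub>C x) = c *\<^sub>C fst x"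
  and snd_scaleC [simp]: "snd (c *\<^sub>C x) = c *\<^sub>C snd x"
  by (simp_all add: scaleC_prod_def)

lemma scaleC_vec_nth [simp]: "(c *\<^sub>C x) $ i = c *\<^sub>C (x $ i)"
  by (simp add: scaleC_vec_def)

lemma scaleC_axis [simp]: "c *\<^sub>C axis k (x::'a::complex_normed_space) = axis k (c *\<^sub>C x)"
  by (simp add: vec_eq_iff axis_def)

lemma bounded_linear_scaleC_right:
  "bounded_linear (\<lambda>x::'a::complex_normed_space. c *\<^sub>C x)"
  by (rule bounded_linear_intro[where K = "cmod c"])
    (simp_all add: scaleC_add_right norm_scaleC scaleR_scaleC scaleC_scaleC mult.commute)

section \<open>Complex differentiability at a point\<close>

text \<open>The direction comes first, so that \<open>dd v f\<close> is again a function of the point and can be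
  differentiated in turn.\<close>

definition dd :: "'a \<Rightarrow> ('a::complex_normed_space \<Rightarrow> 'b::complex_normed_space) \<Rightarrow> 'a \<Rightarrow> 'b"
  where "dd v f p = frechet_derivative f (at p) v"

text \<open>Pointwise complex differentiability. The chain and product rules for \<open>dd\<close> hold at single
  points, and eventual equalities of derivatives are derived from them near the base point.\<close>

definition cdiff :: "('a::complex_normed_space \<Rightarrow> 'b::complex_normed_space) \<Rightarrow> 'a \<Rightarrow> bool"
  where "cdiff f p \<longleftrightarrow> (\<exists>D. (f has_derivative D) (at p) \<and> (\<forall>c v. D (c *\<^sub>C v) = c *\<^sub>C D v))"

lemma cdiffI:
  assumes "(f has_derivative D) (at p)" "\<And>c v. D (c *\<^sub>C v) = c *\<^sub>C D v"
  shows "cdiff f p" "dd v f p = D v"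
  using assms frechet_derivative_at[OF assms(1)] by (auto simp: cdiff_def dd_def)

lemma cdiffD:
  assumes "cdiff f p"
  shows "(f has_derivative (\<lambda>v. dd v f p)) (at p)" and "dd (c *\<^sub>C v) f p = c *\<^sub>C dd v f p"
  using assms cdiffI unfolding cdiff_def by (metis (no_types, lifting) ext)+

lemma cdiff_linear:
  assumes "cdiff f p"
  shows "linear (\<lambda>v. dd v f p)" "bounded_linear (\<lambda>v. dd v f p)"
  using has_derivative_bounded_linear[OF cdiffD(1)[OF assms]] bounded_linear.linear by blast+

lemma dd_add_dir: "cdiff f p \<Longrightarrow> dd (u + v) f p = dd u f p + dd v f p"
  and dd_diff_dir: "cdiff f p \<Longrightarrow> dd (u - v) f p = dd u f p - dd v f p"
  and dd_zero_dir: "cdiff f p \<Longrightarrow> dd 0 f p = 0"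
  and dd_sum_dir: "cdiff f p \<Longrightarrow> dd (\<Sum>i\<in>I. g i) f p = (\<Sum>i\<in>I. dd (g i) f p)"
  using linear_add[OF cdiff_linear(1), of f p u v] linear_diff[OF cdiff_linear(1), of f p u v]
    linear_0[OF cdiff_linear(1), of f p]
    linear_sum[OF cdiff_linear(1), of f p g I]
  by simp_all

lemma cdiff_isCont: "cdiff f p \<Longrightarrow> isCont f p"
  using cdiffD(1) has_derivative_continuous by blast

lemma holomorphic_at_iff: "holomorphic_at f p \<longleftrightarrow> (\<forall>\<^sub>F q in nhds p. cdiff f q)"
  by (auto simp: holomorphic_at_def holomorphic_map_on_def eventually_nhds cdiff_def)

lemma holomorphic_at_cdiff: "holomorphic_at f p \<Longrightarrow> cdiff f p"
  unfolding holomorphic_at_iff by (rule eventually_nhds_x_imp_x)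

lemma holomorphic_at_nearby: "holomorphic_at f p \<Longrightarrow> \<forall>\<^sub>F q in nhds p. holomorphic_at f q"
  by (simp add: holomorphic_at_iff eventually_eventually)

lemma cdiff_transform:
  assumes "\<forall>\<^sub>F x in nhds p. f x = g x"
  shows "cdiff f p = cdiff g p" and "dd v f p = dd v g p"
proof -
  have ev: "\<forall>\<^sub>F x in at p. f x = g x" and p: "f p = g p"
    using assms by (auto intro: eventually_nhds_x_imp_x simp: eventually_nhds_conv_at)
  have eq: "(f has_derivative D) (at p) = (g has_derivative D) (at p)" for D
    using has_derivative_transform_eventually[OF _ ev p]
      has_derivative_transform_eventually[of g D p UNIV f] ev p
    by (auto simp: eq_commute)
  show "cdiff f p = cdiff g p" by (simp add: cdiff_def eq)
  show "dd v f p = dd v g p" by (simp add: dd_def frechet_derivative_def eq)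
qed

lemma eventually_dd_cong:
  assumes "\<forall>\<^sub>F x in nhds p. f x = g x"
  shows "\<forall>\<^sub>F x in nhds p. dd v f x = dd v g x"
proof -
  have "\<forall>\<^sub>F q in nhds p. \<forall>\<^sub>F x in nhds q. f x = g x"
    using assms by (simp add: eventually_eventually)
  then show ?thesis by eventually_elim (rule cdiff_transform)
qed

lemma holomorphic_at_cong:
  assumes "\<forall>\<^sub>F x in nhds p. f x = g x"
  shows "holomorphic_at f p = holomorphic_at g p"
proof -
  have "\<forall>\<^sub>F q in nhds p. \<forall>\<^sub>F x in nhds q. f x = g x"
    using assms by (simp add: eventually_eventually)
  then have "\<forall>\<^sub>F q in nhds p. cdiff f q = cdiff g q" by eventually_elim (rule cdiff_transform)
  then show ?thesis unfolding holomorphic_at_iff by (rule eventually_cong)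
qed

lemma cdiff_compose:
  assumes g: "cdiff g p" and f: "cdiff f (g p)"
  shows "cdiff (\<lambda>x. f (g x)) p" and "dd v (\<lambda>x. f (g x)) p = dd (dd v g p) f (g p)"
  using cdiffI[OF has_derivative_compose[OF cdiffD(1)[OF g] cdiffD(1)[OF f]]]
  by (simp_all add: cdiffD(2) f g)

lemma cdiff_Pair:
  assumes "cdiff f p" "cdiff g p"
  shows "cdiff (\<lambda>x. (f x, g x)) p" and "dd v (\<lambda>x. (f x, g x)) p = (dd v f p, dd v g p)"
  using cdiffI[OF has_derivative_Pair[OF cdiffD(1)[OF assms(1)] cdiffD(1)[OF assms(2)]]]
  by (simp_all add: cdiffD(2) assms)

lemma cdiff_bounded_linear:
  assumes "bounded_linear L" "\<And>c v. L (c *\<^sub>C v) = c *\<^sub>C L v"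
  shows "cdiff L p" and "dd v L p = L v"
  using cdiffI[OF bounded_linear_imp_has_derivative[OF assms(1)]] assms(2) by auto

lemma cdiff_const [simp]: "cdiff (\<lambda>x. k) p" and dd_const [simp]: "dd v (\<lambda>x. k) p = 0"
  using cdiffI[OF has_derivative_const] by auto

lemma cdiff_id [simp]: "cdiff (\<lambda>x. x) p" and dd_id [simp]: "dd v (\<lambda>x. x) p = v"
  using cdiffI[OF has_derivative_ident] by auto

lemma cdiff_fst [simp]: "cdiff fst p" and dd_fst [simp]: "dd v fst p = fst v"
  by (rule cdiff_bounded_linear[OF bounded_linear_fst fst_scaleC])+

lemma cdiff_snd [simp]: "cdiff snd p" and dd_snd [simp]: "dd v snd p = snd v"
  by (rule cdiff_bounded_linear[OF bounded_linear_snd snd_scaleC])+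

lemma cdiff_vec_nth [simp]: "cdiff (\<lambda>x. x $ i) p" and dd_vec_nth [simp]: "dd v (\<lambda>x. x $ i) p = v $ i"
  using cdiff_bounded_linear[OF bounded_linear_vec_nth] by auto

lemma cdiff_add:
  assumes "cdiff f p" "cdiff g p"
  shows "cdiff (\<lambda>x. f x + g x) p" and "dd v (\<lambda>x. f x + g x) p = dd v f p + dd v g p"
  using cdiffI[OF has_derivative_add[OF cdiffD(1)[OF assms(1)] cdiffD(1)[OF assms(2)]]]
  by (simp_all add: cdiffD(2) assms scaleC_add_right)

lemma cdiff_diff:
  assumes "cdiff f p" "cdiff g p"
  shows "cdiff (\<lambda>x. f x - g x) p" and "dd v (\<lambda>x. f x - g x) p = dd v f p - dd v g p"
  using cdiffI[OF has_derivative_diff[OF cdiffD(1)[OF assms(1)] cdiffD(1)[OF assms(2)]]]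
  by (simp_all add: cdiffD(2) assms scaleC_diff_right)

lemma cdiff_sum:
  assumes "\<And>i. i \<in> I \<Longrightarrow> cdiff (f i) p"
  shows "cdiff (\<lambda>x. \<Sum>i\<in>I. f i x) p"
    and "dd v (\<lambda>x. \<Sum>i\<in>I. f i x) p = (\<Sum>i\<in>I. dd v (f i) p)"
  using cdiffI[OF has_derivative_sum[OF cdiffD(1)[OF assms]], of I]
  by (simp_all add: cdiffD(2) assms scaleC_sum_right)

lemma cdiff_mult:
  fixes f g :: "'a::complex_normed_space \<Rightarrow> complex"
  assumes "cdiff f p" "cdiff g p"
  shows "cdiff (\<lambda>x. f x * g x) p"
    and "dd v (\<lambda>x. f x * g x) p = dd v f p * g p + f p * dd v g p"
  using cdiffI[OF has_derivative_mult[OF cdiffD(1)[OF assms(1)] cdiffD(1)[OF assms(2)]]]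
  by (simp_all add: cdiffD(2) assms algebra_simps)

lemma bounded_linear_axis: "bounded_linear (\<lambda>x::'a::complex_normed_space. axis k x :: 'a ^ 'n::finite)"
proof (rule bounded_linear_intro[where K = 1])
  fix x :: 'a
  have "norm (axis k x :: 'a ^ 'n) \<le> (\<Sum>i\<in>UNIV. norm ((axis k x :: 'a ^ 'n) $ i))"
    unfolding norm_vec_def by (rule L2_set_le_sum) simp
  then show "norm (axis k x :: 'a ^ 'n) \<le> norm x * 1"
    by (simp add: axis_def if_distrib[of norm] sum.delta cong: if_cong)
qed (simp_all add: vec_eq_iff axis_def)

lemma cdiff_vec_lambda:
  fixes f :: "'n::finite \<Rightarrow> 'a::complex_normed_space \<Rightarrow> 'b::complex_normed_space"
  assumes "\<And>i. cdiff (f i) p"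
  shows "cdiff (\<lambda>x. \<chi> i. f i x) p" and "dd v (\<lambda>x. \<chi> i. f i x) p = (\<chi> i. dd v (f i) p)"
proof -
  have eq: "(\<lambda>x. \<chi> i. f i x) = (\<lambda>x. \<Sum>i\<in>UNIV. axis i (f i x))"
    by (simp add: fun_eq_iff vec_eq_iff axis_def sum.delta)
  have *: "cdiff (\<lambda>x. axis i (f i x) :: 'b ^ 'n) p"
    "dd v (\<lambda>x. axis i (f i x) :: 'b ^ 'n) p = axis i (dd v (f i) p)" for i
    by (simp_all add: cdiff_compose[OF assms] cdiff_bounded_linear[OF bounded_linear_axis scaleC_axis[symmetric]])
  show "cdiff (\<lambda>x. \<chi> i. f i x) p" unfolding eq using * by (intro cdiff_sum)
  show "dd v (\<lambda>x. \<chi> i. f i x) p = (\<chi> i. dd v (f i) p)"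
    unfolding eq using * by (subst cdiff_sum) (simp_all add: vec_eq_iff axis_def sum.delta)
qed

lemma cdiff_prod:
  fixes f :: "'i \<Rightarrow> 'a::complex_normed_space \<Rightarrow> complex"
  assumes "\<And>i. i \<in> I \<Longrightarrow> cdiff (f i) p"
  shows "cdiff (\<lambda>x. \<Prod>i\<in>I. f i x) p"
  using assms by (induction I rule: infinite_finite_induct) (auto intro: cdiff_mult)

lemma cdiff_power:
  fixes f :: "'a::complex_normed_space \<Rightarrow> complex"
  assumes "cdiff f p"
  shows "cdiff (\<lambda>x. f x ^ n) p"
  using assms by (induction n) (auto intro: cdiff_mult)

section \<open>Calculus of holomorphic maps\<close>

lemma holomorphic_at_isCont: "holomorphic_at f p \<Longrightarrow> isCont f p"
  by (rule cdiff_isCont[OF holomorphic_at_cdiff])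

lemma isCont_tendsto_nhds: "isCont f p \<Longrightarrow> f p = q \<Longrightarrow> filterlim f (nhds q) (nhds p)"
  unfolding isCont_def using tendsto_at_iff_tendsto_nhds by blast

lemma holomorphic_at_filterlim: "holomorphic_at f p \<Longrightarrow> f p = q \<Longrightarrow> filterlim f (nhds q) (nhds p)"
  by (intro isCont_tendsto_nhds holomorphic_at_isCont)

text \<open>Statements about germs are transported along holomorphic maps in this form throughout.\<close>

lemma eventually_holomorphic_compose:
  assumes "\<forall>\<^sub>F y in nhds q. P y" "holomorphic_at f p" "f p = q"
  shows "\<forall>\<^sub>F x in nhds p. P (f x)"
  using eventually_compose_filterlim[OF assms(1) holomorphic_at_filterlim[OF assms(2,3)]] .

lemma holomorphic_at_compose:
  assumes f: "holomorphic_at f q" and g: "holomorphic_at g p" and "g p = q"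
  shows "holomorphic_at (\<lambda>x. f (g x)) p"
proof -
  have "\<forall>\<^sub>F x in nhds p. cdiff f (g x)"
    using eventually_holomorphic_compose[OF _ g \<open>g p = q\<close>] f by (simp add: holomorphic_at_iff)
  with g show ?thesis
    unfolding holomorphic_at_iff by eventually_elim (rule cdiff_compose)
qed

lemma holomorphic_at_id: "holomorphic_at (\<lambda>x. x) p"
  and holomorphic_at_fst: "holomorphic_at fst q"
  and holomorphic_at_snd: "holomorphic_at snd q"
  and holomorphic_at_vec_nth: "holomorphic_at (\<lambda>x. x $ i) r"
  by (simp_all add: holomorphic_at_iff)

lemma holomorphic_at_fst_comp: "holomorphic_at f p \<Longrightarrow> holomorphic_at (\<lambda>x. fst (f x)) p"
  and holomorphic_at_snd_comp: "holomorphic_at f p \<Longrightarrow> holomorphic_at (\<lambda>x. snd (f x)) p"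
  by (rule holomorphic_at_compose[OF holomorphic_at_fst _ refl]
      holomorphic_at_compose[OF holomorphic_at_snd _ refl], assumption)+

lemma holomorphic_at_vec_nth_comp: "holomorphic_at f p \<Longrightarrow> holomorphic_at (\<lambda>x. f x $ i) p"
  by (rule holomorphic_at_compose[OF holomorphic_at_vec_nth _ refl])

lemma holomorphic_at_Pair:
  assumes "holomorphic_at f p" "holomorphic_at g p"
  shows "holomorphic_at (\<lambda>x. (f x, g x)) p"
  using assms unfolding holomorphic_at_iff by eventually_elim (rule cdiff_Pair)

lemma holomorphic_at_diff:
  assumes "holomorphic_at f p" "holomorphic_at g p"
  shows "holomorphic_at (\<lambda>x. f x - g x) p"
  using assms unfolding holomorphic_at_iff by eventually_elim (rule cdiff_diff)

lemma holomorphic_at_vec_lambda: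
  fixes f :: "'n::finite \<Rightarrow> 'a::complex_normed_space \<Rightarrow> 'b::complex_normed_space"
  assumes "\<And>i. holomorphic_at (f i) p"
  shows "holomorphic_at (\<lambda>x. \<chi> i. f i x) p"
proof -
  have "\<forall>\<^sub>F q in nhds p. \<forall>i. cdiff (f i) q"
    using assms by (simp add: holomorphic_at_iff eventually_all_finite)
  then show ?thesis unfolding holomorphic_at_iff by eventually_elim (rule cdiff_vec_lambda, blast)
qed

lemma holomorphic_at_sum:
  fixes f :: "'i \<Rightarrow> 'a::complex_normed_space \<Rightarrow> complex"
  assumes "\<And>i. i \<in> I \<Longrightarrow> holomorphic_at (f i) p"
  shows "holomorphic_at (\<lambda>x. \<Sum>i\<in>I. f i x) p"
  using assms
  by (induction I rule: infinite_finite_induct) (auto intro: holomorphic_at_add holomorphic_at_const)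

lemma holomorphic_at_prod:
  fixes f :: "'i \<Rightarrow> 'a::complex_normed_space \<Rightarrow> complex"
  assumes "\<And>i. i \<in> I \<Longrightarrow> holomorphic_at (f i) p"
  shows "holomorphic_at (\<lambda>x. \<Prod>i\<in>I. f i x) p"
  using assms
  by (induction I rule: infinite_finite_induct) (auto intro: holomorphic_at_mult holomorphic_at_const)

lemma holomorphic_at_power:
  fixes f :: "'a::complex_normed_space \<Rightarrow> complex"
  assumes "holomorphic_at f p"
  shows "holomorphic_at (\<lambda>x. f x ^ n) p"
  using assms by (induction n) (auto intro: holomorphic_at_mult holomorphic_at_const)

lemmas holomorphic_intros = holomorphic_at_const holomorphic_at_id holomorphic_at_fst_comp
  holomorphic_at_snd_comp holomorphic_at_vec_nth_comp holomorphic_at_Pair holomorphic_at_add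
  holomorphic_at_diff holomorphic_at_mult holomorphic_at_minus holomorphic_at_vec_lambda
  holomorphic_at_sum holomorphic_at_prod holomorphic_at_power

section \<open>Cauchy estimates and holomorphic derivatives\<close>

lemma has_field_derivative_line:
  fixes f :: "'a::complex_normed_space \<Rightarrow> complex"
  assumes "cdiff f (p + t *\<^sub>C v)"
  shows "((\<lambda>t. f (p + t *\<^sub>C v)) has_field_derivative dd v f (p + t *\<^sub>C v)) (at t)"
proof -
  have 1: "((\<lambda>t. p + t *\<^sub>C v) has_derivative (\<lambda>s. s *\<^sub>C v)) (at t)"
    using has_derivative_add[OF has_derivative_const
        bounded_linear_imp_has_derivative[OF bounded_linear_scaleC_left[of v]], of p] by simp
  show ?thesis
    using has_derivative_compose[OF 1 cdiffD(1)[OF assms]]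
    by (rule has_derivative_imp_has_field_derivative) (simp add: cdiffD(2)[OF assms] mult.commute)
qed

lemma dd_eq_deriv:
  fixes f :: "'a::complex_normed_space \<Rightarrow> complex"
  assumes "cdiff f p"
  shows "deriv (\<lambda>t. f (p + t *\<^sub>C v)) 0 = dd v f p"
  using has_field_derivative_line[of f p 0 v] assms by (simp add: DERIV_imp_deriv)

lemma holomorphic_on_line:
  fixes f :: "'a::complex_normed_space \<Rightarrow> complex"
  assumes "\<And>t. t \<in> S \<Longrightarrow> cdiff f (p + t *\<^sub>C v)"
  shows "(\<lambda>t. f (p + t *\<^sub>C v)) holomorphic_on S"
  unfolding holomorphic_on_def field_differentiable_def
  using has_field_derivative_line[OF assms] has_field_derivative_at_within by blast

lemma line_in_ball:
  fixes v :: "'a::complex_normed_space"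
  assumes "norm t * norm v < r"
  shows "p + t *\<^sub>C v \<in> ball p r"
  using assms by (simp add: dist_norm norm_scaleC)

text \<open>On the complex line through \<open>p\<close> in the direction \<open>v\<close> this is the Cauchy inequality of one
  variable. It is used on the disc of half the possible radius, whose closure stays in the ball;
  hence the factor 2.\<close>

lemma cauchy_estimate_dd:
  fixes f :: "'a::complex_normed_space \<Rightarrow> complex"
  assumes r: "r > 0" and f: "\<And>x. x \<in> ball p r \<Longrightarrow> cdiff f x"
    and B: "\<And>x. x \<in> ball p r \<Longrightarrow> norm (f x) \<le> B"
  shows "norm (dd v f p) \<le> 2 * B / r * norm v"
proof (cases "v = 0")
  case True
  then show ?thesis using dd_zero_dir[OF f[of p]] r by simp
next
  case False
  define s where "s = r / (2 * norm v)"
  have s: "s > 0" using False r by (simp add: s_def)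
  have in_ball: "p + t *\<^sub>C v \<in> ball p r" if "norm t \<le> s" for t
  proof (rule line_in_ball)
    have "norm t * norm v \<le> s * norm v" using that by (simp add: mult_right_mono)
    also have "\<dots> < r" using False r by (simp add: s_def)
    finally show "norm t * norm v < r" .
  qed
  have hol: "(\<lambda>t. f (p + t *\<^sub>C v)) holomorphic_on cball 0 s"
    using f in_ball by (intro holomorphic_on_line) (simp add: dist_norm)
  have "norm ((deriv ^^ 1) (\<lambda>t. f (p + t *\<^sub>C v)) 0) \<le> fact 1 * B / s ^ 1"
  proof (rule Cauchy_inequality)
    show "(\<lambda>t. f (p + t *\<^sub>C v)) holomorphic_on ball 0 s"
      using hol by (rule holomorphic_on_subset) auto
    show "continuous_on (cball 0 s) (\<lambda>t. f (p + t *\<^sub>C v))"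
      using hol by (rule holomorphic_on_imp_continuous_on)
    show "norm (f (p + x *\<^sub>C v)) \<le> B" if "norm (0 - x) = s" for x
      using that by (intro B in_ball) simp
  qed (rule s)
  also have "fact 1 * B / s ^ 1 = 2 * B / r * norm v"
    using False by (simp add: s_def)
  finally show ?thesis
    using dd_eq_deriv[OF f[of p], of v] r by simp
qed

text \<open>Taylor's formula on a complex line. The second derivative is bounded by Cauchy's inequality on
  discs of radius \<open>s\<close>, so the bound depends on \<open>p\<close> only through \<open>B\<close> and \<open>s\<close>; this uniformity makes the difference
  quotients of \<open>f\<close> converge uniformly.\<close>

lemma dd_quadratic_remainder:
  fixes f :: "'a::complex_normed_space \<Rightarrow> complex"
  assumes r: "r > 0" and f: "\<And>x. x \<in> ball p r \<Longrightarrow> cdiff f x"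
    and B: "\<And>x. x \<in> ball p r \<Longrightarrow> norm (f x) \<le> B"
    and s: "s > 0" "2 * s * norm v < r" and t: "norm t < s"
  shows "norm (f (p + t *\<^sub>C v) - f p - t * dd v f p) \<le> 2 * B / s ^ 2 * norm t ^ 2"
proof -
  define g where "g = (\<lambda>t. f (p + t *\<^sub>C v))"
  have in_ball: "p + t *\<^sub>C v \<in> ball p r" if "norm t \<le> 2 * s" for t
  proof (rule line_in_ball)
    have "norm t * norm v \<le> 2 * s * norm v" using that by (simp add: mult_right_mono)
    also have "\<dots> < r" using s by simp
    finally show "norm t * norm v < r" .
  qed
  have hol: "g holomorphic_on cball 0 (2 * s)"
    unfolding g_def using f in_ball by (intro holomorphic_on_line) (simp add: dist_norm)
  have hol': "g holomorphic_on ball 0 (2 * s)"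
    using hol by (rule holomorphic_on_subset) auto
  note hol2 = hol' holomorphic_deriv[OF hol' open_ball]
  have "norm ((deriv ^^ 0) g t - (\<Sum>i\<le>1. (deriv ^^ i) g 0 * (t - 0) ^ i / fact i))
      \<le> 2 * B / s ^ 2 * norm (t - 0) ^ Suc 1 / fact 1"
  proof (rule field_Taylor[where f = "\<lambda>i. (deriv ^^ i) g" and S = "ball 0 s"])
    fix i :: nat and x :: complex assume x: "x \<in> ball 0 s" and i: "i \<le> 1"
    have x2: "x \<in> ball 0 (2 * s)" using x s by simp
    have "(deriv ^^ i) g holomorphic_on ball 0 (2 * s)"
      by (rule holomorphic_higher_deriv[OF hol' open_ball])
    from holomorphic_derivI[OF this open_ball x2]
    show "((deriv ^^ i) g has_field_derivative (deriv ^^ Suc i) g x) (at x within ball 0 s)"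
      by (simp add: has_field_derivative_at_within)
  next
    fix x assume x: "x \<in> ball (0::complex) s"
    have sub: "cball x s \<subseteq> cball 0 (2 * s)"
      using x by (simp add: cball_subset_cball_iff dist_norm)
    have "norm ((deriv ^^ 2) g x) \<le> fact 2 * B / s ^ 2"
    proof (rule Cauchy_inequality)
      show "g holomorphic_on ball x s"
        using hol by (rule holomorphic_on_subset) (use sub ball_subset_cball in blast)
      show "continuous_on (cball x s) g"
        using hol sub by (blast intro: holomorphic_on_imp_continuous_on continuous_on_subset)
      show "norm (g y) \<le> B" if "norm (x - y) = s" for y
      proof -
        have "y \<in> cball 0 (2 * s)" using that sub by (auto simp: dist_norm)
        then show ?thesis unfolding g_def by (intro B in_ball) simp
      qed
    qed (rule s)
    then show "norm ((deriv ^^ Suc 1) g x) \<le> 2 * B / s ^ 2" by (simp add: numeral_2_eq_2)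
  qed (use s t in auto)
  moreover have "deriv g 0 = dd v f p" unfolding g_def using f r by (simp add: dd_eq_deriv)
  ultimately show ?thesis
    by (simp add: g_def algebra_simps power2_eq_square)
qed

text \<open>By the Cauchy estimates, uniform convergence on a ball forces the derivatives to converge on
  the ball of half the radius, uniformly in the point and in the unit direction.\<close>

lemma uniform_limit_cdiff:
  fixes f :: "'a::complex_normed_space \<Rightarrow> complex"
  assumes r: "r > 0" and F: "\<And>n x. x \<in> ball p r \<Longrightarrow> cdiff (F n) x"
    and lim: "\<And>e. e > 0 \<Longrightarrow> \<forall>\<^sub>F n in sequentially. \<forall>x\<in>ball p r. norm (F n x - f x) \<le> e"
    and x: "x \<in> ball p (r / 2)"
  shows "cdiff f x" and "(\<lambda>n. dd v (F n) x) \<longlonglongrightarrow> dd v f x"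
proof -
  let ?S = "ball p (r / 2)"
  have sub: "ball y (r / 2) \<subseteq> ball p r" if "y \<in> ?S" for y
  proof
    fix z assume "z \<in> ball y (r / 2)"
    then show "z \<in> ball p r"
      using that dist_triangle[of p z y] by simp
  qed
  have diff_bound: "norm (dd h (F m) y - dd h (F n) y) \<le> 8 * e / r * norm h"
    if y: "y \<in> ?S" and m: "\<forall>x\<in>ball p r. norm (F m x - f x) \<le> e"
      and n: "\<forall>x\<in>ball p r. norm (F n x - f x) \<le> e" for y m n e h
  proof -
    have yb: "y \<in> ball p r" using y r by simp
    have "norm (dd h (\<lambda>x. F m x - F n x) y) \<le> 2 * (2 * e) / (r / 2) * norm h"
    proof (rule cauchy_estimate_dd)
      show "norm (F m z - F n z) \<le> 2 * e" if "z \<in> ball y (r / 2)" for z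
        using norm_triangle_ineq4[of "F m z - f z" "F n z - f z"] m n that sub[OF y] by fastforce
    qed (use r sub[OF y] in \<open>auto intro!: cdiff_diff F\<close>)
    then show ?thesis using F[OF yb] r by (simp add: cdiff_diff(2))
  qed
  have cauchy: "Cauchy (\<lambda>n. dd h (F n) y)" if y: "y \<in> ?S" for y h
  proof (rule metric_CauchyI)
    fix e :: real assume e: "e > 0"
    define d where "d = e * r / (8 * (norm h + 1))"
    have d: "d > 0" using e r by (simp add: d_def pos_add_strict add_nonneg_pos)
    obtain N where N: "\<forall>n\<ge>N. \<forall>x\<in>ball p r. norm (F n x - f x) \<le> d"
      using lim[OF d] by (auto simp: eventually_sequentially)
    have "dist (dd h (F m) y) (dd h (F n) y) < e" if "m \<ge> N" "n \<ge> N" for m n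
    proof -
      have "norm h + 1 \<noteq> 0" using norm_ge_zero[of h] by linarith
      have "dist (dd h (F m) y) (dd h (F n) y) \<le> 8 * d / r * norm h"
        unfolding dist_norm using N that by (intro diff_bound y) auto
      also have "\<dots> = e * (norm h / (norm h + 1))" using r \<open>norm h + 1 \<noteq> 0\<close>
        by (simp add: d_def divide_simps)
      also have "\<dots> < e * 1" using e
        by (intro mult_strict_left_mono) (simp_all add: add_nonneg_pos)
      finally show ?thesis by simp
    qed
    then show "\<exists>N. \<forall>m\<ge>N. \<forall>n\<ge>N. dist (dd h (F m) y) (dd h (F n) y) < e" by blast
  qed
  define g' where "g' y h = Topological_Spaces.lim (\<lambda>n. dd h (F n) y)" for y h
  have g': "(\<lambda>n. dd h (F n) y) \<longlonglongrightarrow> g' y h" if "y \<in> ?S" for y h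
    unfolding g'_def using cauchy[OF that] by (simp add: Cauchy_convergent convergent_LIMSEQ_iff[symmetric])
  have ptw: "(\<lambda>n. F n y) \<longlonglongrightarrow> f y" if y: "y \<in> ?S" for y
  proof (rule metric_LIMSEQ_I)
    fix e :: real assume "e > 0"
    moreover have "y \<in> ball p r" using y r by simp
    ultimately have "\<forall>\<^sub>F n in sequentially. norm (F n y - f y) \<le> e / 2"
      using lim[of "e / 2"] by (auto elim: eventually_mono)
    then show "\<exists>N. \<forall>n\<ge>N. dist (F n y) (f y) < e"
      using \<open>e > 0\<close> by (fastforce simp: eventually_sequentially dist_norm)
  qed
  have "\<exists>g. \<forall>x\<in>?S. (\<lambda>n. F n x) \<longlonglongrightarrow> g x \<and> (g has_derivative g' x) (at x within ?S)"
  proof (rule has_derivative_sequence)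
    show "convex ?S" by simp
    show "(F n has_derivative (\<lambda>h. dd h (F n) y)) (at y within ?S)" if "y \<in> ?S" for n y
      by (rule has_derivative_at_withinI, rule cdiffD(1), rule F) (use that r in simp)
    show "p \<in> ?S" using r by simp
    then show "(\<lambda>n. F n p) \<longlonglongrightarrow> f p" by (rule ptw)
    fix e :: real assume e: "e > 0"
    define d where "d = e * r / 8"
    have d: "d > 0" using e r by (simp add: d_def)
    obtain N where N: "\<forall>n\<ge>N. \<forall>x\<in>ball p r. norm (F n x - f x) \<le> d"
      using lim[OF d] by (auto simp: eventually_sequentially)
    have "norm (dd h (F n) y - g' y h) \<le> e * norm h" if n: "n \<ge> N" and y: "y \<in> ?S" for n y h
    proof (rule Lim_bounded)
      show "(\<lambda>m. norm (dd h (F n) y - dd h (F m) y)) \<longlonglongrightarrow> norm (dd h (F n) y - g' y h)"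
        by (intro tendsto_intros g' y)
      show "\<forall>m\<ge>N. norm (dd h (F n) y - dd h (F m) y) \<le> e * norm h"
        using diff_bound[OF y, of n d _ h] N n r by (auto simp: d_def)
    qed
    then show "\<forall>\<^sub>F n in sequentially. \<forall>x\<in>?S. \<forall>h. norm (dd h (F n) x - g' x h) \<le> e * norm h"
      unfolding eventually_sequentially by blast
  qed
  then obtain g where g: "\<And>y. y \<in> ?S \<Longrightarrow> (\<lambda>n. F n y) \<longlonglongrightarrow> g y"
      "\<And>y. y \<in> ?S \<Longrightarrow> (g has_derivative g' y) (at y within ?S)" by blast
  have gf: "g y = f y" if "y \<in> ?S" for y
    using LIMSEQ_unique[OF g(1)[OF that] ptw[OF that]] .
  have "(f has_derivative g' x) (at x within ?S)"
    using has_derivative_transform[OF x _ g(2)[OF x], of f] gf by simp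
  then have der: "(f has_derivative g' x) (at x)"
    using at_within_open[OF x open_ball] by simp
  have lin: "g' x (c *\<^sub>C h) = c *\<^sub>C g' x h" for c h
  proof -
    have "x \<in> ball p r" using x r by simp
    then have "(\<lambda>n. dd (c *\<^sub>C h) (F n) x) \<longlonglongrightarrow> c * g' x h"
      using tendsto_mult_left[OF g'[OF x, of h], of c] F by (simp add: cdiffD(2))
    then show ?thesis using LIMSEQ_unique g'[OF x] by auto
  qed
  show "cdiff f x" by (rule cdiffI(1)[OF der lin])
  show "(\<lambda>n. dd v (F n) x) \<longlonglongrightarrow> dd v f x"
    using g'[OF x] cdiffI(2)[OF der lin] by simp
qed

lemma holomorphic_at_ball:
  fixes f :: "'a::complex_normed_space \<Rightarrow> complex"
  assumes "holomorphic_at f p"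
  obtains r B where "r > 0" "\<forall>x\<in>ball p r. cdiff f x \<and> norm (f x) \<le> B"
proof -
  have "\<forall>\<^sub>F x in nhds p. norm (f x - f p) < 1"
    using isCont_tendsto_nhds[OF holomorphic_at_isCont[OF assms] refl]
    by (simp add: tendsto_iff dist_norm)
  then have "\<forall>\<^sub>F x in nhds p. cdiff f x \<and> norm (f x - f p) < 1"
    using assms unfolding holomorphic_at_iff by eventually_elim simp
  then obtain r where r: "r > 0" "\<forall>x. dist x p < r \<longrightarrow> cdiff f x \<and> norm (f x - f p) < 1"
    by (auto simp: eventually_nhds_metric)
  have "norm (f x) \<le> norm (f p) + 1" if "x \<in> ball p r" for x
  proof -
    have "norm (f x - f p) < 1" using r(2) that by (simp add: dist_commute)
    then show ?thesis using norm_triangle_ineq2[of "f x" "f p"] by linarith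
  qed
  moreover have "cdiff f x" if "x \<in> ball p r" for x
    using r(2) that by (simp add: dist_commute)
  ultimately show ?thesis using r(1) by (intro that[of r "norm (f p) + 1"]) blast+
qed

text \<open>The difference quotients of step \<open>1 / n\<close> exhibit a directional derivative as a locally uniform
  limit of holomorphic functions.\<close>

lemma difference_quotients:
  fixes f :: "'a::complex_normed_space \<Rightarrow> complex"
  assumes "holomorphic_at f p"
  obtains R N where "R > 0" "\<forall>n\<ge>N. \<forall>x\<in>ball p R. cdiff f (x + (1 / of_nat n) *\<^sub>C v)"
    "\<forall>x\<in>ball p R. cdiff f x"
    "\<forall>e>0. \<forall>\<^sub>F n in sequentially. \<forall>x\<in>ball p R.
      norm (of_nat n * (f (x + (1 / of_nat n) *\<^sub>C v) - f x) - dd v f x) \<le> e"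
proof -
  obtain r B where r: "r > 0" and rB: "\<forall>x\<in>ball p r. cdiff f x \<and> norm (f x) \<le> B"
    by (rule holomorphic_at_ball[OF assms])
  then have f: "cdiff f x" and B: "norm (f x) \<le> B" if "x \<in> ball p r" for x
    using that by blast+
  \<comment> \<open>for steps shorter than \<open>s\<close> the discs of radius \<open>2 s\<close> in \<open>dd_quadratic_remainder\<close> stay in a ball of radius \<open>r / 2\<close>\<close>
  define s where "s = r / (4 * (norm v + 1))"
  have s: "s > 0" using r by (simp add: s_def add_nonneg_pos)
  have sv: "2 * s * norm v < r / 2"
  proof -
    have "norm v + 1 \<noteq> 0" using norm_ge_zero[of v] by linarith
    then have "2 * s * norm v = r / 2 * (norm v / (norm v + 1))" by (simp add: s_def divide_simps)
    also have "\<dots> < r / 2 * 1" using r by (intro mult_strict_left_mono) (simp_all add: add_nonneg_pos)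
    finally show ?thesis by simp
  qed
  have sub: "ball y (r / 2) \<subseteq> ball p r" if "y \<in> ball p (r / 2)" for y
  proof
    fix z assume "z \<in> ball y (r / 2)"
    then show "z \<in> ball p r" using that dist_triangle[of p z y] by simp
  qed
  obtain N0 where "inverse (real (Suc N0)) < s"
    using reals_Archimedean[OF s] by blast
  then have "1 / real (Suc N0) < s" unfolding inverse_eq_divide .
  then obtain N where N: "N > 0" "1 / real N < s" by blast
  have Ns: "norm (1 / of_nat n :: complex) < s" "n > 0" if "n \<ge> N" for n
  proof -
    show n: "n > 0" using that N by simp
    have "1 / real n \<le> 1 / real N" using that N by (simp add: frac_le)
    then show "norm (1 / of_nat n :: complex) < s" using N by (simp add: norm_divide)
  qed
  show ?thesis
  proof (rule that[of "r / 2" N])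
    show "\<forall>x\<in>ball p (r / 2). cdiff f x"
      using r by (intro ballI f) simp
    have "cdiff f (x + (1 / of_nat n) *\<^sub>C v)" if "n \<ge> N" "x \<in> ball p (r / 2)" for n x
    proof -
      have "norm (1 / of_nat n :: complex) * norm v \<le> s * norm v"
        using Ns[OF that(1)] by (intro mult_right_mono) auto
      also have "\<dots> \<le> 2 * s * norm v" using s by simp
      finally have "x + (1 / of_nat n) *\<^sub>C v \<in> ball x (r / 2)"
        using sv by (intro line_in_ball) linarith
      then show ?thesis using sub[OF that(2)] f by blast
    qed
    then show "\<forall>n\<ge>N. \<forall>x\<in>ball p (r / 2). cdiff f (x + (1 / of_nat n) *\<^sub>C v)" by blast
    show "\<forall>e>0. \<forall>\<^sub>F n in sequentially. \<forall>x\<in>ball p (r / 2).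
      norm (of_nat n * (f (x + (1 / of_nat n) *\<^sub>C v) - f x) - dd v f x) \<le> e"
    proof (intro allI impI)
      fix e :: real assume e: "e > 0"
      have "(\<lambda>n. 2 * B / s\<^sup>2 * (1 / real n)) \<longlonglongrightarrow> 2 * B / s\<^sup>2 * 0"
        by (intro tendsto_mult_left lim_1_over_n)
      then have "\<forall>\<^sub>F n in sequentially. 2 * B / s\<^sup>2 * (1 / real n) < e"
        using e by (intro order_tendstoD(2)) simp_all
      then show "\<forall>\<^sub>F n in sequentially. \<forall>x\<in>ball p (r / 2).
        norm (of_nat n * (f (x + (1 / of_nat n) *\<^sub>C v) - f x) - dd v f x) \<le> e"
        using eventually_ge_at_top[of N]
      proof eventually_elim
        case (elim n)
        show ?case
        proof
          fix x assume x: "x \<in> ball p (r / 2)"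
          define t :: complex where "t = 1 / of_nat n"
          have t: "norm t < s" "n > 0" "of_nat n * t = 1" "norm t = 1 / real n"
            using Ns[OF elim(2)] by (simp_all add: t_def norm_divide)
          have bd: "norm (f (x + t *\<^sub>C v) - f x - t * dd v f x) \<le> 2 * B / s ^ 2 * norm t ^ 2"
          proof (rule dd_quadratic_remainder[where r = "r / 2"])
            fix y assume "y \<in> ball x (r / 2)"
            then have "y \<in> ball p r" using sub[OF x] by blast
            then show "cdiff f y" "norm (f y) \<le> B" using f B by blast+
          qed (use r s sv t(1) in simp_all)
          have "of_nat n * (f (x + t *\<^sub>C v) - f x) - dd v f x
            = of_nat n * (f (x + t *\<^sub>C v) - f x - t * dd v f x)"
            using arg_cong[OF t(3), of "\<lambda>c. c * dd v f x"] by (simp add: right_diff_distrib mult.assoc)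
          then have "norm (of_nat n * (f (x + t *\<^sub>C v) - f x) - dd v f x)
            = real n * norm (f (x + t *\<^sub>C v) - f x - t * dd v f x)"
            by (simp add: norm_mult)
          also have "\<dots> \<le> real n * (2 * B / s ^ 2 * norm t ^ 2)"
            using bd by (intro mult_left_mono) auto
          also have "\<dots> = 2 * B / s\<^sup>2 * (1 / real n)"
            unfolding t(4) using t(2) by (simp add: power2_eq_square)
          also have "\<dots> \<le> e" using elim by simp
          finally show "norm (of_nat n * (f (x + (1 / of_nat n) *\<^sub>C v) - f x) - dd v f x) \<le> e"
            by (simp add: t_def)
        qed
      qed
    qed
  qed (use r in auto)
qed

lemma cdiff_difference_quotient:
  fixes f :: "'a::complex_normed_space \<Rightarrow> complex"
  assumes "cdiff f (x + h)" "cdiff f x"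
  shows "cdiff (\<lambda>x. c * (f (x + h) - f x)) x"
    and "dd u (\<lambda>x. c * (f (x + h) - f x)) x = c * (dd u f (x + h) - dd u f x)"
proof -
  have sh: "cdiff (\<lambda>x. x + h) x" "dd u (\<lambda>x. x + h) x = u"
    by (simp_all add: cdiff_add[OF cdiff_id cdiff_const])
  have *: "cdiff (\<lambda>x. f (x + h)) x" "dd u (\<lambda>x. f (x + h)) x = dd u f (x + h)"
    using cdiff_compose[OF sh(1), of f] assms sh(2) by simp_all
  show "cdiff (\<lambda>x. c * (f (x + h) - f x)) x"
    "dd u (\<lambda>x. c * (f (x + h) - f x)) x = c * (dd u f (x + h) - dd u f x)"
    using cdiff_mult[OF cdiff_const[of c] cdiff_diff(1)[OF *(1) assms(2)]] *
      cdiff_diff(2)[OF *(1) assms(2)] by simp_all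
qed

text \<open>Both claims come from the difference quotients of \<open>f\<close> in the direction \<open>v\<close>: their uniform
  limit \<open>dd v f\<close> is holomorphic, and their derivatives along \<open>u\<close>, which are the difference
  quotients of \<open>dd u f\<close>, converge both to \<open>dd u (dd v f)\<close> and to \<open>dd v (dd u f)\<close>.\<close>

lemma holomorphic_at_dd:
  fixes f :: "'a::complex_normed_space \<Rightarrow> complex"
  assumes f: "holomorphic_at f p"
  shows "holomorphic_at (dd v f) p"
    and dd_commute: "dd u (dd v f) p = dd v (dd u f) p"
proof -
  have main: "holomorphic_at (dd v f) p \<and>
      (\<exists>N. (\<lambda>n. of_nat (n + N) * (dd u f (p + (1 / of_nat (n + N)) *\<^sub>C v) - dd u f p)) \<longlonglongrightarrow> dd u (dd v f) p)"
    for u v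
  proof -
    obtain R N where R: "R > 0" and 1: "\<forall>n\<ge>N. \<forall>x\<in>ball p R. cdiff f (x + (1 / of_nat n) *\<^sub>C v)"
      and 2: "\<forall>x\<in>ball p R. cdiff f x"
      and 3: "\<forall>e>0. \<forall>\<^sub>F n in sequentially. \<forall>x\<in>ball p R.
        norm (of_nat n * (f (x + (1 / of_nat n) *\<^sub>C v) - f x) - dd v f x) \<le> e"
      by (rule difference_quotients[OF f, of v])
    define F where "F n x = of_nat (n + N) * (f (x + (1 / of_nat (n + N)) *\<^sub>C v) - f x)" for n x
    have 1: "cdiff f (x + (1 / of_nat (n + N)) *\<^sub>C v)" if "x \<in> ball p R" for n x
      using 1[rule_format, of "n + N" x] that by simp
    have F: "cdiff (F n) x" if "x \<in> ball p R" for n x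
      unfolding F_def by (rule cdiff_difference_quotient) (use 1 2 that in blast)+
    have lim: "\<forall>\<^sub>F n in sequentially. \<forall>x\<in>ball p R. norm (F n x - dd v f x) \<le> e" if "e > 0" for e
      unfolding F_def using 3[rule_format, OF that] by (rule eventually_compose_filterlim)
        (rule filterlim_add_const_nat_at_top)
    have ddF: "dd u (F n) p = of_nat (n + N) * (dd u f (p + (1 / of_nat (n + N)) *\<^sub>C v) - dd u f p)" for n
      unfolding F_def
      by (rule cdiff_difference_quotient) (use 1[of p] 2 R in auto)
    have "cdiff (dd v f) x" if "x \<in> ball p (R / 2)" for x
      by (rule uniform_limit_cdiff(1)[where F = F, OF R F lim that])
    moreover have "(\<lambda>n. dd u (F n) p) \<longlonglongrightarrow> dd u (dd v f) p"
      by (rule uniform_limit_cdiff(2)[where F = F, OF R F lim]) (use R in simp_all)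
    ultimately show ?thesis
      unfolding holomorphic_at_iff ddF
      using eventually_nhds_in_open[OF open_ball, of p p "R / 2"] R
      by (auto elim: eventually_mono)
  qed
  then show "holomorphic_at (dd v f) p" by blast
  obtain N where lim1: "(\<lambda>n. of_nat (n + N) * (dd u f (p + (1 / of_nat (n + N)) *\<^sub>C v) - dd u f p))
      \<longlonglongrightarrow> dd u (dd v f) p"
    using main by blast
  obtain R' N' where "R' > 0" and lim': "\<forall>e>0. \<forall>\<^sub>F n in sequentially. \<forall>x\<in>ball p R'.
      norm (of_nat n * (dd u f (x + (1 / of_nat n) *\<^sub>C v) - dd u f x) - dd v (dd u f) x) \<le> e"
    by (rule difference_quotients[OF main[THEN conjunct1], of u v])
  have "(\<lambda>n. of_nat n * (dd u f (p + (1 / of_nat n) *\<^sub>C v) - dd u f p)) \<longlonglongrightarrow> dd v (dd u f) p"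
  proof (rule tendstoI)
    fix e :: real assume "e > 0"
    then have "\<forall>\<^sub>F n in sequentially. \<forall>x\<in>ball p R'.
        norm (of_nat n * (dd u f (x + (1 / of_nat n) *\<^sub>C v) - dd u f x) - dd v (dd u f) x) \<le> e / 2"
      by (intro lim'[rule_format] half_gt_zero)
    then show "\<forall>\<^sub>F n in sequentially. dist (of_nat n * (dd u f (p + (1 / of_nat n) *\<^sub>C v) - dd u f p)) (dd v (dd u f) p) < e"
    proof eventually_elim
      case (elim n)
      then have "norm (of_nat n * (dd u f (p + (1 / of_nat n) *\<^sub>C v) - dd u f p) - dd v (dd u f) p) \<le> e / 2"
        using \<open>R' > 0\<close> by (blast intro: centre_in_ball[THEN iffD2])
      then show ?case unfolding dist_norm using \<open>e > 0\<close> by linarith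
    qed
  qed
  from LIMSEQ_ignore_initial_segment[OF this, of N] show "dd u (dd v f) p = dd v (dd u f) p"
    using LIMSEQ_unique lim1 by blast
qed

section \<open>The holomorphic inverse function theorem\<close>

text \<open>The complex-linear functional whose real part is the inner product with \<open>b\<close>.\<close>

definition complex_functional :: "'b::{complex_normed_space, euclidean_space} \<Rightarrow> 'b \<Rightarrow> complex"
  where "complex_functional b y = complex_of_real (y \<bullet> b) - \<i> * complex_of_real ((\<i> *\<^sub>C y) \<bullet> b)"

lemma scaleC_Re_Im: "c *\<^sub>C (y::'a::complex_normed_space) = Re c *\<^sub>R y + Im c *\<^sub>R (\<i> *\<^sub>C y)"
  by (metis complex_eq mult.commute scaleC_add_left scaleC_scaleC scaleR_scaleC)

lemma cdiff_complex_functional: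
  "cdiff (complex_functional b) y" "dd v (complex_functional b) y = complex_functional b v"
proof -
  have i: "bounded_linear (\<lambda>y. \<i> *\<^sub>C (y::'a))" by (rule bounded_linear_scaleC_right)
  have "bounded_linear (\<lambda>y::'a. complex_of_real (y \<bullet> b) - \<i> * complex_of_real ((\<i> *\<^sub>C y) \<bullet> b))"
    by (intro bounded_linear_sub bounded_linear_compose[OF bounded_linear_of_real]
        bounded_linear_const_mult bounded_linear_inner_left
        bounded_linear_compose[OF bounded_linear_inner_left i])
  then have bl: "bounded_linear (complex_functional b)" by (simp add: complex_functional_def[abs_def])
  have "complex_functional b (c *\<^sub>C w) = c *\<^sub>C complex_functional b w" for c w
  proof -
    have "\<i> *\<^sub>C (c *\<^sub>C w) = Re c *\<^sub>R (\<i> *\<^sub>C w) - Im c *\<^sub>R w"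
      by (simp add: scaleC_scaleC scaleC_Re_Im[of "\<i> * c" w])
    then show ?thesis
      unfolding complex_functional_def scaleC_Re_Im[of c w]
      by (simp add: inner_add_left inner_diff_left complex_eq_iff)
  qed
  then show "cdiff (complex_functional b) y" "dd v (complex_functional b) y = complex_functional b v"
    using cdiff_bounded_linear[OF bl] by auto
qed

text \<open>Composing with complex-linear functionals reduces vector-valued maps to scalar ones, whose
  derivatives are holomorphic.\<close>

lemma isCont_dd:
  fixes f :: "'a::complex_normed_space \<Rightarrow> 'b::{complex_normed_space, euclidean_space}"
  assumes f: "holomorphic_at f p"
  shows "isCont (dd v f) p"
proof -
  have "((\<lambda>x. dd v f x \<bullet> b) \<longlongrightarrow> dd v f p \<bullet> b) (at p)" for b
  proof -
    let ?l = "complex_functional b"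
    have hol: "holomorphic_at (\<lambda>x. ?l (f x)) p"
      by (rule holomorphic_at_compose[OF _ f refl]) (simp add: holomorphic_at_iff cdiff_complex_functional)
    have eq: "Re (dd v (\<lambda>x. ?l (f x)) x) = dd v f x \<bullet> b" if "cdiff f x" for x
    proof -
      have "dd v (\<lambda>x. ?l (f x)) x = ?l (dd v f x)"
        using cdiff_compose(2)[OF that cdiff_complex_functional(1)[where b = b], of v]
        unfolding cdiff_complex_functional(2) .
      then show ?thesis by (simp only:) (simp add: complex_functional_def)
    qed
    have "((\<lambda>x. Re (dd v (\<lambda>x. ?l (f x)) x)) \<longlongrightarrow> Re (dd v (\<lambda>x. ?l (f x)) p)) (at p)"
      using holomorphic_at_isCont[OF holomorphic_at_dd(1)[OF hol, of v]]
      by (intro tendsto_Re) (simp add: isCont_def)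
    moreover have "\<forall>\<^sub>F x in at p. Re (dd v (\<lambda>x. ?l (f x)) x) = dd v f x \<bullet> b"
      using f eq unfolding holomorphic_at_iff by (auto simp: eventually_nhds_conv_at elim: eventually_mono)
    ultimately show ?thesis
      using eq[OF holomorphic_at_cdiff[OF f]] by (auto intro: Lim_transform_eventually)
  qed
  then show ?thesis
    unfolding isCont_def by (subst tendsto_componentwise_iff) blast
qed

text \<open>A holomorphic map is continuously differentiable, so the real inverse function theorem applies.
  The derivative of the local inverse is the inverse of a complex-linear bijection and therefore
  complex-linear.\<close>

lemma holomorphic_inverse_function:
  fixes f :: "'a::{complex_normed_space, euclidean_space} \<Rightarrow> 'a"
  assumes f: "holomorphic_at f p" and inj: "\<And>v. dd v f p = 0 \<Longrightarrow> v = 0"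
  obtains g where "holomorphic_at g (f p)" "g (f p) = p"
    "\<forall>\<^sub>F x in nhds p. g (f x) = x" "\<forall>\<^sub>F y in nhds (f p). f (g y) = y"
proof -
  obtain U where U: "open U" "p \<in> U" "\<And>x. x \<in> U \<Longrightarrow> holomorphic_at f x"
    using holomorphic_at_nearby[OF f] by (auto simp: eventually_nhds)
  define f' where "f' x = Blinfun (\<lambda>v. dd v f x)" for x
  have f': "blinfun_apply (f' x) = (\<lambda>v. dd v f x)" if "x \<in> U" for x
    unfolding f'_def
    by (rule bounded_linear_Blinfun_apply[OF cdiff_linear(2)[OF holomorphic_at_cdiff[OF U(3)[OF that]]]])
  have lin: "linear (\<lambda>v. dd v f p)" by (rule cdiff_linear(1)[OF holomorphic_at_cdiff[OF f]])
  have "inj (\<lambda>v. dd v f p)"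
    using inj linear_injective_0[OF lin] by blast
  then obtain h where h: "linear h" "h \<circ> (\<lambda>v. dd v f p) = id"
    using linear_injective_left_inverse[OF lin] by blast
  have hb: "bounded_linear h" using h(1) by (simp add: linear_conv_bounded_linear)
  have inv: "Blinfun h o\<^sub>L f' p = id_blinfun"
    using h(2) by (intro blinfun_eqI) (simp add: f'[OF U(2)] bounded_linear_Blinfun_apply[OF hb] fun_eq_iff)
  have cont: "continuous_on U f'"
  proof (rule continuous_on_blinfun_componentwise)
    fix i :: 'a
    have "continuous_on U (dd i f)"
      by (intro continuous_at_imp_continuous_on ballI isCont_dd U(3))
    then show "continuous_on U (\<lambda>x. blinfun_apply (f' x) i)"
      by (rule continuous_on_eq) (simp add: f')
  qed
  have der: "(f has_derivative blinfun_apply (f' x)) (at x)" if "x \<in> U" for x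
    using cdiffD(1)[OF holomorphic_at_cdiff[OF U(3)[OF that]]] by (simp add: f'[OF that])
  show ?thesis
  proof (rule inverse_function_theorem[OF U(1) der cont U(2) inv])
    fix U' V g g'
    assume *: "open U'" "U' \<subseteq> U" "p \<in> U'" "open V" "f p \<in> V" "homeomorphism U' V f g"
      "\<And>y. y \<in> V \<Longrightarrow> (g has_derivative g' y) (at y)"
      "\<And>y. y \<in> V \<Longrightarrow> g' y = inv (blinfun_apply (f' (g y)))"
      "\<And>y. y \<in> V \<Longrightarrow> bij (blinfun_apply (f' (g y)))"
    have gU: "g y \<in> U" if "y \<in> V" for y
      using *(2,6) that by (auto simp: homeomorphism_def)
    have cd: "cdiff g y" if y: "y \<in> V" for y
    proof (rule cdiffI(1)[OF *(7)[OF y]])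
      fix c v
      let ?D = "\<lambda>v. dd v f (g y)"
      have D: "bij ?D" "g' y = inv ?D" using *(8,9)[OF y] f'[OF gU[OF y]] by simp_all
      have "?D (c *\<^sub>C inv ?D v) = c *\<^sub>C ?D (inv ?D v)"
        by (rule cdiffD(2)[OF holomorphic_at_cdiff[OF U(3)[OF gU[OF y]]]])
      also have "\<dots> = c *\<^sub>C v" using surj_f_inv_f[OF bij_is_surj[OF D(1)]] by simp
      finally show "g' y (c *\<^sub>C v) = c *\<^sub>C g' y v"
        using inv_f_eq[OF bij_is_inj[OF D(1)]] D(2) by metis
    qed
    show ?thesis
    proof (rule that[of g])
      show "holomorphic_at g (f p)"
        unfolding holomorphic_at_iff using eventually_nhds_in_open[OF *(4,5)] cd by (auto elim: eventually_mono)
      show "g (f p) = p" using *(3,6) by (auto simp: homeomorphism_def)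
      show "\<forall>\<^sub>F x in nhds p. g (f x) = x"
        using eventually_nhds_in_open[OF *(1,3)] *(6) by (auto simp: homeomorphism_def elim: eventually_mono)
      show "\<forall>\<^sub>F y in nhds (f p). f (g y) = y"
        using eventually_nhds_in_open[OF *(4,5)] *(6) by (auto simp: homeomorphism_def elim: eventually_mono)
    qed
  qed
qed

section \<open>Conjugations and uniqueness on their fixed points\<close>

lemma scaleC_half_double: "(1/2) *\<^sub>C (x + x) = (x::'a::complex_normed_space)"
  using scaleC_add_left[of "1/2" "1/2" x] by (simp add: scaleC_add_right scaleC_one)

text \<open>An antilinear isometric involution. Its fixed points form a real subspace \<open>T\<close> such that the
  whole space is the direct sum of \<open>T\<close> and \<open>\<i> T\<close>.\<close>

definition conjugation :: "('a::complex_normed_space \<Rightarrow> 'a) \<Rightarrow> bool"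
  where "conjugation \<tau> \<longleftrightarrow> (\<forall>x y. \<tau> (x + y) = \<tau> x + \<tau> y) \<and> (\<forall>c x. \<tau> (c *\<^sub>C x) = cnj c *\<^sub>C \<tau> x) \<and>
    (\<forall>x. \<tau> (\<tau> x) = x) \<and> (\<forall>x. norm (\<tau> x) = norm x)"

lemma conjugationD:
  assumes "conjugation \<tau>"
  shows "\<tau> (x + y) = \<tau> x + \<tau> y" "\<tau> (c *\<^sub>C x) = cnj c *\<^sub>C \<tau> x" "\<tau> (\<tau> x) = x" "norm (\<tau> x) = norm x"
    "bounded_linear \<tau>" "\<tau> 0 = 0" "\<tau> (x - y) = \<tau> x - \<tau> y"
proof -
  show 1: "\<tau> (x + y) = \<tau> x + \<tau> y" "\<tau> (c *\<^sub>C x) = cnj c *\<^sub>C \<tau> x" "\<tau> (\<tau> x) = x" "norm (\<tau> x) = norm x"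
    for x y c using assms by (simp_all add: conjugation_def)
  show bl: "bounded_linear \<tau>"
    by (rule bounded_linear_intro[where K = 1]) (simp_all add: 1 scaleR_scaleC)
  show "\<tau> 0 = 0" "\<tau> (x - y) = \<tau> x - \<tau> y"
    using bl by (simp_all add: linear_simps)
qed

lemma filterlim_conjugation:
  assumes "conjugation \<tau>" "\<tau> p = q"
  shows "filterlim \<tau> (nhds q) (nhds p)"
  by (rule isCont_tendsto_nhds[OF linear_continuous_at[OF conjugationD(5)[OF assms(1)]] assms(2)])

text \<open>Every \<open>x\<close> is \<open>a + \<i> b\<close> with \<open>a\<close> and \<open>b\<close> fixed by \<open>\<tau>\<close>. On the complex line \<open>t \<mapsto> a + t b\<close>
  the function vanishes for small real \<open>t\<close>, hence by the identity theorem of one variable also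
  at \<open>t = \<i>\<close>.\<close>

lemma holomorphic_zero_of_zero_on_fixed_points:
  fixes f :: "'a::complex_normed_space \<Rightarrow> complex"
  assumes \<tau>: "conjugation \<tau>" and f: "holomorphic_at f 0"
    and zero: "\<forall>\<^sub>F x in nhds 0. \<tau> x = x \<longrightarrow> f x = 0"
  shows "\<forall>\<^sub>F x in nhds 0. f x = 0"
proof -
  note \<tau> = conjugationD[OF \<tau>]
  have "\<forall>\<^sub>F x in nhds 0. cdiff f x \<and> (\<tau> x = x \<longrightarrow> f x = 0)"
    using zero f unfolding holomorphic_at_iff by eventually_elim simp
  then obtain r where r: "r > 0" "\<And>x. x \<in> ball 0 r \<Longrightarrow> cdiff f x \<and> (\<tau> x = x \<longrightarrow> f x = 0)"
    unfolding eventually_nhds_metric by (auto simp: dist_commute)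
  have "f x = 0" if x: "x \<in> ball 0 r" for x
  proof -
    define a where "a = (1/2) *\<^sub>C (x + \<tau> x)"
    define b where "b = (- \<i>/2) *\<^sub>C (x - \<tau> x)"
    define S where "S = {t. a + t *\<^sub>C b \<in> ball 0 r}"
    have ab: "\<tau> a = a" "\<tau> b = b"
      by (simp_all add: a_def b_def \<tau> add.commute scaleC_diff_right scaleC_minus_left)
    have fix_real: "\<tau> (a + complex_of_real s *\<^sub>C b) = a + complex_of_real s *\<^sub>C b" for s
      by (simp add: \<tau> ab)
    have x_eq: "a + \<i> *\<^sub>C b = x"
    proof -
      have "\<i> *\<^sub>C b = (1/2) *\<^sub>C (x - \<tau> x)" by (simp add: b_def scaleC_scaleC)
      then have "a + \<i> *\<^sub>C b = (1/2) *\<^sub>C (x + x)" by (simp add: a_def flip: scaleC_add_right)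
      also have "\<dots> = x" by (rule scaleC_half_double)
      finally show ?thesis .
    qed
    have "norm a \<le> norm x"
      using norm_triangle_ineq[of x "\<tau> x"] by (simp add: a_def norm_scaleC \<tau> norm_divide)
    then have a_in: "a \<in> ball 0 r" using x by simp
    have blb: "bounded_linear (\<lambda>t. t *\<^sub>C b)" by (rule bounded_linear_scaleC_left)
    have contb: "continuous_on UNIV (\<lambda>t. a + t *\<^sub>C b)"
      by (intro continuous_on_add continuous_on_const linear_continuous_on blb)
    have "open S"
      using open_vimage[OF open_ball contb, of 0 r] unfolding S_def vimage_def .
    moreover have "convex S"
    proof -
      have "S = (\<lambda>t. t *\<^sub>C b) -` ball (- a) r"
        unfolding S_def vimage_def by (simp add: dist_norm norm_minus_commute[of _ "- a"])
      then show ?thesis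
        using convex_linear_vimage[OF bounded_linear.linear[OF blb] convex_ball] by simp
    qed
    moreover have "0 \<in> S" "\<i> \<in> S" using a_in x x_eq by (simp_all add: S_def)
    moreover have "0 islimpt (S \<inter> \<real>)"
    proof -
      obtain d where d: "d > 0" "ball 0 d \<subseteq> S"
        using \<open>open S\<close> \<open>0 \<in> S\<close> open_contains_ball by blast
      show ?thesis unfolding islimpt_approachable
      proof (intro allI impI)
        fix e :: real assume e: "e > 0"
        let ?t = "complex_of_real (min d e / 2)"
        have n: "norm ?t = min d e / 2" using d e by (simp del: of_real_divide)
        have "?t \<in> S" using d e n by (intro subsetD[OF d(2)]) (simp add: dist_norm min_def)
        moreover have "?t \<noteq> 0" "norm ?t < e" using d e n by (auto simp: min_def)
        moreover have "?t \<in> \<real>" by simp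
        ultimately show "\<exists>t\<in>S \<inter> \<real>. t \<noteq> 0 \<and> dist t 0 < e" unfolding dist_0_norm dist_commute[of _ 0]
          by blast
      qed
    qed
    moreover have "(\<lambda>t. f (a + t *\<^sub>C b)) holomorphic_on S"
      using r(2) by (intro holomorphic_on_line) (simp add: S_def)
    moreover have "f (a + t *\<^sub>C b) = 0" if "t \<in> S \<inter> \<real>" for t
      using that r(2)[of "a + t *\<^sub>C b"] fix_real by (auto simp: S_def elim!: Reals_cases)
    ultimately have "f (a + \<i> *\<^sub>C b) = 0"
      using analytic_continuation[of "\<lambda>t. f (a + t *\<^sub>C b)" S "S \<inter> \<real>" 0 \<i>] convex_connected by blast
    then show ?thesis by (simp add: x_eq)
  qed
  then show ?thesis
    using eventually_nhds_in_open[OF open_ball, of 0 0 r] r(1) by (auto elim: eventually_mono)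
qed

text \<open>The two antilinear maps compensate each other, so the derivative is complex-linear.\<close>

lemma cdiff_conjugate:
  assumes \<tau>: "conjugation \<tau>" and \<sigma>: "conjugation \<sigma>" and f: "cdiff f (\<tau> p)"
  shows "cdiff (\<lambda>x. \<sigma> (f (\<tau> x))) p" "dd v (\<lambda>x. \<sigma> (f (\<tau> x))) p = \<sigma> (dd (\<tau> v) f (\<tau> p))"
proof -
  note t = conjugationD[OF \<tau>] and s = conjugationD[OF \<sigma>]
  have "((\<lambda>x. \<sigma> (f (\<tau> x))) has_derivative (\<lambda>v. \<sigma> (dd (\<tau> v) f (\<tau> p)))) (at p)"
    by (rule bounded_linear.has_derivative[OF s(5)
          has_derivative_compose[OF bounded_linear_imp_has_derivative[OF t(5)] cdiffD(1)[OF f]]])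
  from cdiffI[OF this] show "cdiff (\<lambda>x. \<sigma> (f (\<tau> x))) p"
      "dd v (\<lambda>x. \<sigma> (f (\<tau> x))) p = \<sigma> (dd (\<tau> v) f (\<tau> p))"
    by (simp_all add: t s cdiffD(2)[OF f])
qed

lemma holomorphic_at_conjugate:
  assumes \<tau>: "conjugation \<tau>" and \<sigma>: "conjugation \<sigma>" and f: "holomorphic_at f q" "\<tau> p = q"
  shows "holomorphic_at (\<lambda>x. \<sigma> (f (\<tau> x))) p"
proof -
  have "\<forall>\<^sub>F x in nhds p. cdiff f (\<tau> x)"
    using f eventually_compose_filterlim[OF _ filterlim_conjugation[OF \<tau> f(2)]] by (simp add: holomorphic_at_iff)
  then show ?thesis unfolding holomorphic_at_iff
    by eventually_elim (rule cdiff_conjugate[OF \<tau> \<sigma>])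
qed

lemma conjugation_cnj: "conjugation cnj"
  by (simp add: conjugation_def)

section \<open>Complexification of real-analytic functions\<close>

text \<open>Each real coordinate \<open>Z \<bullet> b\<close> is the restriction to \<open>\<zeta> = \<tau> Z\<close> of a complex-linear form \<open>L b\<close>
  in \<open>(Z, \<zeta>)\<close>. These forms are substituted into the power series of \<open>r\<close>. Where all of them are
  smaller than \<open>\<delta>\<close>, the series is dominated by the absolutely convergent series of \<open>r\<close> at the point whose
  coordinates all equal \<open>\<delta>\<close>.\<close>

lemma complexification:
  fixes r :: "'a::{complex_normed_space, euclidean_space} \<Rightarrow> real"
  assumes r: "real_analytic_on r U" "0 \<in> U" and \<tau>: "conjugation \<tau>"
  obtains R where "holomorphic_at R 0" "\<forall>\<^sub>F Z in nhds 0. R (Z, \<tau> Z) = complex_of_real (r Z)"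
proof -
  note \<tau> = conjugationD[OF \<tau>]
  obtain e c where e: "e > 0" and c: "\<And>x. x \<in> ball 0 e \<Longrightarrow>
       ((\<lambda>\<alpha>. c \<alpha> * (\<Prod>b\<in>Basis. (x \<bullet> b) ^ \<alpha> b)) has_sum r x) (Basis \<rightarrow>\<^sub>E (UNIV::nat set))"
    using r unfolding real_analytic_on_def by fastforce
  let ?A = "Basis \<rightarrow>\<^sub>E (UNIV::nat set) :: ('a \<Rightarrow> nat) set"
  define L :: "'a \<Rightarrow> 'a \<times> 'a \<Rightarrow> complex" where
    "L b v = complex_of_real (((1/2) *\<^sub>C (fst v + \<tau> (snd v))) \<bullet> b)
      + \<i> * complex_of_real (((- \<i>/2) *\<^sub>C (fst v - \<tau> (snd v))) \<bullet> b)" for b v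
  have Lbl: "bounded_linear (L b)" for b
    unfolding L_def
    by (intro bounded_linear_add bounded_linear_compose[OF bounded_linear_of_real]
        bounded_linear_const_mult bounded_linear_compose[OF bounded_linear_inner_left]
        bounded_linear_compose[OF bounded_linear_scaleC_right] bounded_linear_sub bounded_linear_fst
        bounded_linear_compose[OF \<tau>(5)] bounded_linear_snd)
  have Lc: "L b (k *\<^sub>C v) = k *\<^sub>C L b v" for b k v
  proof -
    define p where "p = (1/2) *\<^sub>C (fst v + \<tau> (snd v))"
    define q where "q = (- \<i>/2) *\<^sub>C (fst v - \<tau> (snd v))"
    have "(1/2) *\<^sub>C (fst (k *\<^sub>C v) + \<tau> (snd (k *\<^sub>C v))) = Re k *\<^sub>R p - Im k *\<^sub>R q"
      "(- \<i>/2) *\<^sub>C (fst (k *\<^sub>C v) - \<tau> (snd (k *\<^sub>C v))) = Re k *\<^sub>R q + Im k *\<^sub>R p"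
    proof -
      have 1: "a *\<^sub>C (k *\<^sub>C x + cnj k *\<^sub>C y)
          = Re k *\<^sub>R (a *\<^sub>C (x + y)) + Im k *\<^sub>R ((\<i> * a) *\<^sub>C (x - y))" for a and x y :: 'a
        unfolding scaleC_Re_Im[of k x] scaleC_Re_Im[of "cnj k" y]
        by (simp add: scaleC_add_right scaleC_diff_right scaleR_scaleC scaleC_scaleC algebra_simps scaleC_minus_left)
      show "(1/2) *\<^sub>C (fst (k *\<^sub>C v) + \<tau> (snd (k *\<^sub>C v))) = Re k *\<^sub>R p - Im k *\<^sub>R q"
        using 1[of "1/2" "fst v" "\<tau> (snd v)"] by (simp add: p_def q_def \<tau> scaleC_minus_left)
      show "(- \<i>/2) *\<^sub>C (fst (k *\<^sub>C v) - \<tau> (snd (k *\<^sub>C v))) = Re k *\<^sub>R q + Im k *\<^sub>R p"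
        using 1[of "- \<i>/2" "fst v" "- \<tau> (snd v)"] by (simp add: p_def q_def \<tau> scaleC_minus_right)
    qed
    then show ?thesis
      unfolding L_def p_def[symmetric] q_def[symmetric]
      by (simp add: inner_add_left inner_diff_left complex_eq_iff)
  qed
  have Lcd: "cdiff (L b) v" for b v by (rule cdiff_bounded_linear[OF Lbl Lc])
  have Lreal: "L b (Z, \<tau> Z) = complex_of_real (Z \<bullet> b)" for b Z
    by (simp add: L_def \<tau> scaleC_half_double)
  \<comment> \<open>small enough that the point with all coordinates \<open>\<delta>\<close> has norm at most \<open>e / 2\<close>\<close>
  define \<delta> where "\<delta> = e / (2 * real (DIM('a)))"
  have \<delta>: "\<delta> > 0" using e by (simp add: \<delta>_def)
  define x0 where "x0 = (\<Sum>b\<in>Basis. \<delta> *\<^sub>R b :: 'a)"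
  have x0: "x0 \<bullet> b = \<delta>" if "b \<in> Basis" for b
    using that by (simp add: x0_def inner_sum_left inner_Basis if_distrib sum.delta cong: if_cong)
  have "norm x0 \<le> (\<Sum>b\<in>Basis. norm (\<delta> *\<^sub>R b :: 'a))" unfolding x0_def by (rule norm_sum)
  also have "\<dots> = e / 2" using \<delta> e by (simp add: \<delta>_def)
  finally have x0e: "x0 \<in> ball 0 e" using e by simp
  define M where "M \<alpha> = norm (c \<alpha> * (\<Prod>b\<in>Basis. (x0 \<bullet> b) ^ \<alpha> b))" for \<alpha>
  have M: "M summable_on ?A"
    unfolding M_def
    using summable_on_iff_abs_summable_on_real[THEN iffD1, OF has_sum_imp_summable[OF c[OF x0e]]] .
  have M_eq: "M \<alpha> = \<bar>c \<alpha>\<bar> * (\<Prod>b\<in>Basis. \<delta> ^ \<alpha> b)" for \<alpha>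
    using \<delta> by (simp add: M_def abs_mult abs_prod x0 power_abs)
  define T where "T \<alpha> v = complex_of_real (c \<alpha>) * (\<Prod>b\<in>Basis. L b v ^ \<alpha> b)" for \<alpha> v
  define R where "R v = (\<Sum>\<^sub>\<infinity>\<alpha>\<in>?A. T \<alpha> v)" for v
  have "\<forall>\<^sub>F v in nhds 0. \<forall>b\<in>Basis. norm (L b v) < \<delta>"
  proof (rule eventually_ball_finite)
    show "\<forall>b\<in>Basis. \<forall>\<^sub>F v in nhds 0. norm (L b v) < \<delta>"
    proof
      fix b
      have "L b 0 = 0" using linear_0[OF bounded_linear.linear[OF Lbl]] .
      then have "filterlim (L b) (nhds 0) (nhds 0)"
        using cdiff_isCont[OF Lcd] by (intro isCont_tendsto_nhds)
      then show "\<forall>\<^sub>F v in nhds 0. norm (L b v) < \<delta>" using \<delta> by (simp add: tendsto_iff)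
    qed
  qed simp
  then obtain s where s: "s > 0" "\<And>v b. v \<in> ball 0 s \<Longrightarrow> b \<in> Basis \<Longrightarrow> norm (L b v) < \<delta>"
    unfolding eventually_nhds_metric by (auto simp: dist_commute)
  have ul: "uniform_limit (ball 0 s) (\<lambda>F v. \<Sum>\<alpha>\<in>F. T \<alpha> v) R (finite_subsets_at_top ?A)"
    unfolding R_def
  proof (rule Weierstrass_m_test_general[OF _ M])
    fix \<alpha> v assume "v \<in> ball (0::'a \<times> 'a) s"
    then have "(\<Prod>b\<in>Basis. norm (L b v) ^ \<alpha> b) \<le> (\<Prod>b\<in>Basis. \<delta> ^ \<alpha> b)"
      using s(2)[THEN less_imp_le] by (intro prod_mono conjI power_mono zero_le_power norm_ge_zero)
    then show "norm (T \<alpha> v) \<le> M \<alpha>"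
      by (simp add: T_def M_eq norm_mult norm_power mult_left_mono flip: prod_norm)
  qed
  have "\<exists>F. finite F \<and> (\<forall>v\<in>ball 0 s. norm ((\<Sum>\<alpha>\<in>F. T \<alpha> v) - R v) \<le> 1 / real (Suc n))" for n
  proof -
    have "\<forall>\<^sub>F F in finite_subsets_at_top ?A. \<forall>v\<in>ball 0 s. dist (\<Sum>\<alpha>\<in>F. T \<alpha> v) (R v) < 1 / real (Suc n)"
      using ul by (rule uniform_limitD) simp
    then show ?thesis
      unfolding eventually_finite_subsets_at_top dist_norm by (meson less_imp_le order_refl)
  qed
  then obtain F where F: "\<And>n. finite (F n)"
    "\<And>n v. v \<in> ball 0 s \<Longrightarrow> norm ((\<Sum>\<alpha>\<in>F n. T \<alpha> v) - R v) \<le> 1 / real (Suc n)" by metis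
  have "cdiff R v" if v: "v \<in> ball 0 (s / 2)" for v
  proof (rule uniform_limit_cdiff(1)[OF s(1) _ _ v, where F = "\<lambda>n v. \<Sum>\<alpha>\<in>F n. T \<alpha> v"])
    show "cdiff (\<lambda>v. \<Sum>\<alpha>\<in>F n. T \<alpha> v) x" for n x
      unfolding T_def by (intro cdiff_sum cdiff_mult cdiff_const cdiff_prod cdiff_power Lcd)
    fix d :: real assume "d > 0"
    then obtain N where N: "inverse (real (Suc N)) < d" using reals_Archimedean by blast
    have "norm ((\<Sum>\<alpha>\<in>F n. T \<alpha> x) - R x) \<le> d" if "n \<ge> N" "x \<in> ball 0 s" for n x
    proof -
      have "1 / real (Suc n) \<le> 1 / real (Suc N)" using that(1) by (simp add: frac_le)
      then show ?thesis using F(2)[OF that(2), of n] N by (simp add: inverse_eq_divide)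
    qed
    then show "\<forall>\<^sub>F n in sequentially. \<forall>x\<in>ball 0 s. norm ((\<Sum>\<alpha>\<in>F n. T \<alpha> x) - R x) \<le> d"
      unfolding eventually_sequentially by blast
  qed
  then have hol: "holomorphic_at R 0"
    unfolding holomorphic_at_iff using eventually_nhds_in_open[OF open_ball, of 0 0 "s / 2"] s(1)
    by (auto elim: eventually_mono)
  have val: "R (Z, \<tau> Z) = complex_of_real (r Z)" if "Z \<in> ball 0 e" for Z
  proof -
    have "((\<lambda>\<alpha>. complex_of_real (c \<alpha> * (\<Prod>b\<in>Basis. (Z \<bullet> b) ^ \<alpha> b))) has_sum complex_of_real (r Z)) ?A"
      by (rule has_sum_bounded_linear[OF bounded_linear_of_real c[OF that]])
    then show ?thesis
      unfolding R_def by (intro infsumI) (simp add: T_def Lreal)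
  qed
  show ?thesis
    by (rule that[OF hol]) (use eventually_nhds_in_open[OF open_ball, of 0 0 e] e val in \<open>auto elim: eventually_mono\<close>)
qed

section \<open>Conjugate points and Wirtinger derivatives\<close>

definition vec_cnj :: "complex ^ 'n::finite \<Rightarrow> complex ^ 'n"
  where "vec_cnj z = (\<chi> i. cnj (z $ i))"

lemma conj_point_Pair [simp]: "conj_point (z, w) = (vec_cnj z, cnj w)"
  by (simp add: conj_point_def vec_cnj_def)

lemma vec_cnj_0 [simp]: "vec_cnj 0 = 0"
  by (simp add: vec_cnj_def vec_eq_iff)

lemma Pair_zero: "(0, 0) = 0"
  by (simp add: zero_prod_def)

lemma conjugation_vec_cnj: "conjugation vec_cnj"
  by (simp add: conjugation_def vec_cnj_def vec_eq_iff norm_vec_def)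

lemma conjugation_Pair:
  assumes "conjugation \<sigma>" "conjugation \<tau>"
  shows "conjugation (\<lambda>(x, y). (\<sigma> x, \<tau> y))"
  unfolding conjugation_def
  by (simp add: conjugationD[OF assms(1)] conjugationD[OF assms(2)] norm_prod_def split: prod.split)

lemma conjugation_swap:
  assumes "conjugation \<sigma>"
  shows "conjugation (\<lambda>(x, y). (\<sigma> y, \<sigma> x))"
  unfolding conjugation_def
  by (simp add: conjugationD[OF assms(1)] norm_prod_def add.commute split: prod.split)

lemma conjugation_conj_point: "conjugation (conj_point :: 'n::finite ambient \<Rightarrow> _)"
proof -
  have "(conj_point :: 'n ambient \<Rightarrow> _) = (\<lambda>(z, w). (vec_cnj z, cnj w))" by auto
  then show ?thesis by (rule ssubst) (rule conjugation_Pair[OF conjugation_vec_cnj conjugation_cnj])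
qed

lemmas conj_point = conjugationD[OF conjugation_conj_point]

text \<open>The conjugation whose fixed points are the pairs \<open>(Z, conj Z)\<close>.\<close>

definition swap_conj :: "'n::finite ambient \<times> 'n ambient \<Rightarrow> 'n ambient \<times> 'n ambient"
  where "swap_conj = (\<lambda>(Z, \<zeta>). (conj_point \<zeta>, conj_point Z))"

lemma swap_conj_Pair [simp]: "swap_conj (Z, \<zeta>) = (conj_point \<zeta>, conj_point Z)"
  by (simp add: swap_conj_def)

lemma conjugation_swap_conj: "conjugation swap_conj"
  unfolding swap_conj_def by (rule conjugation_swap[OF conjugation_conj_point])

text \<open>The real derivative of \<open>Z \<mapsto> G (Z, conj Z)\<close> along \<open>v\<close> is the derivative of \<open>G\<close> along
  \<open>(v, conj v)\<close>. Its complex-linear and antilinear parts in \<open>v\<close> are the Wirtinger derivatives.\<close>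

lemma wirtinger_restriction:
  fixes G :: "'n::finite ambient \<times> 'n ambient \<Rightarrow> complex"
  assumes G: "cdiff G (p, conj_point p)" and f: "\<forall>\<^sub>F Z in nhds p. f Z = G (Z, conj_point Z)"
  shows "frechet_derivative f (at p) v = dd (v, conj_point v) G (p, conj_point p)"
    and "wirtinger v f p = dd (v, 0) G (p, conj_point p)"
    and "wirtinger_conj v f p = dd (0, conj_point v) G (p, conj_point p)"
proof -
  have c: "(conj_point has_derivative conj_point) (at p)"
    by (rule bounded_linear_imp_has_derivative[OF conj_point(5)])
  have "((\<lambda>Z. G (Z, conj_point Z)) has_derivative (\<lambda>v. dd (v, conj_point v) G (p, conj_point p))) (at p)"
    by (rule has_derivative_compose[OF has_derivative_Pair[OF has_derivative_ident c] cdiffD(1)[OF G]])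
  moreover have "\<forall>\<^sub>F Z in at p. G (Z, conj_point Z) = f Z" "G (p, conj_point p) = f p"
    using f by (auto simp: eventually_nhds_conv_at elim: eventually_mono)
  ultimately have "(f has_derivative (\<lambda>v. dd (v, conj_point v) G (p, conj_point p))) (at p)"
    using has_derivative_transform_eventually by blast
  then have fd: "frechet_derivative f (at p) = (\<lambda>v. dd (v, conj_point v) G (p, conj_point p))"
    by (rule frechet_derivative_at[symmetric])
  then show "frechet_derivative f (at p) v = dd (v, conj_point v) G (p, conj_point p)" by simp
  let ?a = "dd (v, 0) G (p, conj_point p)" and ?b = "dd (0, conj_point v) G (p, conj_point p)"
  have 1: "dd (v, conj_point v) G (p, conj_point p) = ?a + ?b"
    using dd_add_dir[OF G, of "(v, 0)" "(0, conj_point v)"] by simp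
  have "(\<i> *\<^sub>C v, conj_point (\<i> *\<^sub>C v)) = \<i> *\<^sub>C ((v, 0) - (0, conj_point v))"
    by (simp add: conj_point scaleC_minus_left scaleC_minus_right)
  then have 2: "dd (\<i> *\<^sub>C v, conj_point (\<i> *\<^sub>C v)) G (p, conj_point p) = \<i> * (?a - ?b)"
    using cdiffD(2)[OF G, of \<i> "(v, 0) - (0, conj_point v)"] dd_diff_dir[OF G, of "(v, 0)" "(0, conj_point v)"]
    by simp
  show "wirtinger v f p = ?a" "wirtinger_conj v f p = ?b"
    unfolding wirtinger_def wirtinger_conj_def fd 1 2 by (simp_all add: field_simps)
qed

type_synonym 'n segre_param = "(complex ^ 'n) \<times> 'n ambient"

abbreviation zdir :: "'n::finite \<Rightarrow> 'n segre_param"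
  where "zdir j \<equiv> (axis j 1, 0)"

lemma partial_z_eq:
  assumes "cdiff f x"
  shows "partial_z k f x = dd (zdir k) f x"
  using dd_eq_deriv[OF assms, of "zdir k"]
  by (cases x) (simp add: partial_z_def)

lemma eventually_partial_z:
  assumes "holomorphic_at f x"
  shows "\<forall>\<^sub>F y in nhds x. partial_z k f y = dd (zdir k) f y"
  using assms unfolding holomorphic_at_iff by eventually_elim (rule partial_z_eq)

lemma dd_z_direction:
  fixes f :: "(complex ^ 'n::finite) \<times> 'n ambient \<Rightarrow> complex"
  assumes "cdiff f x"
  shows "dd (a, 0) f x = (\<Sum>j\<in>UNIV. a $ j * dd (zdir j) f x)"
proof -
  have "(a, 0) = (\<Sum>j\<in>UNIV. (a $ j) *\<^sub>C (zdir j :: 'n segre_param))"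
    by (simp add: prod_eq_iff fst_sum snd_sum vec_eq_iff axis_def
        if_distrib[of "(*) _"] cong: if_cong)
  then have "dd (a, 0) f x = (\<Sum>j\<in>UNIV. dd ((a $ j) *\<^sub>C zdir j) f x)"
    by (simp only: dd_sum_dir[OF assms])
  then show ?thesis by (simp only: cdiffD(2)[OF assms] scaleC_complex_eq)
qed

section \<open>The Segre family and its jets\<close>

text \<open>The function \<open>R\<close> is a complexification of the defining function \<open>r\<close>, and the complexified
  hypersurface \<open>R = 0\<close> is parametrized by \<open>x = (z, \<zeta>)\<close> through \<open>\<rho>\<close>: the Segre variety of the
  conjugate of \<open>\<zeta>\<close> is traced out by \<open>segre_point (z, \<zeta>)\<close>, and \<open>jet_map\<close> adds its slopes.\<close>

locale segre_family =
  fixes M :: "'n::finite ambient set" and U r R \<rho>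
  assumes zero_in_M: "0 \<in> M"
    and ldf: "local_defining_function M 0 U r"
    and R_hol: "holomorphic_at R 0"
    and R_real: "\<forall>\<^sub>F Z in nhds 0. R (Z, conj_point Z) = complex_of_real (r Z)"
    and rho_hol: "holomorphic_at \<rho> 0"
    and rho_0: "\<rho> 0 = 0"
    and R_zero: "\<forall>\<^sub>F ((z, w), \<zeta>) in nhds 0. R ((z, w), \<zeta>) = 0 \<longleftrightarrow> w = \<rho> (z, \<zeta>)"
begin

definition segre_point :: "'n segre_param \<Rightarrow> 'n ambient"
  where "segre_point x = (fst x, \<rho> x)"

definition jet_map :: "'n segre_param \<Rightarrow> 'n jet"
  where "jet_map x = (segre_point x, \<chi> j. dd (zdir j) \<rho> x)"

lemma segre_point_0 [simp]: "segre_point 0 = 0"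
  by (simp add: segre_point_def rho_0 Pair_zero)

lemma segre_point_hol: "holomorphic_at segre_point 0"
  unfolding segre_point_def[abs_def]
  by (intro holomorphic_intros rho_hol)

lemma rho_z_hol: "holomorphic_at (dd v \<rho>) 0"
  by (rule holomorphic_at_dd(1)[OF rho_hol])

lemma jet_map_hol: "holomorphic_at jet_map 0"
  unfolding jet_map_def[abs_def]
  by (intro holomorphic_intros segre_point_hol rho_z_hol)

lemma dd_segre_point:
  assumes "cdiff \<rho> x"
  shows "cdiff segre_point x" "dd v segre_point x = (fst v, dd v \<rho> x)"
  unfolding segre_point_def[abs_def]
  using cdiff_Pair[OF cdiff_fst assms] by simp_all

definition segre_pair :: "'n segre_param \<Rightarrow> 'n ambient \<times> 'n ambient"
  where "segre_pair x = (segre_point x, snd x)"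

lemma segre_pair_0 [simp]: "segre_pair 0 = 0"
  by (simp add: segre_pair_def Pair_zero)

lemma segre_pair_hol: "holomorphic_at segre_pair 0"
  unfolding segre_pair_def[abs_def]
  by (intro holomorphic_intros segre_point_hol)

lemma dd_segre_pair:
  assumes "cdiff \<rho> x"
  shows "cdiff segre_pair x" "dd v segre_pair x = ((fst v, dd v \<rho> x), snd v)"
  unfolding segre_pair_def[abs_def]
  using cdiff_Pair[OF dd_segre_point(1)[OF assms] cdiff_snd] dd_segre_point(2)[OF assms] by simp_all

lemma R_segre_pair: "\<forall>\<^sub>F x in nhds 0. R (segre_pair x) = 0"
  using eventually_holomorphic_compose[OF R_zero segre_pair_hol segre_pair_0]
  by (rule eventually_mono) (simp add: segre_pair_def segre_point_def)

lemma R_cdiff: "cdiff R 0"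
  by (rule holomorphic_at_cdiff[OF R_hol])

lemma rho_cdiff: "cdiff \<rho> 0"
  by (rule holomorphic_at_cdiff[OF rho_hol])

lemma implicit_derivative: "dd ((fst v, dd v \<rho> 0), snd v) R 0 = 0"
proof -
  have "dd v (\<lambda>x. R (segre_pair x)) 0 = dd ((fst v, dd v \<rho> 0), snd v) R 0"
    using cdiff_compose(2)[OF dd_segre_pair(1)[OF rho_cdiff], of R v] R_cdiff dd_segre_pair(2)[OF rho_cdiff]
    by simp
  then show ?thesis
    using cdiff_transform(2)[OF R_segre_pair, of v] by simp
qed

text \<open>The two sides agree on the pairs \<open>(Z, conj Z)\<close> because \<open>r\<close> is real-valued.\<close>

lemma R_conj: "\<forall>\<^sub>F v in nhds 0. R v = cnj (R (swap_conj v))"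
proof -
  have s0: "swap_conj 0 = 0" by (rule conjugationD(6)[OF conjugation_swap_conj])
  have "\<forall>\<^sub>F v in nhds 0. R v - cnj (R (swap_conj v)) = 0"
  proof (rule holomorphic_zero_of_zero_on_fixed_points[OF conjugation_swap_conj])
    show "holomorphic_at (\<lambda>v. R v - cnj (R (swap_conj v))) 0"
      by (intro holomorphic_intros R_hol holomorphic_at_conjugate[OF conjugation_swap_conj conjugation_cnj R_hol s0])
    have "\<forall>\<^sub>F v in nhds (0 :: 'n ambient \<times> 'n ambient). R (fst v, conj_point (fst v)) = complex_of_real (r (fst v))"
      using eventually_holomorphic_compose[OF R_real holomorphic_at_fst fst_zero] .
    then show "\<forall>\<^sub>F v in nhds 0. swap_conj v = v \<longrightarrow> R v - cnj (R (swap_conj v)) = 0"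
    proof eventually_elim
      case (elim v)
      then show ?case by (cases v) auto
    qed
  qed
  then show ?thesis by simp
qed

lemma dd_R_conj: "\<forall>\<^sub>F x in nhds 0. dd v R x = cnj (dd (swap_conj v) R (swap_conj x))"
proof -
  have "\<forall>\<^sub>F x in nhds 0. cdiff R (swap_conj x)"
    using R_hol conjugationD(6)[OF conjugation_swap_conj] unfolding holomorphic_at_iff
    by (intro eventually_compose_filterlim[OF _ filterlim_conjugation[OF conjugation_swap_conj]])
  with eventually_dd_cong[OF R_conj, of v] show ?thesis
    by eventually_elim (simp add: cdiff_conjugate(2)[OF conjugation_swap_conj conjugation_cnj])
qed

lemma R_real_nearby: "\<forall>\<^sub>F p in nhds 0. cdiff R (p, conj_point p) \<and>
    (\<forall>\<^sub>F Z in nhds p. complex_of_real (r Z) = R (Z, conj_point Z))"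
proof -
  have "isCont (\<lambda>p. (p, conj_point p)) (0::'n ambient)"
    using linear_continuous_at[OF conj_point(5)] by (intro continuous_intros)
  then have "filterlim (\<lambda>p. (p, conj_point p)) (nhds 0) (nhds (0::'n ambient))"
    by (rule isCont_tendsto_nhds) (simp add: conj_point Pair_zero)
  from eventually_compose_filterlim[OF _ this] R_hol
  have "\<forall>\<^sub>F p in nhds 0. cdiff R (p, conj_point p)" by (simp add: holomorphic_at_iff)
  moreover have "\<forall>\<^sub>F p in nhds 0. \<forall>\<^sub>F Z in nhds p. complex_of_real (r Z) = R (Z, conj_point Z)"
    using R_real by (simp add: eventually_eventually eq_commute)
  ultimately show ?thesis by eventually_elim simp
qed

lemma wirtinger_r:
  "wirtinger v (\<lambda>q. complex_of_real (r q)) 0 = dd (v, 0) R 0"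
  "levi_form r 0 u v = dd (u, 0) (dd (0, conj_point v) R) 0"
proof -
  have 0: "(0, conj_point (0::'n ambient)) = 0" by (simp add: conj_point Pair_zero)
  show "wirtinger v (\<lambda>q. complex_of_real (r q)) 0 = dd (v, 0) R 0"
    by (rule wirtinger_restriction(2)[of R 0, unfolded 0, OF R_cdiff])
      (use eventually_nhds_x_imp_x[OF R_real_nearby] in blast)
  have "\<forall>\<^sub>F q in nhds 0. wirtinger_conj v (\<lambda>q. complex_of_real (r q)) q = dd (0, conj_point v) R (q, conj_point q)"
    using R_real_nearby by eventually_elim (blast intro: wirtinger_restriction(3))
  then show "levi_form r 0 u v = dd (u, 0) (dd (0, conj_point v) R) 0"
    unfolding levi_form_def
    using wirtinger_restriction(2)[of "dd (0, conj_point v) R" 0] holomorphic_at_cdiff[OF holomorphic_at_dd(1)[OF R_hol]]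
    by (simp add: 0)
qed

lemma levi_form_hermitian: "levi_form r 0 u v = cnj (levi_form r 0 v u)"
proof -
  have s0: "swap_conj 0 = (0::'n ambient \<times> 'n ambient)" by (rule conjugationD(6)[OF conjugation_swap_conj])
  have "dd (u, 0) (dd (0, conj_point v) R) 0 = dd (u, 0) (\<lambda>x. cnj (dd (v, 0) R (swap_conj x))) 0"
    using cdiff_transform(2)[OF dd_R_conj[of "(0, conj_point v)"], of "(u, 0)"] by (simp add: conj_point)
  also have "\<dots> = cnj (dd (0, conj_point u) (dd (v, 0) R) 0)"
    using cdiff_conjugate(2)[OF conjugation_swap_conj conjugation_cnj, of "dd (v, 0) R" 0 "(u, 0)"]
      holomorphic_at_cdiff[OF holomorphic_at_dd(1)[OF R_hol]] s0 by (simp add: conj_point)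
  also have "\<dots> = cnj (dd (v, 0) (dd (0, conj_point u) R) 0)"
    by (simp add: dd_commute[OF R_hol, of "(v, 0)"])
  finally show ?thesis by (simp add: wirtinger_r)
qed

text \<open>If \<open>R\<^sub>w\<close> vanished at the origin, then \<open>implicit_derivative\<close> would make the whole derivative of
  \<open>R\<close> vanish there, and with it that of \<open>r\<close>.\<close>

lemma R_w_nonzero: "dd ((0, 1), 0) R 0 \<noteq> 0"
proof
  assume c: "dd ((0, 1), 0) R 0 = 0"
  have "dd ((a, b), \<zeta>) R 0 = 0" for a b \<zeta>
  proof -
    let ?d = "dd (a, \<zeta>) \<rho> 0"
    have "((a, b), \<zeta>) = ((a, ?d), \<zeta>) + (b - ?d) *\<^sub>C ((0, 1), 0)" by simp
    then have "dd ((a, b), \<zeta>) R 0 = dd ((a, ?d), \<zeta>) R 0 + (b - ?d) * dd ((0, 1), 0) R 0"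
      by (simp only: dd_add_dir[OF R_cdiff] cdiffD(2)[OF R_cdiff] scaleC_complex_eq)
    then show ?thesis using implicit_derivative[of "(a, \<zeta>)"] c by simp
  qed
  then have z: "dd v R 0 = 0" for v by (metis surj_pair)
  have 0: "(0, conj_point (0::'n ambient)) = 0" by (simp add: conj_point Pair_zero)
  have "((\<lambda>Z. R (Z, conj_point Z)) has_derivative (\<lambda>v. dd (v, conj_point v) R (0, conj_point 0))) (at 0)"
    by (rule has_derivative_compose[OF has_derivative_Pair[OF has_derivative_ident
            bounded_linear_imp_has_derivative[OF conj_point(5)]] cdiffD(1)]) (simp add: 0 R_cdiff)
  then have "((\<lambda>Z. Re (R (Z, conj_point Z))) has_derivative (\<lambda>v. 0)) (at 0)"
    using has_derivative_Re by (fastforce simp: 0 z)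
  moreover have "\<forall>\<^sub>F Z in at 0. Re (R (Z, conj_point Z)) = r Z" "Re (R (0, conj_point 0)) = r 0"
    using R_real by (auto simp: eventually_nhds_conv_at elim: eventually_mono)
  ultimately have "(r has_derivative (\<lambda>v. 0)) (at 0)"
    using has_derivative_transform_eventually by blast
  then have "frechet_derivative r (at 0) = (\<lambda>_. 0)"
    by (rule frechet_derivative_at[symmetric])
  then show False using ldf by (auto simp: local_defining_function_def)
qed

lemma R_w_dir: "dd ((0, b), 0) R 0 = b * dd ((0, 1), 0) R 0"
  using cdiffD(2)[OF R_cdiff, of b "((0, 1), 0)"] by simp

text \<open>A direction \<open>v\<close> in the kernel of the derivative of the jet map has the form \<open>(0, \<eta>)\<close>. Since the
  derivative of \<open>\<rho>\<close> along \<open>v\<close> vanishes, the conjugate of \<open>\<eta>\<close> is a complex tangent vector.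
  Differentiating the identity \<open>R (segre_pair x) = 0\<close> along \<open>v\<close> and then along a direction in \<open>z\<close>
  leaves at the origin only the value of the Levi form on the corresponding tangent vector and the
  conjugate of \<open>\<eta>\<close>; all other terms contain derivatives of \<open>\<rho>\<close> or \<open>\<rho>\<^sub>z\<close> along \<open>v\<close>. So the conjugate
  of \<open>\<eta>\<close> lies in the kernel of the Levi form.\<close>

lemma jet_map_immersion:
  assumes levi: "levi_nondegenerate M" and v: "dd v jet_map 0 = 0"
  shows "v = 0"
proof -
  obtain a0 \<eta> where v_eq: "v = (a0, \<eta>)" by (cases v)
  have "dd v jet_map 0 = (dd v segre_point 0, \<chi> j. dd v (dd (zdir j) \<rho>) 0)"
    unfolding jet_map_def[abs_def]
    by (simp add: cdiff_Pair cdiff_vec_lambda dd_segre_point rho_cdiff holomorphic_at_cdiff rho_z_hol)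
  with v have v0: "a0 = 0" "dd v \<rho> 0 = 0" "dd v (dd (zdir j) \<rho>) 0 = 0" for j
    by (simp_all add: dd_segre_point(2)[OF rho_cdiff] v_eq prod_eq_iff vec_eq_iff)
  have conj_tangent: "conj_point \<eta> \<in> complex_tangent_space r 0"
  proof -
    have "dd (0, \<eta>) R 0 = 0" using implicit_derivative[of v] v0 by (simp add: v_eq Pair_zero)
    then have "dd (conj_point \<eta>, 0) R 0 = 0"
      using eventually_nhds_x_imp_x[OF dd_R_conj[of "(conj_point \<eta>, 0)"]]
      by (simp add: conj_point conjugationD(6)[OF conjugation_swap_conj])
    then show ?thesis by (simp add: complex_tangent_space_def wirtinger_r)
  qed
  have "levi_form r 0 (conj_point \<eta>) u = 0" if u: "u \<in> complex_tangent_space r 0" for u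
  proof -
    obtain a b where u_eq: "u = (a, b)" by (cases u)
    let ?e = "(a, 0) :: 'n segre_param"
    \<comment> \<open>complex tangent vectors are tangent to the Segre variety \<open>w = \<rho> (z, 0)\<close>\<close>
    have b: "b = dd ?e \<rho> 0"
    proof -
      have "dd (((a, b), 0) - ((a, dd ?e \<rho> 0), 0)) R 0 = 0"
        using u implicit_derivative[of ?e]
        by (subst dd_diff_dir[OF R_cdiff]) (simp add: complex_tangent_space_def wirtinger_r u_eq)
      then have "(b - dd ?e \<rho> 0) * dd ((0, 1), 0) R 0 = 0"
        using R_w_dir[of "b - dd ?e \<rho> 0"] by (simp add: Pair_zero)
      then show ?thesis using R_w_nonzero by simp
    qed
    have mixed: "dd ?e (dd v \<rho>) 0 = 0"
    proof -
      have "\<forall>\<^sub>F x in nhds 0. dd ?e \<rho> x = (\<Sum>j\<in>UNIV. a $ j * dd (zdir j) \<rho> x)"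
        using rho_hol unfolding holomorphic_at_iff by eventually_elim (rule dd_z_direction)
      then have "dd v (dd ?e \<rho>) 0 = dd v (\<lambda>x. \<Sum>j\<in>UNIV. a $ j * dd (zdir j) \<rho> x) 0"
        by (rule cdiff_transform(2))
      also have "\<dots> = (\<Sum>j\<in>UNIV. dd v (\<lambda>x. a $ j * dd (zdir j) \<rho> x) 0)"
        by (intro cdiff_sum(2) cdiff_mult cdiff_const holomorphic_at_cdiff rho_z_hol)
      also have "\<dots> = 0"
        using v0(3) by (intro sum.neutral ballI) (simp add: cdiff_mult(2) holomorphic_at_cdiff rho_z_hol)
      finally show ?thesis using dd_commute[OF rho_hol, of ?e v] by simp
    qed
    let ?Rw = "\<lambda>x. dd ((0, 1), 0) R (segre_pair x)"
    let ?Re = "\<lambda>x. dd (0, \<eta>) R (segre_pair x)"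
    have Rcd: "\<forall>\<^sub>F x in nhds 0. cdiff R (segre_pair x)"
      using eventually_holomorphic_compose[OF _ segre_pair_hol segre_pair_0] R_hol
      by (simp add: holomorphic_at_iff)
    have "\<forall>\<^sub>F x in nhds 0. dd v (\<lambda>x. R (segre_pair x)) x = 0"
      using eventually_dd_cong[OF R_segre_pair, of v] by simp
    then have "\<forall>\<^sub>F x in nhds 0. dd v \<rho> x * ?Rw x + ?Re x = 0"
      using Rcd rho_hol unfolding holomorphic_at_iff
    proof eventually_elim
      case (elim x)
      have "dd ((0, dd v \<rho> x), \<eta>) R (segre_pair x) = dd v \<rho> x * ?Rw x + ?Re x"
        using dd_add_dir[OF elim(2), of "dd v \<rho> x *\<^sub>C ((0, 1), 0)" "(0, \<eta>)"]
          cdiffD(2)[OF elim(2), of "dd v \<rho> x" "((0, 1), 0)"] by simp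
      then show ?case
        using elim(1) cdiff_compose(2)[OF dd_segre_pair(1)[OF elim(3)] elim(2), of v]
          dd_segre_pair(2)[OF elim(3), of v] v0(1)
        by (simp add: v_eq)
    qed
    then have "dd ?e (\<lambda>x. dd v \<rho> x * ?Rw x + ?Re x) 0 = 0"
      using cdiff_transform(2)[of "\<lambda>x. dd v \<rho> x * ?Rw x + ?Re x" "\<lambda>_. 0"] by simp
    moreover have cds: "cdiff (dd v \<rho>) 0" "cdiff ?Rw 0" "cdiff ?Re 0" "cdiff (dd (0, \<eta>) R) (segre_pair 0)"
      unfolding segre_pair_0
      by (intro holomorphic_at_cdiff rho_z_hol holomorphic_at_compose[OF _ segre_pair_hol segre_pair_0]
          holomorphic_at_dd(1)[OF R_hol])+
    ultimately have "dd ?e ?Re 0 = 0"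
      using mixed v0(2) by (simp add: cdiff_add(2) cdiff_mult)
    moreover have "dd ?e ?Re 0 = dd (u, 0) (dd (0, \<eta>) R) 0"
      using cdiff_compose(2)[OF dd_segre_pair(1)[OF rho_cdiff] cds(4), of ?e]
        dd_segre_pair(2)[OF rho_cdiff, of ?e] b u_eq by simp
    ultimately have "levi_form r 0 u (conj_point \<eta>) = 0"
      by (simp add: wirtinger_r conj_point)
    then show ?thesis using levi_form_hermitian[of "conj_point \<eta>" u] by simp
  qed
  then have "conj_point \<eta> = 0"
    using levi ldf zero_in_M conj_tangent unfolding levi_nondegenerate_def by blast
  then have "\<eta> = 0" by (metis conj_point(3) conj_point(6))
  then show ?thesis using v0(1) by (simp add: v_eq Pair_zero)
qed

text \<open>Jets are regrouped as \<open>(z, (w', w))\<close>, which turns the jet map into a map of one space to itself,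
  as the inverse function theorem requires.\<close>

definition jet_reorder :: "'n jet \<Rightarrow> 'n segre_param"
  where "jet_reorder p = (fst (fst p), (snd p, snd (fst p)))"

lemma jet_reorder_hol: "holomorphic_at jet_reorder p"
  unfolding jet_reorder_def[abs_def] by (intro holomorphic_intros)

lemma jet_reorder_inject: "jet_reorder p = jet_reorder q \<Longrightarrow> p = q"
  by (simp add: jet_reorder_def prod_eq_iff)

lemma jet_base_point_eq: "jet_base_point \<rho> = jet_map 0"
  by (simp add: jet_base_point_def jet_map_def partial_z_eq[OF rho_cdiff])

lemma jet_map_inverse:
  assumes "levi_nondegenerate M"
  obtains g where "holomorphic_at g (jet_reorder (jet_map 0))" "g (jet_reorder (jet_map 0)) = 0"
    "\<forall>\<^sub>F x in nhds 0. g (jet_reorder (jet_map x)) = x"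
    "\<forall>\<^sub>F y in nhds (jet_reorder (jet_map 0)). jet_reorder (jet_map (g y)) = y"
proof -
  have "holomorphic_at (\<lambda>x. jet_reorder (jet_map x)) 0"
    by (rule holomorphic_at_compose[OF jet_reorder_hol jet_map_hol refl])
  moreover have "v = 0" if "dd v (\<lambda>x. jet_reorder (jet_map x)) 0 = 0" for v
  proof -
    have "bounded_linear (jet_reorder :: 'n jet \<Rightarrow> _)"
      unfolding jet_reorder_def[abs_def]
      by (intro bounded_linear_Pair bounded_linear_compose[OF bounded_linear_fst]
          bounded_linear_compose[OF bounded_linear_snd] bounded_linear_fst bounded_linear_snd)
    then have *: "cdiff (jet_reorder :: 'n jet \<Rightarrow> _) q" "dd u (jet_reorder :: 'n jet \<Rightarrow> _) q = jet_reorder u" for q u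
      by (rule cdiff_bounded_linear; simp add: jet_reorder_def)+
    have "jet_reorder (dd v jet_map 0) = 0"
      using that cdiff_compose(2)[OF holomorphic_at_cdiff[OF jet_map_hol] *(1), of v] *(2) by simp
    then have "dd v jet_map 0 = 0" by (simp add: jet_reorder_def prod_eq_iff)
    then show ?thesis by (rule jet_map_immersion[OF assms])
  qed
  ultimately show ?thesis
    using that by (rule holomorphic_inverse_function[of "\<lambda>x. jet_reorder (jet_map x)" 0])
qed

lemma segre_parameters_exist:
  assumes "levi_nondegenerate M"
  obtains A B where "segre_parameters \<rho> A B"
proof -
  obtain g where g: "holomorphic_at g (jet_reorder (jet_map 0))" "g (jet_reorder (jet_map 0)) = 0"
    "\<forall>\<^sub>F x in nhds 0. g (jet_reorder (jet_map x)) = x"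
    "\<forall>\<^sub>F y in nhds (jet_reorder (jet_map 0)). jet_reorder (jet_map (g y)) = y"
    by (rule jet_map_inverse[OF assms])
  define G where "G p = g (jet_reorder p)" for p
  have G: "holomorphic_at G (jet_map 0)" "G (jet_map 0) = 0"
    unfolding G_def using holomorphic_at_compose[OF g(1) jet_reorder_hol refl] g(2) by auto
  have inv: "\<forall>\<^sub>F p in nhds (jet_map 0). jet_map (G p) = p"
    using eventually_holomorphic_compose[OF g(4) jet_reorder_hol refl] unfolding G_def
    by (rule eventually_mono) (rule jet_reorder_inject)
  have "\<forall>\<^sub>F x in nhds 0. \<forall>j. partial_z j \<rho> x = dd (zdir j) \<rho> x"
    using eventually_partial_z[OF rho_hol] by (simp add: eventually_all_finite)
  from eventually_holomorphic_compose[OF this G]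
  have pz: "\<forall>\<^sub>F p in nhds (jet_map 0). \<forall>j. partial_z j \<rho> (G p) = dd (zdir j) \<rho> (G p)" .
  show ?thesis
  proof (rule that)
    show "segre_parameters \<rho> (\<lambda>p. fst (snd (G p))) (\<lambda>p. snd (snd (G p)))"
      unfolding segre_parameters_def jet_base_point_eq
    proof (intro conjI)
      show "\<forall>\<^sub>F ((z, w), w') in nhds (jet_map 0).
        w = \<rho> (z, fst (snd (G ((z, w), w'))), snd (snd (G ((z, w), w')))) \<and>
        (\<forall>j. w' $ j = partial_z j \<rho> (z, fst (snd (G ((z, w), w'))), snd (snd (G ((z, w), w')))))"
        using inv pz
      proof eventually_elim
        case (elim p)
        obtain z w w' where p: "p = ((z, w), w')" by (metis surj_pair)
        have "fst (G p) = z" using elim(1) by (simp add: p jet_map_def segre_point_def)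
        then have "(z, fst (snd (G p)), snd (snd (G p))) = G p" by (metis prod.collapse)
        then show ?case using elim by (auto simp: p jet_map_def segre_point_def vec_eq_iff)
      qed
    qed (simp_all add: G holomorphic_at_fst_comp holomorphic_at_snd_comp)
  qed
qed

definition jet_inverse :: "('n jet \<Rightarrow> complex ^ 'n) \<Rightarrow> ('n jet \<Rightarrow> complex) \<Rightarrow> 'n jet \<Rightarrow> 'n segre_param"
  where "jet_inverse A B p = (fst (fst p), (A p, B p))"

text \<open>Segre parameters are by definition a right inverse of the jet map. Since the jet map is locally
  injective they are a two-sided inverse, whichever pair \<open>A\<close>, \<open>B\<close> has been chosen.\<close>

lemma jet_inverse:
  assumes levi: "levi_nondegenerate M" and AB: "segre_parameters \<rho> A B"
  shows "holomorphic_at (jet_inverse A B) (jet_map 0)" "jet_inverse A B (jet_map 0) = 0"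
    "\<forall>\<^sub>F p in nhds (jet_map 0). jet_map (jet_inverse A B p) = p"
    "\<forall>\<^sub>F x in nhds 0. jet_inverse A B (jet_map x) = x"
proof -
  let ?S = "jet_inverse A B"
  note AB = AB[unfolded segre_parameters_def jet_base_point_eq]
  show hol: "holomorphic_at ?S (jet_map 0)"
    unfolding jet_inverse_def[abs_def] using AB by (intro holomorphic_intros) auto
  show S0: "?S (jet_map 0) = 0"
    using AB by (simp add: jet_inverse_def jet_map_def Pair_zero segre_point_def)
  have "\<forall>\<^sub>F x in nhds 0. \<forall>j. partial_z j \<rho> x = dd (zdir j) \<rho> x"
    using eventually_partial_z[OF rho_hol] by (simp add: eventually_all_finite)
  from eventually_holomorphic_compose[OF this hol S0]
  have pz: "\<forall>\<^sub>F p in nhds (jet_map 0). \<forall>j. partial_z j \<rho> (?S p) = dd (zdir j) \<rho> (?S p)" .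
  have "\<forall>\<^sub>F ((z, w), w') in nhds (jet_map 0).
       w = \<rho> (z, A ((z, w), w'), B ((z, w), w')) \<and>
       (\<forall>j. w' $ j = partial_z j \<rho> (z, A ((z, w), w'), B ((z, w), w')))" using AB by blast
  with pz show inv: "\<forall>\<^sub>F p in nhds (jet_map 0). jet_map (?S p) = p"
  proof eventually_elim
    case (elim p)
    then show ?case
      by (auto simp: jet_map_def jet_inverse_def segre_point_def vec_eq_iff split: prod.splits)
  qed
  obtain g where g: "\<forall>\<^sub>F x in nhds 0. g (jet_reorder (jet_map x)) = x"
    by (rule jet_map_inverse[OF levi])
  have "holomorphic_at (\<lambda>x. ?S (jet_map x)) 0"
    by (rule holomorphic_at_compose[OF hol jet_map_hol refl])
  from eventually_holomorphic_compose[OF g this S0]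
  have "\<forall>\<^sub>F x in nhds 0. g (jet_reorder (jet_map (?S (jet_map x)))) = ?S (jet_map x)" .
  with g eventually_holomorphic_compose[OF inv jet_map_hol refl]
  show "\<forall>\<^sub>F x in nhds 0. ?S (jet_map x) = x"
    by eventually_elim simp
qed

end

section \<open>Existence of complex defining functions\<close>

lemma complex_defining_function_segre_family:
  assumes "complex_defining_function M \<rho>" "0 \<in> M"
  obtains U r R where "segre_family M U r R \<rho>"
  using assms unfolding complex_defining_function_def segre_family_def by blast

text \<open>The complexified defining equation is solved for \<open>w\<close> by inverting
  \<open>((z, w), \<zeta>) \<mapsto> ((z, R ((z, w), \<zeta>)), \<zeta>)\<close>.\<close>

lemma complex_defining_function_exists:
  fixes M :: "'n::finite ambient set"
  assumes M: "0 \<in> M" and solv: "solvable_for_w M"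
  obtains \<rho> where "complex_defining_function M \<rho>"
proof -
  obtain U r where ldf: "local_defining_function M 0 U r"
    and w: "wirtinger (0, 1) (\<lambda>Z. complex_of_real (r Z)) 0 \<noteq> 0"
    using solv unfolding solvable_for_w_def by blast
  have "real_analytic_on r U" "0 \<in> U" using ldf by (auto simp: local_defining_function_def)
  then obtain R where R: "holomorphic_at R 0" "\<forall>\<^sub>F Z in nhds 0. R (Z, conj_point Z) = complex_of_real (r Z)"
    by (rule complexification[OF _ _ conjugation_conj_point])
  have 0: "(0, conj_point (0::'n ambient)) = 0" by (simp add: conj_point Pair_zero)
  have Rcd: "cdiff R 0" by (rule holomorphic_at_cdiff[OF R(1)])
  have R_real: "\<forall>\<^sub>F Z in nhds 0. complex_of_real (r Z) = R (Z, conj_point Z)"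
    using R(2) by (simp add: eq_commute)
  have Rw: "dd ((0, 1), 0) R 0 \<noteq> 0"
    using w wirtinger_restriction(2)[of R 0, unfolded 0, OF Rcd R_real] by simp
  have "r 0 = 0" using M ldf by (auto simp: local_defining_function_def)
  then have R0: "R 0 = 0" using eventually_nhds_x_imp_x[OF R(2)] by (simp add: 0)
  define f where "f v = ((fst (fst v), R v), snd v)" for v :: "'n ambient \<times> 'n ambient"
  have f: "holomorphic_at f 0"
    unfolding f_def[abs_def] by (intro holomorphic_intros R(1))
  have f0: "f 0 = 0" by (simp add: f_def R0 Pair_zero)
  have df: "dd v f 0 = ((fst (fst v), dd v R 0), snd v)" for v
  proof -
    have "cdiff (\<lambda>v::'n ambient \<times> 'n ambient. fst (fst v)) 0" "dd v (\<lambda>v::'n ambient \<times> 'n ambient. fst (fst v)) 0 = fst (fst v)"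
      using cdiff_compose[OF cdiff_fst cdiff_fst] by simp_all
    then show ?thesis
      unfolding f_def[abs_def] by (simp add: cdiff_Pair Rcd)
  qed
  have inj: "v = 0" if "dd v f 0 = 0" for v
  proof -
    obtain a b \<zeta> where v: "v = ((a, b), \<zeta>)" by (metis surj_pair)
    have "fst (fst v) = 0" "snd v = 0" "dd v R 0 = 0" using that by (simp_all add: df prod_eq_iff)
    then have "a = 0" "\<zeta> = 0" "dd v R 0 = 0" by (auto simp: v)
    moreover have "dd ((0, b), 0) R 0 = b * dd ((0, 1), 0) R 0"
      using cdiffD(2)[OF Rcd, of b "((0, 1), 0)"] by simp
    moreover have "v = ((0, b), 0)" using \<open>a = 0\<close> \<open>\<zeta> = 0\<close> v by simp
    ultimately show ?thesis using Rw by (simp add: Pair_zero)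
  qed
  obtain g where g: "holomorphic_at g (f 0)" "g (f 0) = 0"
      "\<forall>\<^sub>F x in nhds 0. g (f x) = x" "\<forall>\<^sub>F y in nhds (f 0). f (g y) = y"
    by (rule holomorphic_inverse_function[OF f inj])
  define e :: "'n segre_param \<Rightarrow> 'n ambient \<times> 'n ambient" where "e x = ((fst x, 0), snd x)" for x
  have e: "holomorphic_at e x" "e 0 = 0" for x
    unfolding e_def[abs_def] by (intro holomorphic_intros) (simp add: Pair_zero)
  define \<rho> where "\<rho> x = snd (fst (g (e x)))" for x
  have \<rho>: "holomorphic_at \<rho> 0"
    unfolding \<rho>_def[abs_def] using g(1) e(2)
    by (intro holomorphic_intros holomorphic_at_compose[OF _ e(1)]) (simp_all add: f0)
  have \<rho>0: "\<rho> 0 = 0" using g(2) by (simp add: \<rho>_def e(2) f0)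
  define q where "q v = e (fst (fst v), snd v)" for v :: "'n ambient \<times> 'n ambient"
  have q: "holomorphic_at q 0" "q 0 = f 0"
    unfolding q_def[abs_def]
    by (intro holomorphic_at_compose[OF e(1) _ refl] holomorphic_intros) (simp add: Pair_zero e f0)
  have "\<forall>\<^sub>F v in nhds 0. R v = 0 \<longleftrightarrow> snd (fst v) = \<rho> (fst (fst v), snd v)"
    using g(3) eventually_holomorphic_compose[OF g(4) q]
  proof eventually_elim
    case (elim v)
    obtain z w \<zeta> where v: "v = ((z, w), \<zeta>)" by (metis surj_pair)
    obtain z1 w1 \<zeta>1 where gq: "g (q v) = ((z1, w1), \<zeta>1)" by (metis surj_pair)
    have "z1 = z" "\<zeta>1 = \<zeta>" and R1: "R ((z1, w1), \<zeta>1) = 0"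
      using elim(2) unfolding gq by (auto simp: f_def q_def e_def v)
    moreover have "\<rho> (z, \<zeta>) = w1" using gq by (simp add: \<rho>_def q_def v fst_conv)
    moreover have "w = \<rho> (z, \<zeta>)" if "R v = 0"
    proof -
      have "f v = q v" using that by (simp add: f_def q_def e_def v)
      then have "g (q v) = v" using elim(1) by simp
      then show ?thesis by (simp add: \<rho>_def q_def v)
    qed
    ultimately show ?case by (auto simp: v)
  qed
  then have "\<forall>\<^sub>F ((z, w), \<zeta>) in nhds 0. R ((z, w), \<zeta>) = 0 \<longleftrightarrow> w = \<rho> (z, \<zeta>)"
    by (rule eventually_mono) auto
  then show ?thesis
    using that \<rho> \<rho>0 ldf R unfolding complex_defining_function_def by blast
qed

section \<open>Biholomorphisms map Segre varieties to Segre varieties\<close>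

text \<open>In the parameters \<open>(z, (b, t))\<close> of the complexified hypersurface, the points \<open>(Z, conj Z)\<close> with
  \<open>Z\<close> in \<open>M\<close> are the fixed points of the antiholomorphic involution induced by \<open>swap_conj\<close>. The
  local biholomorphism \<open>\<kappa>\<close> straightens them to the fixed points of a linear conjugation, to which
  uniqueness applies. Its last component \<open>\<i> (c w - conj c t)\<close> is real on the pairs \<open>(Z, conj Z)\<close>, where
  \<open>t = conj w\<close>, and it completes \<open>z\<close> and \<open>b\<close> to coordinates because \<open>R\<^sub>w = c\<close> and \<open>R\<^sub>t = conj c\<close> at
  the origin.\<close>

lemma segre_zero_of_zero_on_hypersurface:
  fixes M :: "'n::finite ambient set" and E :: "'n ambient \<times> 'n ambient \<Rightarrow> complex"
  assumes "segre_family M U r R \<rho>" and E: "holomorphic_at E 0"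
    and zero: "\<forall>\<^sub>F Z in nhds 0. Z \<in> M \<longrightarrow> E (Z, conj_point Z) = 0"
  shows "\<forall>\<^sub>F x in nhds 0. E (segre_family.segre_pair \<rho> x) = 0"
proof -
  interpret segre_family M U r R \<rho> by fact
  define c where "c = dd ((0, 1), 0) R 0"
  have c: "c \<noteq> 0" using R_w_nonzero by (simp add: c_def)
  have c': "dd (0, (0, 1)) R 0 = cnj c"
    using eventually_nhds_x_imp_x[OF dd_R_conj[of "(0, (0, 1))"]]
    by (simp add: c_def conj_point Pair_zero conjugationD(6)[OF conjugation_swap_conj])
  define \<kappa> where "\<kappa> x = (fst x, (fst (snd x), \<i> * (c * \<rho> x - cnj c * snd (snd x))))"
    for x :: "'n segre_param"
  have \<kappa>: "holomorphic_at \<kappa> 0"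
    unfolding \<kappa>_def[abs_def] by (intro holomorphic_intros rho_hol)
  have \<kappa>0: "\<kappa> 0 = 0" by (simp add: \<kappa>_def rho_0 Pair_zero)
  have d\<kappa>: "dd v \<kappa> 0 = (fst v, (fst (snd v), \<i> * (c * dd v \<rho> 0 - cnj c * snd (snd v))))" for v
  proof -
    have 1: "cdiff (\<lambda>x::'n segre_param. fst (snd x)) 0" "dd v (\<lambda>x::'n segre_param. fst (snd x)) 0 = fst (snd v)"
      "cdiff (\<lambda>x::'n segre_param. snd (snd x)) 0" "dd v (\<lambda>x::'n segre_param. snd (snd x)) 0 = snd (snd v)"
      using cdiff_compose[OF cdiff_snd cdiff_fst] cdiff_compose[OF cdiff_snd cdiff_snd] by simp_all
    show ?thesis
      unfolding \<kappa>_def[abs_def] by (simp add: cdiff_Pair cdiff_mult cdiff_diff rho_cdiff 1)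
  qed
  have inj: "v = 0" if v: "dd v \<kappa> 0 = 0" for v
  proof -
    obtain a b s where v_eq: "v = (a, (b, s))" by (metis surj_pair)
    have "fst v = 0" "fst (snd v) = 0" and "c * dd v \<rho> 0 = cnj c * snd (snd v)"
      using v by (simp_all add: d\<kappa> prod_eq_iff)
    then have ab: "a = 0" "b = 0" and *: "c * dd v \<rho> 0 = cnj c * s"
      by (auto simp: v_eq)
    have "dd ((0, dd v \<rho> 0), (0, s)) R 0 = dd v \<rho> 0 * c + s * cnj c"
      using dd_add_dir[OF R_cdiff, of "dd v \<rho> 0 *\<^sub>C ((0, 1), 0)" "s *\<^sub>C (0, (0, 1))"]
        cdiffD(2)[OF R_cdiff, of "dd v \<rho> 0" "((0, 1), 0)"] cdiffD(2)[OF R_cdiff, of s "(0, (0, 1))"] c'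
      by (simp add: c_def)
    then have "c * dd v \<rho> 0 + cnj c * s = 0"
      using implicit_derivative[of v] by (simp add: v_eq ab mult.commute)
    then have "s = 0" using * c by (simp add: algebra_simps)
    then show ?thesis by (simp add: v_eq ab Pair_zero)
  qed
  obtain g where "holomorphic_at g (\<kappa> 0)" "g (\<kappa> 0) = 0"
      and g\<kappa>: "\<forall>\<^sub>F x in nhds 0. g (\<kappa> x) = x" and "\<forall>\<^sub>F y in nhds (\<kappa> 0). \<kappa> (g y) = y"
    by (rule holomorphic_inverse_function[OF \<kappa> inj])
  then have g: "holomorphic_at g 0" "g 0 = 0" and \<kappa>g: "\<forall>\<^sub>F y in nhds 0. \<kappa> (g y) = y"
    by (simp_all add: \<kappa>0)
  \<comment> \<open>the conjugation whose fixed points are \<open>(z, (conj z, u))\<close> with \<open>u\<close> real\<close>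
  define \<tau> where "\<tau> y = (vec_cnj (fst (snd y)), (vec_cnj (fst y), cnj (snd (snd y))))"
    for y :: "'n segre_param"
  have \<tau>: "conjugation \<tau>"
    unfolding conjugation_def \<tau>_def
    by (simp add: conjugationD[OF conjugation_vec_cnj] conjugationD[OF conjugation_cnj] norm_prod_def prod_eq_iff)
  \<comment> \<open>the image of \<open>x\<close> under the involution, if the components \<open>z\<close> and \<open>b\<close> of \<open>x\<close> are conjugate\<close>
  define x2 where "x2 x = (fst x, (fst (snd x), cnj (\<rho> x)))" for x :: "'n segre_param"
  have x2: "filterlim x2 (nhds 0) (nhds 0)"
  proof (rule isCont_tendsto_nhds)
    have "isCont \<rho> 0" by (rule cdiff_isCont[OF rho_cdiff])
    then show "isCont x2 0" unfolding x2_def by (intro continuous_intros)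
    show "x2 0 = 0" by (simp add: x2_def rho_0 Pair_zero)
  qed
  have near: "\<forall>\<^sub>F x in nhds 0. \<tau> (\<kappa> x) = \<kappa> x \<longrightarrow> snd x = conj_point (segre_point x)"
  proof -
    have sc: "filterlim (\<lambda>x. swap_conj (segre_pair x)) (nhds 0) (nhds 0)"
      by (rule filterlim_compose[OF filterlim_conjugation[OF conjugation_swap_conj]
            holomorphic_at_filterlim[OF segre_pair_hol segre_pair_0]])
        (rule conjugationD(6)[OF conjugation_swap_conj])
    show ?thesis
      using R_segre_pair eventually_holomorphic_compose[OF R_conj segre_pair_hol segre_pair_0]
        eventually_compose_filterlim[OF R_zero sc] g\<kappa> eventually_compose_filterlim[OF g\<kappa> x2]
    proof eventually_elim
      case (elim x)
      show ?case
      proof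
        assume fixed: "\<tau> (\<kappa> x) = \<kappa> x"
        obtain z b t where x: "x = (z, (b, t))" by (metis surj_pair)
        let ?w = "\<rho> x"
        have b: "b = vec_cnj z" "vec_cnj b = z" using fixed by (auto simp: \<tau>_def \<kappa>_def x conjugationD(3)[OF conjugation_vec_cnj])
        have real: "cnj (\<i> * (c * ?w - cnj c * t)) = \<i> * (c * ?w - cnj c * t)"
          using fixed by (simp add: \<tau>_def \<kappa>_def x)
        have "R (swap_conj (segre_pair x)) = 0" using elim(1,2) by simp
        moreover have "swap_conj (segre_pair x) = ((z, cnj t), (b, cnj ?w))"
          by (simp add: segre_pair_def segre_point_def x b(1) conjugationD(3)[OF conjugation_vec_cnj])
        ultimately have "cnj t = \<rho> (x2 x)"
          using elim(3) by (simp add: x2_def x)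
        then have "\<kappa> (x2 x) = (z, (b, \<i> * (c * cnj t - cnj c * cnj ?w)))"
          by (simp add: \<kappa>_def) (simp add: x2_def x)
        also have "\<i> * (c * cnj t - cnj c * cnj ?w) = cnj (\<i> * (c * ?w - cnj c * t))"
          by (simp add: algebra_simps)
        finally have "\<kappa> (x2 x) = \<kappa> x" by (simp only: real) (simp add: \<kappa>_def x)
        then have "x2 x = x" using elim(4,5) by simp
        then show "snd x = conj_point (segre_point x)"
          by (simp add: x2_def segre_point_def x b)
      qed
    qed
  qed
  have ldf': "open U" "0 \<in> U" "\<And>Z. Z \<in> U \<Longrightarrow> r Z = 0 \<Longrightarrow> Z \<in> M"
    using ldf by (auto simp: local_defining_function_def)
  have inM: "\<forall>\<^sub>F x in nhds 0. snd x = conj_point (segre_point x) \<longrightarrow> E (segre_pair x) = 0"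
    using R_segre_pair eventually_holomorphic_compose[OF R_real segre_point_hol segre_point_0]
      eventually_holomorphic_compose[OF zero segre_point_hol segre_point_0]
      eventually_holomorphic_compose[OF eventually_nhds_in_open[OF ldf'(1,2)] segre_point_hol segre_point_0]
    by eventually_elim (auto simp: segre_pair_def dest: ldf'(3))
  have "\<forall>\<^sub>F x in nhds 0. \<tau> (\<kappa> x) = \<kappa> x \<longrightarrow> E (segre_pair x) = 0"
    using near inM by eventually_elim blast
  from eventually_holomorphic_compose[OF this g] \<kappa>g
  have "\<forall>\<^sub>F y in nhds 0. \<tau> y = y \<longrightarrow> E (segre_pair (g y)) = 0"
    by eventually_elim simp
  moreover have "holomorphic_at (\<lambda>y. E (segre_pair (g y))) 0"
    using holomorphic_at_compose[OF holomorphic_at_compose[OF E segre_pair_hol segre_pair_0] g] .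
  ultimately have "\<forall>\<^sub>F y in nhds 0. E (segre_pair (g y)) = 0"
    by (rule holomorphic_zero_of_zero_on_fixed_points[OF \<tau>, rotated])
  from eventually_holomorphic_compose[OF this \<kappa> \<kappa>0] g\<kappa>
  show ?thesis by eventually_elim simp
qed

text \<open>The function \<open>R' (H Z, conj (H (conj \<zeta>)))\<close> vanishes at the pairs \<open>(Z, conj Z)\<close> with \<open>Z\<close> in \<open>M\<close>,
  hence near the origin on the whole complexified hypersurface of \<open>M\<close>.\<close>

lemma segre_correspondence:
  fixes M M' :: "'n::finite ambient set"
  assumes S: "segre_family M U r R \<rho>" and S': "segre_family M' U' r' R' \<rho>'"
    and H: "holomorphic_at H 0" "H 0 = 0" and HM: "\<forall>\<^sub>F Z in nhds 0. Z \<in> M \<longrightarrow> H Z \<in> M'"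
  shows "\<forall>\<^sub>F x in nhds 0. snd (H (segre_family.segre_point \<rho> x)) =
    \<rho>' (fst (H (segre_family.segre_point \<rho> x)), conj_point (H (conj_point (snd x))))"
proof -
  interpret segre_family M U r R \<rho> by fact
  interpret S': segre_family M' U' r' R' \<rho>' by fact
  let ?Hb = "\<lambda>\<zeta>. conj_point (H (conj_point \<zeta>))"
  have Hb: "holomorphic_at ?Hb 0" "?Hb 0 = 0"
    using holomorphic_at_conjugate[OF conjugation_conj_point conjugation_conj_point H(1) conj_point(6)] H(2)
    by (simp_all add: conj_point)
  define HH where "HH v = (H (fst v), ?Hb (snd v))" for v
  have HH: "holomorphic_at HH 0" "HH 0 = 0"
    unfolding HH_def[abs_def]
    by (intro holomorphic_at_Pair holomorphic_at_compose[OF H(1) holomorphic_at_fst fst_zero]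
        holomorphic_at_compose[OF Hb(1) holomorphic_at_snd snd_zero])
      (simp add: H(2) Hb(2) Pair_zero)
  have ldf': "open U'" "0 \<in> U'" "\<And>Z. Z \<in> U' \<Longrightarrow> Z \<in> M' \<Longrightarrow> r' Z = 0"
    using S'.ldf by (auto simp: local_defining_function_def)
  have "\<forall>\<^sub>F Z in nhds 0. Z \<in> M \<longrightarrow> R' (HH (Z, conj_point Z)) = 0"
    using HM eventually_holomorphic_compose[OF eventually_nhds_in_open[OF ldf'(1,2)] H]
      eventually_holomorphic_compose[OF S'.R_real H]
    by eventually_elim (auto simp: HH_def conj_point ldf'(3))
  from segre_zero_of_zero_on_hypersurface[OF S holomorphic_at_compose[OF S'.R_hol HH] this]
  have "\<forall>\<^sub>F x in nhds 0. R' (HH (segre_pair x)) = 0" .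
  moreover have "holomorphic_at (\<lambda>x. HH (segre_pair x)) 0" "HH (segre_pair 0) = 0"
    using holomorphic_at_compose[OF HH(1) segre_pair_hol segre_pair_0] HH(2) by simp_all
  from eventually_holomorphic_compose[OF S'.R_zero this]
  have "\<forall>\<^sub>F x in nhds 0. case HH (segre_pair x) of ((z, w), \<zeta>) \<Rightarrow> R' ((z, w), \<zeta>) = 0 \<longleftrightarrow> w = \<rho>' (z, \<zeta>)"
    by (rule eventually_mono) (auto split: prod.splits)
  ultimately show ?thesis
    by eventually_elim (auto simp: HH_def segre_pair_def split: prod.splits)
qed

section \<open>Germs of functions at a point\<close>

lemma holomorphic_at_translation: "holomorphic_at (\<lambda>v. p + v) q" "holomorphic_at (\<lambda>x. x - p) q"
  unfolding holomorphic_at_iff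
  by (intro always_eventually allI cdiff_add(1) cdiff_diff(1) cdiff_const cdiff_id)+

lemma eventually_translate:
  fixes p :: "'a::complex_normed_space"
  shows "(\<forall>\<^sub>F v in nhds 0. P (p + v)) \<longleftrightarrow> (\<forall>\<^sub>F x in nhds p. P x)"
proof
  assume *: "\<forall>\<^sub>F v in nhds 0. P (p + v)"
  have "\<forall>\<^sub>F x in nhds p. P (p + (x - p))"
    by (rule eventually_holomorphic_compose[OF * holomorphic_at_translation(2)]) simp
  then show "\<forall>\<^sub>F x in nhds p. P x" by simp
next
  assume *: "\<forall>\<^sub>F x in nhds p. P x"
  show "\<forall>\<^sub>F v in nhds 0. P (p + v)"
    by (rule eventually_holomorphic_compose[OF * holomorphic_at_translation(1)]) simp
qed

lemma germ_rel_translate: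
  assumes "holomorphic_at f p"
  shows "germ_rel (\<lambda>v. f (p + v)) (\<lambda>v. f (p + v))"
  using holomorphic_at_compose[OF assms holomorphic_at_translation(1), of p 0] by (simp add: germ_rel_def)

lemma germ_at_eq_iff:
  assumes "holomorphic_at f p" "holomorphic_at g p"
  shows "germ_at p f = germ_at p g \<longleftrightarrow> (\<forall>\<^sub>F x in nhds p. f x = g x)"
proof -
  have "germ_at p f = germ_at p g \<longleftrightarrow> germ_rel (\<lambda>v. f (p + v)) (\<lambda>v. g (p + v))"
    unfolding germ_at_def using Quotient3_rel[OF Quotient3_germ] germ_rel_translate assms by metis
  also have "\<dots> \<longleftrightarrow> (\<forall>\<^sub>F v in nhds 0. f (p + v) = g (p + v))"
    using germ_rel_translate[OF assms(1)] germ_rel_translate[OF assms(2)] by (simp add: germ_rel_def)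
  also have "\<dots> \<longleftrightarrow> (\<forall>\<^sub>F x in nhds p. f x = g x)"
    by (rule eventually_translate[of "\<lambda>x. f x = g x"])
  finally show ?thesis .
qed

lemma germ_at_add:
  assumes "holomorphic_at f p" "holomorphic_at g p"
  shows "germ_at p (\<lambda>x. f x + g x) = germ_at p f + germ_at p g"
  unfolding germ_at_def using plus_germ.abs_eq[OF assms[THEN germ_rel_translate]] by simp

lemma germ_at_mult:
  assumes "holomorphic_at f p" "holomorphic_at g p"
  shows "germ_at p (\<lambda>x. f x * g x) = germ_at p f * germ_at p g"
  unfolding germ_at_def using times_germ.abs_eq[OF assms[THEN germ_rel_translate]] by simp

lemma germ_at_const: "germ_at p (\<lambda>x. 0) = 0" "germ_at p (\<lambda>x. 1) = 1"
  by (simp_all add: germ_at_def zero_germ.abs_eq one_germ.abs_eq)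

lemma germ_at_uminus:
  assumes "holomorphic_at f p"
  shows "germ_at p (\<lambda>x. - f x) = - germ_at p f"
  unfolding germ_at_def using uminus_germ.abs_eq[OF assms[THEN germ_rel_translate]] by simp

lemma germ_at_cases:
  obtains f where "holomorphic_at f p" "G = germ_at p f"
proof -
  let ?f = "\<lambda>x. rep_germ G (x - p)"
  have rel: "germ_rel (rep_germ G) (rep_germ G)" by (rule Quotient3_rep_reflp[OF Quotient3_germ])
  have "holomorphic_at ?f p"
    using rel by (intro holomorphic_at_compose[OF _ holomorphic_at_translation(2), of _ 0]) (simp_all add: germ_rel_def)
  moreover have "G = germ_at p ?f"
    by (simp add: germ_at_def Quotient3_abs_rep[OF Quotient3_germ])
  ultimately show ?thesis by (rule that)
qed

definition mero_germ :: "'a::complex_normed_space \<Rightarrow> ('a \<Rightarrow> complex) \<Rightarrow> 'a meromorphic_germ"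
  where "mero_germ p f = Fract (germ_at p f) 1"

lemma mero_germ_cong:
  assumes "holomorphic_at f p" "\<forall>\<^sub>F x in nhds p. f x = g x"
  shows "mero_germ p f = mero_germ p g"
  using germ_at_eq_iff[of f p g] holomorphic_at_cong[OF assms(2)] assms by (simp add: mero_germ_def)

lemma mero_germ_add:
  assumes "holomorphic_at f p" "holomorphic_at g p"
  shows "mero_germ p (\<lambda>x. f x + g x) = mero_germ p f + mero_germ p g"
  by (simp add: mero_germ_def germ_at_add[OF assms])

lemma mero_germ_mult:
  assumes "holomorphic_at f p" "holomorphic_at g p"
  shows "mero_germ p (\<lambda>x. f x * g x) = mero_germ p f * mero_germ p g"
  by (simp add: mero_germ_def germ_at_mult[OF assms])

lemma mero_germ_const: "mero_germ p (\<lambda>x. 0) = 0" "mero_germ p (\<lambda>x. 1) = 1"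
  by (simp_all add: mero_germ_def germ_at_const Zero_fract_def One_fract_def)

lemma mero_germ_sum:
  assumes "\<And>i. i \<in> I \<Longrightarrow> holomorphic_at (f i) p"
  shows "mero_germ p (\<lambda>x. \<Sum>i\<in>I. f i x) = (\<Sum>i\<in>I. mero_germ p (f i))"
  using assms
  by (induction I rule: infinite_finite_induct) (simp_all add: mero_germ_const mero_germ_add holomorphic_at_sum)

lemma mero_germ_prod:
  assumes "\<And>i. i \<in> I \<Longrightarrow> holomorphic_at (f i) p"
  shows "mero_germ p (\<lambda>x. \<Prod>i\<in>I. f i x) = (\<Prod>i\<in>I. mero_germ p (f i))"
  using assms
  by (induction I rule: infinite_finite_induct) (simp_all add: mero_germ_const mero_germ_mult holomorphic_at_prod)

lemma mero_germ_power:
  assumes "holomorphic_at f p"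
  shows "mero_germ p (\<lambda>x. f x ^ n) = mero_germ p f ^ n"
  by (induction n) (simp_all add: mero_germ_const mero_germ_mult assms holomorphic_at_power)

lemma Fract_eq_mero_germ: "germ_at p g \<noteq> 0 \<Longrightarrow> Fract (germ_at p f) (germ_at p g) = mero_germ p f / mero_germ p g"
  by (simp add: mero_germ_def)

section \<open>Pulling back germs\<close>

text \<open>Representatives live near the origin; every representative of the germ yields the same pullback
  when \<open>\<phi>\<close> is holomorphic at \<open>p\<close> with \<open>\<phi> p = q\<close>.\<close>

definition pullback :: "('a \<Rightarrow> 'b) \<Rightarrow> 'a \<Rightarrow> 'b \<Rightarrow> 'b::complex_normed_space germ \<Rightarrow> 'a::complex_normed_space germ"
  where "pullback \<phi> p q G = germ_at p (\<lambda>x. rep_germ G (\<phi> x - q))"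

lemma pullback_germ_at:
  assumes \<phi>: "holomorphic_at \<phi> p" "\<phi> p = q" and f: "holomorphic_at f q"
  shows "pullback \<phi> p q (germ_at q f) = germ_at p (\<lambda>x. f (\<phi> x))"
proof -
  let ?r = "rep_germ (germ_at q f)"
  have *: "germ_rel ?r (\<lambda>v. f (q + v))"
    unfolding germ_at_def by (rule Quotient3_rep_abs[OF Quotient3_germ, OF germ_rel_translate[OF f]])
  have d: "holomorphic_at (\<lambda>x. \<phi> x - q) p" "\<phi> p - q = 0"
    using \<phi> by (auto intro: holomorphic_intros)
  have "\<forall>\<^sub>F v in nhds 0. ?r v = f (q + v)" using * by (simp add: germ_rel_def)
  from eventually_holomorphic_compose[OF this d]
  have "\<forall>\<^sub>F x in nhds p. ?r (\<phi> x - q) = f (\<phi> x)" by simp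
  moreover have "holomorphic_at (\<lambda>x. ?r (\<phi> x - q)) p"
    using * by (intro holomorphic_at_compose[OF _ d]) (simp add: germ_rel_def)
  ultimately show ?thesis
    unfolding pullback_def using germ_at_eq_iff holomorphic_at_compose[OF f \<phi>] by blast
qed

definition field_hom :: "('k::field \<Rightarrow> 'l::field) \<Rightarrow> bool"
  where "field_hom \<sigma> \<longleftrightarrow> \<sigma> 1 = 1 \<and> (\<forall>x y. \<sigma> (x + y) = \<sigma> x + \<sigma> y) \<and> (\<forall>x y. \<sigma> (x * y) = \<sigma> x * \<sigma> y)"

lemma field_homD:
  assumes "field_hom \<sigma>"
  shows "\<sigma> 0 = 0" "\<sigma> 1 = 1" "\<sigma> (x + y) = \<sigma> x + \<sigma> y" "\<sigma> (x * y) = \<sigma> x * \<sigma> y" "\<sigma> (- x) = - \<sigma> x"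
    "\<sigma> (x - y) = \<sigma> x - \<sigma> y" "\<sigma> (inverse x) = inverse (\<sigma> x)" "\<sigma> (x / y) = \<sigma> x / \<sigma> y" "\<sigma> x = 0 \<longleftrightarrow> x = 0"
    "\<sigma> (\<Sum>i\<in>I. f i) = (\<Sum>i\<in>I. \<sigma> (f i))" "\<sigma> (\<Prod>i\<in>I. f i) = (\<Prod>i\<in>I. \<sigma> (f i))" "\<sigma> (x ^ n) = \<sigma> x ^ n"
proof -
  show 1: "\<sigma> 1 = 1" and add: "\<sigma> (x + y) = \<sigma> x + \<sigma> y" and mult: "\<sigma> (x * y) = \<sigma> x * \<sigma> y" for x y
    using assms by (simp_all add: field_hom_def)
  show 0: "\<sigma> 0 = 0" using add[of 0 0] by (metis add.right_neutral add_left_cancel)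
  show minus: "\<sigma> (- x) = - \<sigma> x" for x
    using add[of x "- x"] 0 by (simp add: eq_neg_iff_add_eq_0 add.commute)
  show "\<sigma> (x - y) = \<sigma> x - \<sigma> y" using add[of x "- y"] by (simp add: minus)
  have inv1: "\<sigma> x * \<sigma> (inverse x) = 1" if "x \<noteq> 0" for x
    using mult[of x "inverse x"] that by (simp add: 1)
  show z: "\<sigma> x = 0 \<longleftrightarrow> x = 0" for x
    using inv1[of x] 0 by (cases "x = 0") auto
  show inv: "\<sigma> (inverse x) = inverse (\<sigma> x)" for x
    using inv1[of x] 0 by (cases "x = 0") (auto simp: inverse_unique)
  show "\<sigma> (x / y) = \<sigma> x / \<sigma> y" by (simp add: divide_inverse mult inv)
  show "\<sigma> (\<Sum>i\<in>I. f i) = (\<Sum>i\<in>I. \<sigma> (f i))"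
    by (induction I rule: infinite_finite_induct) (simp_all add: 0 add)
  show "\<sigma> (\<Prod>i\<in>I. f i) = (\<Prod>i\<in>I. \<sigma> (f i))"
    by (induction I rule: infinite_finite_induct) (simp_all add: 1 mult)
  show "\<sigma> (x ^ n) = \<sigma> x ^ n" by (induction n) (simp_all add: 1 mult)
qed

text \<open>Well defined if \<open>h\<close> is an injective ring homomorphism.\<close>

definition map_fract :: "('a::idom \<Rightarrow> 'b::idom) \<Rightarrow> 'a fract \<Rightarrow> 'b fract"
  where "map_fract h x = (SOME y. \<exists>a b. b \<noteq> 0 \<and> x = Fract a b \<and> y = Fract (h a) (h b))"

lemma map_fract:
  assumes h1: "h 1 = 1" and add: "\<And>x y. h (x + y) = h x + h y" and mult: "\<And>x y. h (x * y) = h x * h y"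
    and inj: "\<And>x. h x = 0 \<Longrightarrow> x = 0"
  shows "b \<noteq> 0 \<Longrightarrow> map_fract h (Fract a b) = Fract (h a) (h b)"
    and "field_hom (map_fract h)"
proof -
  have nz: "h b \<noteq> 0" if "b \<noteq> 0" for b using inj that by blast
  show eq: "map_fract h (Fract a b) = Fract (h a) (h b)" if b: "b \<noteq> 0" for a b
    unfolding map_fract_def
  proof (rule some_equality)
    show "\<exists>a' b'. b' \<noteq> 0 \<and> Fract a b = Fract a' b' \<and> Fract (h a) (h b) = Fract (h a') (h b')"
      using b by blast
    fix y assume "\<exists>a' b'. b' \<noteq> 0 \<and> Fract a b = Fract a' b' \<and> y = Fract (h a') (h b')"
    then obtain a' b' where *: "b' \<noteq> 0" "Fract a b = Fract a' b'" "y = Fract (h a') (h b')" by blast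
    then have "a * b' = a' * b" using b by (simp add: eq_fract)
    then have "h a * h b' = h a' * h b" by (metis mult)
    then show "y = Fract (h a) (h b)" using *(3) nz[OF *(1)] nz[OF b] by (simp add: eq_fract)
  qed
  have "map_fract h 1 = 1" using eq[of 1 1] h1 by (simp add: One_fract_def)
  moreover have "map_fract h (x + y) = map_fract h x + map_fract h y"
    and "map_fract h (x * y) = map_fract h x * map_fract h y" for x y
    by (cases x; cases y; simp add: eq nz add mult)+
  ultimately show "field_hom (map_fract h)" by (simp add: field_hom_def)
qed

text \<open>The right inverse \<open>\<psi>\<close> makes the pullback injective, so that it extends to quotients.\<close>

lemma pullback_field_hom:
  fixes \<phi> :: "'a::complex_normed_space \<Rightarrow> 'b::complex_normed_space"
  assumes \<phi>: "holomorphic_at \<phi> p" "\<phi> p = q" and \<psi>: "holomorphic_at \<psi> q" "\<psi> q = p"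
    and inv: "\<forall>\<^sub>F y in nhds q. \<phi> (\<psi> y) = y"
  shows "field_hom (map_fract (pullback \<phi> p q))"
    and "holomorphic_at f q \<Longrightarrow> map_fract (pullback \<phi> p q) (mero_germ q f) = mero_germ p (\<lambda>x. f (\<phi> x))"
proof -
  note pb = pullback_germ_at[OF \<phi>]
  have h1: "pullback \<phi> p q 1 = 1"
    using pb[OF holomorphic_at_const[of 1]] by (simp add: germ_at_const)
  have add: "pullback \<phi> p q (x + y) = pullback \<phi> p q x + pullback \<phi> p q y"
    and mult: "pullback \<phi> p q (x * y) = pullback \<phi> p q x * pullback \<phi> p q y" for x y
  proof -
    obtain f where f: "holomorphic_at f q" "x = germ_at q f" by (rule germ_at_cases)
    obtain g where g: "holomorphic_at g q" "y = germ_at q g" by (rule germ_at_cases)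
    note c = holomorphic_at_compose[OF f(1) \<phi>] holomorphic_at_compose[OF g(1) \<phi>]
    show "pullback \<phi> p q (x + y) = pullback \<phi> p q x + pullback \<phi> p q y"
      unfolding f(2) g(2)
      by (simp add: germ_at_add[OF f(1) g(1), symmetric] germ_at_add[OF c] pb f(1) g(1) holomorphic_at_add)
    show "pullback \<phi> p q (x * y) = pullback \<phi> p q x * pullback \<phi> p q y"
      unfolding f(2) g(2)
      by (simp add: germ_at_mult[OF f(1) g(1), symmetric] germ_at_mult[OF c] pb f(1) g(1) holomorphic_at_mult)
  qed
  have inj: "x = 0" if "pullback \<phi> p q x = 0" for x
  proof -
    obtain f where f: "holomorphic_at f q" "x = germ_at q f" by (rule germ_at_cases)
    have "\<forall>\<^sub>F x in nhds p. f (\<phi> x) = 0"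
      using that germ_at_eq_iff[OF holomorphic_at_compose[OF f(1) \<phi>] holomorphic_at_const[of 0]]
      by (simp add: f(2) pb[OF f(1)] germ_at_const)
    from eventually_holomorphic_compose[OF this \<psi>] inv
    have "\<forall>\<^sub>F y in nhds q. f y = 0" by eventually_elim simp
    then show ?thesis
      using germ_at_eq_iff[OF f(1) holomorphic_at_const[of 0]] by (simp add: f(2) germ_at_const)
  qed
  show "field_hom (map_fract (pullback \<phi> p q))"
    by (rule map_fract(2)[OF h1 add mult inj])
  show "map_fract (pullback \<phi> p q) (mero_germ q f) = mero_germ p (\<lambda>x. f (\<phi> x))" if "holomorphic_at f q"
    unfolding mero_germ_def using map_fract(1)[OF h1 add mult inj, of 1 "germ_at q f"] by (simp add: pb[OF that] h1)
qed

section \<open>Subfields and transcendence degree\<close>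

lemma is_subfieldD:
  assumes "is_subfield K"
  shows "0 \<in> K" "1 \<in> K" "x \<in> K \<Longrightarrow> y \<in> K \<Longrightarrow> x - y \<in> K" "x \<in> K \<Longrightarrow> y \<in> K \<Longrightarrow> x + y \<in> K"
    "x \<in> K \<Longrightarrow> y \<in> K \<Longrightarrow> x * y \<in> K" "x \<in> K \<Longrightarrow> inverse x \<in> K" "x \<in> K \<Longrightarrow> - x \<in> K"
    "x \<in> K \<Longrightarrow> y \<in> K \<Longrightarrow> x / y \<in> K"
    "(\<And>i. i \<in> I \<Longrightarrow> f i \<in> K) \<Longrightarrow> (\<Sum>i\<in>I. f i) \<in> K"
    "(\<And>i. i \<in> I \<Longrightarrow> f i \<in> K) \<Longrightarrow> (\<Prod>i\<in>I. f i) \<in> K"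
    "x \<in> K \<Longrightarrow> x ^ n \<in> K"
proof -
  show 0: "0 \<in> K" and 1: "1 \<in> K" and diff: "x \<in> K \<Longrightarrow> y \<in> K \<Longrightarrow> x - y \<in> K"
    and mult: "x \<in> K \<Longrightarrow> y \<in> K \<Longrightarrow> x * y \<in> K" and inv: "x \<in> K \<Longrightarrow> inverse x \<in> K" for x y
    using assms by (auto simp: is_subfield_def)
  show neg: "x \<in> K \<Longrightarrow> - x \<in> K" for x using diff[OF 0, of x] by simp
  show add: "x \<in> K \<Longrightarrow> y \<in> K \<Longrightarrow> x + y \<in> K" for x y using diff[of x "- y"] neg by simp
  show "x \<in> K \<Longrightarrow> y \<in> K \<Longrightarrow> x / y \<in> K" using mult inv by (simp add: divide_inverse)
  show "(\<Sum>i\<in>I. f i) \<in> K" if "\<And>i. i \<in> I \<Longrightarrow> f i \<in> K"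
    using that by (induction I rule: infinite_finite_induct) (auto intro: 0 add)
  show "(\<Prod>i\<in>I. f i) \<in> K" if "\<And>i. i \<in> I \<Longrightarrow> f i \<in> K"
    using that by (induction I rule: infinite_finite_induct) (auto intro: 1 mult)
  show "x \<in> K \<Longrightarrow> x ^ n \<in> K" by (induction n) (auto intro: 1 mult)
qed

lemma is_subfield_field_adjoin: "is_subfield (field_adjoin K S)"
  unfolding field_adjoin_def is_subfield_def by blast

lemma field_adjoin_incl: "K \<subseteq> field_adjoin K S" "S \<subseteq> field_adjoin K S"
  by (auto simp: field_adjoin_def)

lemma field_adjoin_least: "is_subfield L \<Longrightarrow> K \<subseteq> L \<Longrightarrow> S \<subseteq> L \<Longrightarrow> field_adjoin K S \<subseteq> L"
  by (auto simp: field_adjoin_def)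

lemma field_hom_image_adjoin:
  assumes \<sigma>: "field_hom \<sigma>" and L: "is_subfield L" and K: "\<sigma> ` K \<subseteq> L" and S: "\<sigma> ` S \<subseteq> L"
  shows "\<sigma> ` field_adjoin K S \<subseteq> L"
proof -
  have "is_subfield {x. \<sigma> x \<in> L}"
    using is_subfieldD[OF L] by (simp add: is_subfield_def field_homD[OF \<sigma>])
  then have "field_adjoin K S \<subseteq> {x. \<sigma> x \<in> L}"
    using K S by (intro field_adjoin_least) auto
  then show ?thesis by auto
qed

text \<open>The map \<open>\<sigma>\<close> carries independent sets to independent sets: applying \<open>\<tau>\<close> to a relation over \<open>K\<close>
  between elements of \<open>\<sigma> ` S\<close> gives a relation over \<open>K'\<close> between elements of \<open>S\<close>.\<close>

lemma transcendence_degree_le: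
  fixes \<sigma> :: "'k::field \<Rightarrow> 'l::field"
  assumes \<sigma>: "field_hom \<sigma>" and \<tau>: "field_hom \<tau>" and inv: "\<And>x. x \<in> L' \<Longrightarrow> \<tau> (\<sigma> x) = x"
    and L: "\<sigma> ` L' \<subseteq> L" and K: "\<tau> ` K \<subseteq> K'"
  shows "transcendence_degree K' L' \<le> transcendence_degree K L"
  unfolding transcendence_degree_def
proof (rule SUP_least)
  fix S assume "S \<in> {S. S \<subseteq> L' \<and> finite S \<and> algebraically_independent K' S}"
  then have S: "S \<subseteq> L'" "finite S" "algebraically_independent K' S" by auto
  have inj: "inj_on \<sigma> S" using inv S(1) by (intro inj_on_inverseI[where g = \<tau>]) blast
  have "algebraically_independent K (\<sigma> ` S)"
    unfolding algebraically_independent_def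
  proof (intro allI impI, elim conjE)
    fix T A c
    assume T: "finite T" "T \<subseteq> \<sigma> ` S" and A: "finite A" "A \<subseteq> T \<rightarrow>\<^sub>E (UNIV::nat set)"
      and c: "c \<in> A \<rightarrow> K" and zero: "(\<Sum>\<alpha>\<in>A. c \<alpha> * (\<Prod>t\<in>T. t ^ \<alpha> t)) = 0"
    have "\<sigma> (\<tau> t) = t \<and> \<tau> t \<in> S" if "t \<in> T" for t
    proof -
      obtain s where "s \<in> S" "t = \<sigma> s" using \<open>t \<in> T\<close> T(2) by blast
      then show ?thesis using inv S(1) by auto
    qed
    then have \<sigma>\<tau>: "\<sigma> (\<tau> t) = t" and \<tau>S: "\<tau> t \<in> S" if "t \<in> T" for t using that by blast+
    have inj\<tau>: "inj_on \<tau> T" using \<sigma>\<tau> by (rule inj_on_inverseI[where g = \<sigma>])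
    \<comment> \<open>exponents are extensional functions on the set of variables and have to be re-indexed\<close>
    define h where "h \<alpha> = restrict (\<lambda>s. \<alpha> (\<sigma> s)) (\<tau> ` T)" for \<alpha> :: "'l \<Rightarrow> nat"
    define k where "k \<beta> = restrict (\<lambda>t. \<beta> (\<tau> t)) T" for \<beta> :: "'k \<Rightarrow> nat"
    have kh: "k (h \<alpha>) = \<alpha>" if \<alpha>: "\<alpha> \<in> A" for \<alpha>
    proof
      fix t
      have "\<alpha> t = undefined" if "t \<notin> T" by (rule PiE_arb[OF subsetD[OF A(2) \<alpha>] that])
      then show "k (h \<alpha>) t = \<alpha> t" by (cases "t \<in> T") (simp_all add: k_def h_def \<sigma>\<tau>)
    qed
    have injh: "inj_on h A" using kh by (rule inj_on_inverseI[where g = k])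
    have "\<tau> (\<Sum>\<alpha>\<in>A. c \<alpha> * (\<Prod>t\<in>T. t ^ \<alpha> t)) = (\<Sum>\<alpha>\<in>A. \<tau> (c \<alpha>) * (\<Prod>t\<in>T. \<tau> t ^ \<alpha> t))"
      by (simp add: field_homD[OF \<tau>])
    also have "\<dots> = (\<Sum>\<alpha>\<in>A. \<tau> (c (k (h \<alpha>))) * (\<Prod>s\<in>\<tau> ` T. s ^ h \<alpha> s))"
    proof (intro sum.cong refl)
      fix \<alpha> assume "\<alpha> \<in> A"
      moreover have "(\<Prod>s\<in>\<tau> ` T. s ^ h \<alpha> s) = (\<Prod>t\<in>T. \<tau> t ^ \<alpha> t)"
        by (simp add: prod.reindex[OF inj\<tau>] h_def \<sigma>\<tau>)
      ultimately show "\<tau> (c \<alpha>) * (\<Prod>t\<in>T. \<tau> t ^ \<alpha> t) = \<tau> (c (k (h \<alpha>))) * (\<Prod>s\<in>\<tau> ` T. s ^ h \<alpha> s)"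
        by (simp add: kh)
    qed
    also have "\<dots> = (\<Sum>\<beta>\<in>h ` A. \<tau> (c (k \<beta>)) * (\<Prod>s\<in>\<tau> ` T. s ^ \<beta> s))"
      by (simp add: sum.reindex[OF injh])
    finally have "(\<Sum>\<beta>\<in>h ` A. \<tau> (c (k \<beta>)) * (\<Prod>s\<in>\<tau> ` T. s ^ \<beta> s)) = 0"
      using zero by (simp add: field_homD[OF \<tau>])
    moreover have "finite (\<tau> ` T)" "\<tau> ` T \<subseteq> S" "finite (h ` A)" using T A \<tau>S by auto
    moreover have "h ` A \<subseteq> \<tau> ` T \<rightarrow>\<^sub>E (UNIV::nat set)" by (auto simp: h_def)
    moreover have "(\<lambda>\<beta>. \<tau> (c (k \<beta>))) \<in> h ` A \<rightarrow> K'"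
      using c K kh by (auto simp: Pi_iff image_subset_iff)
    ultimately have "\<tau> (c (k \<beta>)) = 0" if "\<beta> \<in> h ` A" for \<beta>
      by (intro S(3)[unfolded algebraically_independent_def, rule_format,
            of "\<tau> ` T" "h ` A" "\<lambda>\<beta>. \<tau> (c (k \<beta>))" \<beta>, OF _ that] conjI)
    then have "\<tau> (c \<alpha>) = 0" if "\<alpha> \<in> A" for \<alpha> using kh[OF that] that by (metis imageI)
    then show "\<forall>\<alpha>\<in>A. c \<alpha> = 0" by (simp add: field_homD(9)[OF \<tau>])
  qed
  then have "\<sigma> ` S \<in> {S. S \<subseteq> L \<and> finite S \<and> algebraically_independent K S}"
    using S L by auto
  then have "enat (card (\<sigma> ` S)) \<le> (SUP S \<in> {S. S \<subseteq> L \<and> finite S \<and> algebraically_independent K S}. enat (card S))"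
    by (rule SUP_upper)
  then show "enat (card S) \<le> (SUP S \<in> {S. S \<subseteq> L \<and> finite S \<and> algebraically_independent K S}. enat (card S))"
    by (simp add: card_image[OF inj])
qed

text \<open>Cramer's rule: the solution is a quotient of determinants with entries in the subfield.\<close>

lemma subfield_linear_solution:
  fixes P Q :: "'k::field ^ 'n::finite ^ 'n" and x :: "'k ^ 'n"
  assumes W: "is_subfield W" and P: "\<And>i j. P $ i $ j \<in> W" and PQ: "P ** Q = mat 1"
    and b: "\<And>i. (P *v x) $ i \<in> W"
  shows "x $ i \<in> W"
proof -
  have det_W: "det X \<in> W" if "\<And>i j. X $ i $ j \<in> W" for X :: "'k ^ 'n ^ 'n"
  proof -
    have "of_int (sign p) \<in> W" for p :: "'n \<Rightarrow> 'n"
      using is_subfieldD(2,7)[OF W] by (simp add: sign_def)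
    then show ?thesis
      unfolding det_def using that by (intro is_subfieldD(9,5,10)[OF W]) auto
  qed
  have "det P * det Q = 1" using det_mul[of P Q] PQ by simp
  then have "det P \<noteq> 0" by auto
  then have "x = (\<chi> k. det (\<chi> i j. if j = k then (P *v x) $ i else P $ i $ j) / det P)"
    using cramer[of P x "P *v x"] by simp
  then have "x $ i = det (\<chi> i' j. if j = i then (P *v x) $ i' else P $ i' $ j) / det P"
    by (metis (no_types, lifting) vec_lambda_beta)
  also have "\<dots> \<in> W" using P b by (intro is_subfieldD(8)[OF W] det_W) auto
  finally show ?thesis .
qed

section \<open>The field of partially rational germs\<close>

abbreviation ymonom :: "('k::finite \<Rightarrow> nat) \<Rightarrow> complex ^ 'k \<Rightarrow> complex"
  where "ymonom \<alpha> y \<equiv> \<Prod>i\<in>UNIV. y $ i ^ \<alpha> i"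

lemma polynomial_in_y_intro:
  fixes A :: "('k::finite \<Rightarrow> nat) set"
  assumes "finite A" "\<And>\<alpha>. \<alpha> \<in> A \<Longrightarrow> holomorphic_at (c \<alpha>) x0"
    "\<And>x y. f (x, y) = (\<Sum>\<alpha>\<in>A. c \<alpha> x * ymonom \<alpha> y)"
  shows "polynomial_in_y x0 f"
  unfolding polynomial_in_y_def using assms by (intro exI[of _ A] exI[of _ c]) auto

lemma polynomial_in_y_coeff:
  assumes "holomorphic_at c x0"
  shows "polynomial_in_y x0 (\<lambda>(x, y :: complex ^ 'k::finite). c x)"
  by (rule polynomial_in_y_intro[of "{\<lambda>_. 0}" "\<lambda>_. c"]) (use assms in auto)

lemma polynomial_in_y_var:
  "polynomial_in_y x0 (\<lambda>(x :: 'x::complex_normed_space, y :: complex ^ 'k::finite). y $ j)"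
proof (rule polynomial_in_y_intro[of "{\<lambda>i. if i = j then 1 else 0}" "\<lambda>_ _. 1"])
  show "(case (x :: 'x, y :: complex ^ 'k) of (x, y) \<Rightarrow> y $ j) = (\<Sum>\<alpha>\<in>{\<lambda>i. if i = j then 1 else 0}. 1 * ymonom \<alpha> y)" for x y
    by (simp add: if_distrib[of "\<lambda>n. _ ^ n"] cong: if_cong)
qed (auto intro: holomorphic_at_const)

lemma polynomial_in_y_add:
  fixes f g :: "'x::complex_normed_space \<times> (complex ^ 'k::finite) \<Rightarrow> complex"
  assumes "polynomial_in_y x0 f" "polynomial_in_y x0 g"
  shows "polynomial_in_y x0 (\<lambda>p. f p + g p)"
proof -
  obtain A :: "('k \<Rightarrow> nat) set" and c where f: "finite A" "\<forall>\<alpha>\<in>A. holomorphic_at (c \<alpha>) x0"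
    "f = (\<lambda>(x, y). \<Sum>\<alpha>\<in>A. c \<alpha> x * ymonom \<alpha> y)" using assms(1) unfolding polynomial_in_y_def by blast
  obtain B :: "('k \<Rightarrow> nat) set" and d where g: "finite B" "\<forall>\<alpha>\<in>B. holomorphic_at (d \<alpha>) x0"
    "g = (\<lambda>(x, y). \<Sum>\<alpha>\<in>B. d \<alpha> x * ymonom \<alpha> y)" using assms(2) unfolding polynomial_in_y_def by blast
  show ?thesis
  proof (rule polynomial_in_y_intro[of "A \<union> B" "\<lambda>\<alpha> x. (if \<alpha> \<in> A then c \<alpha> x else 0) + (if \<alpha> \<in> B then d \<alpha> x else 0)"])
    show "holomorphic_at (\<lambda>x. (if \<alpha> \<in> A then c \<alpha> x else 0) + (if \<alpha> \<in> B then d \<alpha> x else 0)) x0" for \<alpha>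
      using f(2) g(2) holomorphic_at_const[of 0 x0]
      by (intro holomorphic_at_add; cases "\<alpha> \<in> A"; cases "\<alpha> \<in> B") simp_all
    have "(\<Sum>\<alpha>\<in>A. c \<alpha> x * ymonom \<alpha> y) = (\<Sum>\<alpha>\<in>A \<union> B. (if \<alpha> \<in> A then c \<alpha> x else 0) * ymonom \<alpha> y)"
      "(\<Sum>\<alpha>\<in>B. d \<alpha> x * ymonom \<alpha> y) = (\<Sum>\<alpha>\<in>A \<union> B. (if \<alpha> \<in> B then d \<alpha> x else 0) * ymonom \<alpha> y)" for x y
      using f(1) g(1) by (auto intro!: sum.mono_neutral_cong_left)
    then show "f (x, y) + g (x, y) = (\<Sum>\<alpha>\<in>A \<union> B. ((if \<alpha> \<in> A then c \<alpha> x else 0) + (if \<alpha> \<in> B then d \<alpha> x else 0)) * ymonom \<alpha> y)" for x y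
      by (simp add: f(3) g(3) distrib_right sum.distrib)
  qed (use f g in auto)
qed

text \<open>The products of monomials are grouped by their total exponent.\<close>

lemma polynomial_in_y_mult:
  fixes f g :: "'x::complex_normed_space \<times> (complex ^ 'k::finite) \<Rightarrow> complex"
  assumes "polynomial_in_y x0 f" "polynomial_in_y x0 g"
  shows "polynomial_in_y x0 (\<lambda>p. f p * g p)"
proof -
  obtain A :: "('k \<Rightarrow> nat) set" and c where f: "finite A" "\<forall>\<alpha>\<in>A. holomorphic_at (c \<alpha>) x0"
    "f = (\<lambda>(x, y). \<Sum>\<alpha>\<in>A. c \<alpha> x * ymonom \<alpha> y)" using assms(1) unfolding polynomial_in_y_def by blast
  obtain B :: "('k \<Rightarrow> nat) set" and d where g: "finite B" "\<forall>\<alpha>\<in>B. holomorphic_at (d \<alpha>) x0"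
    "g = (\<lambda>(x, y). \<Sum>\<alpha>\<in>B. d \<alpha> x * ymonom \<alpha> y)" using assms(2) unfolding polynomial_in_y_def by blast
  define h where "h = (\<lambda>(\<alpha> :: 'k \<Rightarrow> nat, \<beta> :: 'k \<Rightarrow> nat) i. \<alpha> i + \<beta> i)"
  show ?thesis
  proof (rule polynomial_in_y_intro[of "h ` (A \<times> B)" "\<lambda>\<gamma> x. \<Sum>p\<in>{p \<in> A \<times> B. h p = \<gamma>}. c (fst p) x * d (snd p) x"])
    show "holomorphic_at (\<lambda>x. \<Sum>p\<in>{p \<in> A \<times> B. h p = \<gamma>}. c (fst p) x * d (snd p) x) x0" for \<gamma>
      using f(2) g(2) by (intro holomorphic_at_sum holomorphic_at_mult) auto
    fix x y
    have "f (x, y) * g (x, y) = (\<Sum>p\<in>A \<times> B. c (fst p) x * d (snd p) x * ymonom (h p) y)"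
      by (simp add: f(3) g(3) sum_product sum.cartesian_product h_def power_add prod.distrib
          case_prod_beta ac_simps)
    also have "\<dots> = (\<Sum>\<gamma>\<in>h ` (A \<times> B). \<Sum>p\<in>{p \<in> A \<times> B. h p = \<gamma>}. c (fst p) x * d (snd p) x * ymonom (h p) y)"
      using f(1) g(1) by (intro sum.image_gen) auto
    also have "\<dots> = (\<Sum>\<gamma>\<in>h ` (A \<times> B). (\<Sum>p\<in>{p \<in> A \<times> B. h p = \<gamma>}. c (fst p) x * d (snd p) x) * ymonom \<gamma> y)"
      by (intro sum.cong refl) (auto simp: sum_distrib_right intro!: sum.cong)
    finally show "f (x, y) * g (x, y) = (\<Sum>\<gamma>\<in>h ` (A \<times> B). (\<Sum>p\<in>{p \<in> A \<times> B. h p = \<gamma>}. c (fst p) x * d (snd p) x) * ymonom \<gamma> y)" .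
  qed (use f g in auto)
qed

lemma polynomial_in_y_holomorphic:
  fixes f :: "'x::complex_normed_space \<times> (complex ^ 'k::finite) \<Rightarrow> complex"
  assumes "polynomial_in_y (fst p) f"
  shows "holomorphic_at f p"
proof -
  obtain A :: "('k \<Rightarrow> nat) set" and c where f: "finite A" "\<forall>\<alpha>\<in>A. holomorphic_at (c \<alpha>) (fst p)"
    "f = (\<lambda>(x, y). \<Sum>\<alpha>\<in>A. c \<alpha> x * ymonom \<alpha> y)" using assms unfolding polynomial_in_y_def by blast
  have "holomorphic_at (\<lambda>p. \<Sum>\<alpha>\<in>A. c \<alpha> (fst p) * ymonom \<alpha> (snd p)) p"
    using f(2) by (intro holomorphic_intros holomorphic_at_compose[OF _ holomorphic_at_fst refl]) auto
  then show ?thesis by (simp add: f(3) case_prod_beta')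
qed

lemma partially_rational_germs_alt:
  "partially_rational_germs p = {mero_germ p f / mero_germ p g | f g.
     polynomial_in_y (fst p) f \<and> polynomial_in_y (fst p) g \<and> germ_at p g \<noteq> 0}"
  unfolding partially_rational_germs_def using Fract_eq_mero_germ by (metis (no_types, lifting))

lemma mero_germ_in_partially_rational_germs:
  assumes "polynomial_in_y (fst p) f"
  shows "mero_germ p f \<in> partially_rational_germs p"
proof -
  have "polynomial_in_y (fst p) (\<lambda>_. 1)"
    using polynomial_in_y_coeff[OF holomorphic_at_const[of 1]] by (simp add: case_prod_beta')
  moreover have "mero_germ p f = Fract (germ_at p f) (germ_at p (\<lambda>_. 1))" "germ_at p (\<lambda>_. 1) \<noteq> 0"
    by (simp_all add: mero_germ_def germ_at_const)
  ultimately show ?thesis using assms unfolding partially_rational_germs_def by blast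
qed

lemma is_subfield_partially_rational_germs:
  fixes p :: "'x::complex_normed_space \<times> (complex ^ 'k::finite)"
  shows "is_subfield (partially_rational_germs p)"
proof -
  let ?K = "partially_rational_germs p"
  have const: "polynomial_in_y (fst p) (\<lambda>_ :: 'x \<times> (complex ^ 'k). k)" for k
    using polynomial_in_y_coeff[OF holomorphic_at_const[of k]] by (simp add: case_prod_beta')
  have KI: "Fract (germ_at p f) (germ_at p g) \<in> ?K"
    if "polynomial_in_y (fst p) f" "polynomial_in_y (fst p) g" "germ_at p g \<noteq> 0" for f g
    using that unfolding partially_rational_germs_def by blast
  have KE: "\<exists>f g. x = Fract (germ_at p f) (germ_at p g) \<and> polynomial_in_y (fst p) f \<and> polynomial_in_y (fst p) g
      \<and> germ_at p g \<noteq> 0" if "x \<in> ?K" for x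
    using that unfolding partially_rational_germs_def by blast
  note hol = polynomial_in_y_holomorphic
  have 0: "0 \<in> ?K" and 1: "1 \<in> ?K"
    using mero_germ_in_partially_rational_germs[OF const] mero_germ_const[of p] by metis+
  have add: "x + y \<in> ?K" and mult: "x * y \<in> ?K" and inv: "inverse x \<in> ?K" and neg: "- x \<in> ?K"
    if xy: "x \<in> ?K" "y \<in> ?K" for x y
  proof -
    obtain f g where x: "x = Fract (germ_at p f) (germ_at p g)" and
      f: "polynomial_in_y (fst p) f" and g: "polynomial_in_y (fst p) g" and g0: "germ_at p g \<noteq> 0"
      using KE[OF xy(1)] by blast
    obtain f' g' where y: "y = Fract (germ_at p f') (germ_at p g')" and
      f': "polynomial_in_y (fst p) f'" and g': "polynomial_in_y (fst p) g'" and g0': "germ_at p g' \<noteq> 0"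
      using KE[OF xy(2)] by blast
    note gm = germ_at_mult[OF hol hol]
    have gg: "germ_at p (\<lambda>q. g q * g' q) \<noteq> 0" using g0 g0' gm[OF g g'] by simp
    have "x + y = Fract (germ_at p (\<lambda>q. f q * g' q + f' q * g q)) (germ_at p (\<lambda>q. g q * g' q))"
      using g0 g0' germ_at_add[OF hol[OF polynomial_in_y_mult[OF f g']] hol[OF polynomial_in_y_mult[OF f' g]]]
      by (simp add: x y gm f g f' g')
    then show "x + y \<in> ?K"
      using KI[OF polynomial_in_y_add[OF polynomial_in_y_mult[OF f g'] polynomial_in_y_mult[OF f' g]] polynomial_in_y_mult[OF g g'] gg]
      by simp
    have "x * y = Fract (germ_at p (\<lambda>q. f q * f' q)) (germ_at p (\<lambda>q. g q * g' q))"
      by (simp add: x y gm f g f' g')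
    then show "x * y \<in> ?K" using KI[OF polynomial_in_y_mult[OF f f'] polynomial_in_y_mult[OF g g'] gg] by simp
    show "inverse x \<in> ?K"
    proof (cases "germ_at p f = 0")
      case True
      then have "x = 0" by (simp add: x Zero_fract_def eq_fract g0)
      then show ?thesis using 0 by simp
    next
      case False
      then show ?thesis using KI[OF g f] by (simp add: x)
    qed
    have "- x = Fract (germ_at p (\<lambda>q. (-1) * f q)) (germ_at p g)"
      using gm[OF const[of "-1"] f] germ_at_uminus[OF holomorphic_at_const[of 1], of p] by (simp add: x germ_at_const)
    then show "- x \<in> ?K" using KI[OF polynomial_in_y_mult[OF const[of "-1"] f] g g0] by simp
  qed
  show ?thesis
    unfolding is_subfield_def using 0 1 add mult inv neg by (metis diff_conv_add_uminus)
qed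

section \<open>Functions of the jet read on the Segre family\<close>

locale segre_jet = segre_family M U r R \<rho> for M :: "'n::finite ambient set" and U r R \<rho> +
  fixes A B
  assumes levi: "levi_nondegenerate M"
    and params: "segre_parameters \<rho> A B"
begin

abbreviation "p0 \<equiv> jet_map 0"
abbreviation "S \<equiv> jet_inverse A B"

lemmas S_hol = jet_inverse(1)[OF levi params]
lemmas S_0 = jet_inverse(2)[OF levi params]
lemmas jet_S = jet_inverse(3)[OF levi params]
lemmas S_jet = jet_inverse(4)[OF levi params]

abbreviation K :: "'n jet meromorphic_germ set"
  where "K \<equiv> partially_rational_germs p0"

definition L :: "'n jet meromorphic_germ set"
  where "L = field_adjoin K (mero_germ p0 ` {associated_system \<rho> A B k l | k l. True})"

lemma jet_transcendence: "transcendence_degree_in_y (jet_base_point \<rho>) {associated_system \<rho> A B k l | k l. True}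
    = transcendence_degree K L"
  by (simp add: transcendence_degree_in_y_def L_def jet_base_point_eq mero_germ_def Let_def)

lemma subK: "is_subfield K" by (rule is_subfield_partially_rational_germs)
lemma subL: "is_subfield L" unfolding L_def by (rule is_subfield_field_adjoin)
lemma K_L: "K \<subseteq> L" unfolding L_def by (rule field_adjoin_incl)

text \<open>A function of the parameters \<open>(z, \<zeta>)\<close>, regarded as a germ on jet space by means of the
  inverse of the jet map.\<close>

definition jet_germ :: "('n segre_param \<Rightarrow> complex) \<Rightarrow> 'n jet meromorphic_germ"
  where "jet_germ f = mero_germ p0 (\<lambda>q. f (S q))"

lemma comp_S_hol: "holomorphic_at f 0 \<Longrightarrow> holomorphic_at (\<lambda>q. f (S q)) p0"
  by (rule holomorphic_at_compose[OF _ S_hol S_0])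

lemma jet_germ_cong: "holomorphic_at f 0 \<Longrightarrow> \<forall>\<^sub>F x in nhds 0. f x = g x \<Longrightarrow> jet_germ f = jet_germ g"
  unfolding jet_germ_def by (rule mero_germ_cong[OF comp_S_hol]) (auto intro: eventually_holomorphic_compose[OF _ S_hol S_0])

lemma jet_germ_add: "holomorphic_at f 0 \<Longrightarrow> holomorphic_at g 0 \<Longrightarrow> jet_germ (\<lambda>x. f x + g x) = jet_germ f + jet_germ g"
  unfolding jet_germ_def by (intro mero_germ_add comp_S_hol)

lemma jet_germ_mult: "holomorphic_at f 0 \<Longrightarrow> holomorphic_at g 0 \<Longrightarrow> jet_germ (\<lambda>x. f x * g x) = jet_germ f * jet_germ g"
  unfolding jet_germ_def by (intro mero_germ_mult comp_S_hol)

lemma jet_germ_sum: "(\<And>i. i \<in> I \<Longrightarrow> holomorphic_at (f i) 0) \<Longrightarrow> jet_germ (\<lambda>x. \<Sum>i\<in>I. f i x) = (\<Sum>i\<in>I. jet_germ (f i))"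
  unfolding jet_germ_def by (intro mero_germ_sum comp_S_hol)

lemma jet_germ_const: "jet_germ (\<lambda>x. 0) = 0" "jet_germ (\<lambda>x. 1) = 1"
  by (simp_all add: jet_germ_def mero_germ_const)

lemma point_S: "\<forall>\<^sub>F q in nhds p0. segre_point (S q) = fst q"
  using jet_S
proof eventually_elim
  case (elim q)
  have "fst (jet_map (S q)) = fst q" by (simp only: elim)
  then show ?case by (simp add: jet_map_def)
qed

lemma slope_S: "\<forall>\<^sub>F q in nhds p0. dd (zdir j) \<rho> (S q) = snd q $ j"
  using jet_S
proof eventually_elim
  case (elim q)
  have "snd (jet_map (S q)) $ j = snd q $ j" by (simp only: elim)
  then show ?case by (simp add: jet_map_def)
qed

lemma comp_point_hol: "holomorphic_at \<phi> 0 \<Longrightarrow> holomorphic_at (\<lambda>x. \<phi> (segre_point x)) 0"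
  by (rule holomorphic_at_compose[OF _ segre_point_hol segre_point_0])

lemma jet_germ_point_K:
  assumes "holomorphic_at \<phi> 0"
  shows "jet_germ (\<lambda>x. \<phi> (segre_point x)) \<in> K"
proof -
  have "jet_germ (\<lambda>x. \<phi> (segre_point x)) = mero_germ p0 (\<lambda>(x, y). \<phi> x)"
    unfolding jet_germ_def
    by (rule mero_germ_cong[OF comp_S_hol[OF comp_point_hol[OF assms]]])
      (use point_S in \<open>auto elim!: eventually_mono split: prod.split\<close>)
  moreover have "fst p0 = 0" by (simp add: jet_map_def)
  ultimately show ?thesis
    using mero_germ_in_partially_rational_germs[OF polynomial_in_y_coeff] assms by metis
qed

text \<open>The slope is the coordinate \<open>w'\<^sub>j\<close>, a polynomial in \<open>w'\<close>.\<close>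

lemma jet_germ_slope_K: "jet_germ (dd (zdir j) \<rho>) \<in> K"
proof -
  have "jet_germ (dd (zdir j) \<rho>) = mero_germ p0 (\<lambda>(x, y). y $ j)"
    unfolding jet_germ_def
    by (rule mero_germ_cong[OF comp_S_hol[OF rho_z_hol]])
      (use slope_S[of j] in \<open>auto elim!: eventually_mono split: prod.split\<close>)
  then show ?thesis using mero_germ_in_partially_rational_germs[OF polynomial_in_y_var] by metis
qed

lemma associated_system_eq:
  "\<forall>\<^sub>F q in nhds p0. associated_system \<rho> A B k l q = dd (zdir l) (dd (zdir k) \<rho>) (S q)"
proof -
  have 1: "\<forall>\<^sub>F x in nhds 0. partial_z k \<rho> x = dd (zdir k) \<rho> x" by (rule eventually_partial_z[OF rho_hol])
  then have "holomorphic_at (partial_z k \<rho>) 0" using holomorphic_at_cong rho_z_hol by blast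
  from eventually_partial_z[OF this, of l] eventually_dd_cong[OF 1, of "zdir l"]
  have "\<forall>\<^sub>F x in nhds 0. partial_z l (partial_z k \<rho>) x = dd (zdir l) (dd (zdir k) \<rho>) x"
    by eventually_elim simp
  from eventually_holomorphic_compose[OF this S_hol S_0]
  have "\<forall>\<^sub>F q in nhds p0. partial_z l (partial_z k \<rho>) (S q) = dd (zdir l) (dd (zdir k) \<rho>) (S q)" .
  then show ?thesis
    by eventually_elim (auto simp: associated_system_def jet_inverse_def split: prod.splits)
qed

lemma rho_zz_hol: "holomorphic_at (dd u (dd v \<rho>)) 0"
  by (rule holomorphic_at_dd(1)[OF rho_z_hol])

lemma mero_germ_associated_system: "mero_germ p0 (associated_system \<rho> A B k l) = jet_germ (dd (zdir l) (dd (zdir k) \<rho>))"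
  unfolding jet_germ_def
  by (rule mero_germ_cong[symmetric, OF comp_S_hol[OF rho_zz_hol]])
    (use associated_system_eq[of k l] in \<open>auto elim: eventually_mono\<close>)

lemma jet_germ_curvature_L: "jet_germ (dd (zdir l) (dd (zdir k) \<rho>)) \<in> L"
  unfolding L_def mero_germ_associated_system[symmetric] by (rule subsetD[OF field_adjoin_incl(2)]) blast

text \<open>In jet coordinates the right-hand side is the total derivative
  \<open>\<phi>\<^sub>z\<^sub>j + w'\<^sub>j \<phi>\<^sub>w\<close>, which is affine in \<open>w'\<close>.\<close>

lemma tangential_derivative:
  fixes \<phi> :: "'n ambient \<Rightarrow> complex"
  assumes \<phi>: "holomorphic_at \<phi> 0"
  shows "\<forall>\<^sub>F x in nhds 0. dd (zdir j) (\<lambda>x. \<phi> (segre_point x)) x =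
    dd (axis j 1, 0) \<phi> (segre_point x) + dd (zdir j) \<rho> x * dd (0, 1) \<phi> (segre_point x)"
  using eventually_holomorphic_compose[OF \<phi>[unfolded holomorphic_at_iff] segre_point_hol segre_point_0]
    rho_hol[unfolded holomorphic_at_iff]
proof eventually_elim
  case (elim x)
  show ?case
    using cdiff_compose(2)[OF dd_segre_point(1)[OF elim(2)] elim(1), of "zdir j"]
      dd_segre_point(2)[OF elim(2), of "zdir j"]
      dd_add_dir[OF elim(1), of "(axis j 1, 0)" "dd (zdir j) \<rho> x *\<^sub>C (0, 1)"]
      cdiffD(2)[OF elim(1), of "dd (zdir j) \<rho> x" "(0, 1)"]
    by simp
qed

lemma tangential_hol:
  fixes \<phi> :: "'n ambient \<Rightarrow> complex"
  assumes "holomorphic_at \<phi> 0"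
  shows "holomorphic_at (dd v (\<lambda>x. \<phi> (segre_point x))) 0"
  by (rule holomorphic_at_dd(1)[OF comp_point_hol[OF assms]])

lemma jet_germ_tangential_K:
  fixes \<phi> :: "'n ambient \<Rightarrow> complex"
  assumes \<phi>: "holomorphic_at \<phi> 0"
  shows "jet_germ (dd (zdir j) (\<lambda>x. \<phi> (segre_point x))) \<in> K"
proof -
  note h = holomorphic_at_dd(1)[OF \<phi>]
  have "jet_germ (dd (zdir j) (\<lambda>x. \<phi> (segre_point x))) =
      jet_germ (\<lambda>x. dd (axis j 1, 0) \<phi> (segre_point x)) + jet_germ (dd (zdir j) \<rho>) * jet_germ (\<lambda>x. dd (0, 1) \<phi> (segre_point x))"
    by (subst jet_germ_cong[OF tangential_hol[OF \<phi>] tangential_derivative[OF \<phi>]])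
      (simp add: jet_germ_add jet_germ_mult comp_point_hol h rho_z_hol holomorphic_at_mult)
  then show ?thesis
    using jet_germ_point_K h jet_germ_slope_K is_subfieldD(4,5)[OF subK] by metis
qed

text \<open>In the second total derivative of \<open>\<phi>\<close> the only terms that are not rational in \<open>w'\<close> are those
  with the factor \<open>\<rho>\<^sub>z\<^sub>j\<^sub>z\<^sub>k\<close>, which is \<open>\<Phi>\<^sub>j\<^sub>k\<close>.\<close>

lemma jet_germ_tangential2_L:
  fixes \<phi> :: "'n ambient \<Rightarrow> complex"
  assumes \<phi>: "holomorphic_at \<phi> 0"
  shows "jet_germ (dd (zdir k) (dd (zdir j) (\<lambda>x. \<phi> (segre_point x)))) \<in> L"
proof -
  let ?a = "\<lambda>x. dd (axis j 1, 0) \<phi> (segre_point x)" and ?w = "\<lambda>x. dd (0, 1) \<phi> (segre_point x)"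
  note h = holomorphic_at_dd(1)[OF \<phi>]
  have ha: "holomorphic_at ?a 0" and hw: "holomorphic_at ?w 0" using h comp_point_hol by blast+
  have "\<forall>\<^sub>F x in nhds 0. dd (zdir k) (\<lambda>x. ?a x + dd (zdir j) \<rho> x * ?w x) x =
      dd (zdir k) ?a x + (dd (zdir k) (dd (zdir j) \<rho>) x * ?w x + dd (zdir j) \<rho> x * dd (zdir k) ?w x)"
    using ha hw rho_z_hol[of "zdir j"] unfolding holomorphic_at_iff
    by eventually_elim (simp add: cdiff_add cdiff_mult)
  with eventually_dd_cong[OF tangential_derivative[OF \<phi>, of j], of "zdir k"]
  have ev: "\<forall>\<^sub>F x in nhds 0. dd (zdir k) (dd (zdir j) (\<lambda>x. \<phi> (segre_point x))) x =
      dd (zdir k) ?a x + (dd (zdir k) (dd (zdir j) \<rho>) x * ?w x + dd (zdir j) \<rho> x * dd (zdir k) ?w x)"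
    by eventually_elim simp
  have "jet_germ (dd (zdir k) (dd (zdir j) (\<lambda>x. \<phi> (segre_point x)))) =
    jet_germ (dd (zdir k) ?a) + (jet_germ (dd (zdir k) (dd (zdir j) \<rho>)) * jet_germ ?w + jet_germ (dd (zdir j) \<rho>) * jet_germ (dd (zdir k) ?w))"
    by (subst jet_germ_cong[OF holomorphic_at_dd(1)[OF tangential_hol[OF \<phi>]] ev])
      (simp add: jet_germ_add jet_germ_mult ha hw rho_z_hol rho_zz_hol holomorphic_at_dd(1) holomorphic_at_mult holomorphic_at_add)
  moreover have "jet_germ (dd (zdir k) ?a) \<in> L" "jet_germ ?w \<in> L" "jet_germ (dd (zdir j) \<rho>) \<in> L" "jet_germ (dd (zdir k) ?w) \<in> L"
    using K_L jet_germ_tangential_K h jet_germ_point_K jet_germ_slope_K by blast+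
  ultimately show ?thesis
    using jet_germ_curvature_L is_subfieldD(4,5)[OF subL] by simp
qed

end

section \<open>The prolonged map\<close>

text \<open>The map that \<open>H\<close> induces on the parameters of Segre families: the point with first component
  \<open>z\<close> on the Segre variety with parameter \<open>\<zeta>\<close> is mapped to a point on the Segre variety with
  parameter \<open>conj (H (conj \<zeta>))\<close>.\<close>

definition segre_transfer ::
    "('n::finite segre_param \<Rightarrow> complex) \<Rightarrow> ('n ambient \<Rightarrow> 'n ambient) \<Rightarrow>
     'n segre_param \<Rightarrow> 'n segre_param"
  where "segre_transfer \<rho> H x = (fst (H (fst x, \<rho> x)), conj_point (H (conj_point (snd x))))"

text \<open>Only one of the two compositions of \<open>H\<close> and \<open>G\<close> is recorded. The other one belongs to the instance
  with source and target exchanged.\<close>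

locale segre_map =
  src: segre_jet M U r R \<rho> A B + tgt: segre_jet M' U' r' R' \<rho>' A' B'
  for M :: "'n::finite ambient set" and U r R \<rho> A B and M' :: "'n ambient set" and U' r' R' \<rho>' A' B' +
  fixes H G :: "'n ambient \<Rightarrow> 'n ambient"
  assumes H_hol: "holomorphic_at H 0" and H_0: "H 0 = 0"
    and H_M: "\<forall>\<^sub>F Z in nhds 0. Z \<in> M \<longrightarrow> H Z \<in> M'"
    and G_hol: "holomorphic_at G 0"
    and GH: "\<forall>\<^sub>F Z in nhds 0. G (H Z) = Z"
begin

abbreviation "\<theta> \<equiv> segre_transfer \<rho> H"
abbreviation "\<theta>' \<equiv> segre_transfer \<rho>' G"

lemma conj_H: "holomorphic_at (\<lambda>\<zeta>. conj_point (H (conj_point \<zeta>))) 0" "conj_point (H (conj_point 0)) = 0"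
  using holomorphic_at_conjugate[OF conjugation_conj_point conjugation_conj_point H_hol conj_point(6)] H_0
  by (simp_all add: conj_point)

lemma conj_G: "holomorphic_at (\<lambda>\<zeta>. conj_point (G (conj_point \<zeta>))) 0"
  by (rule holomorphic_at_conjugate[OF conjugation_conj_point conjugation_conj_point G_hol conj_point(6)])

lemma theta_eq: "\<theta> x = (fst (H (src.segre_point x)), conj_point (H (conj_point (snd x))))"
  by (simp add: segre_transfer_def src.segre_point_def)

lemma theta'_eq: "\<theta>' x = (fst (G (tgt.segre_point x)), conj_point (G (conj_point (snd x))))"
  by (simp add: segre_transfer_def tgt.segre_point_def)

lemma theta_hol: "holomorphic_at \<theta> 0" and theta_0: "\<theta> 0 = 0"
  unfolding theta_eq[abs_def]
  by (intro holomorphic_at_Pair holomorphic_at_fst_comp src.comp_point_hol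
      holomorphic_at_compose[OF H_hol src.segre_point_hol src.segre_point_0]
      holomorphic_at_compose[OF conj_H(1) holomorphic_at_snd snd_zero])
    (simp add: H_0 conj_H(2) Pair_zero)

lemma theta'_hol: "holomorphic_at \<theta>' 0"
  unfolding theta'_eq[abs_def]
  by (intro holomorphic_at_Pair holomorphic_at_fst_comp
      holomorphic_at_compose[OF G_hol tgt.segre_point_hol tgt.segre_point_0]
      holomorphic_at_compose[OF conj_G holomorphic_at_snd snd_zero])

lemma correspondence: "\<forall>\<^sub>F x in nhds 0. snd (H (src.segre_point x)) = \<rho>' (\<theta> x)"
  using segre_correspondence[OF src.segre_family_axioms tgt.segre_family_axioms H_hol H_0 H_M]
  by (simp add: theta_eq)

lemma point_theta: "\<forall>\<^sub>F x in nhds 0. tgt.segre_point (\<theta> x) = H (src.segre_point x)"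
  using correspondence by eventually_elim (simp add: tgt.segre_point_def prod_eq_iff, simp add: theta_eq)

text \<open>By \<open>point_theta\<close>, the point of the target Segre variety with parameters \<open>\<theta> x\<close> is the image
  of the point with parameters \<open>x\<close>, and \<open>G\<close> takes it back.\<close>

lemma theta'_theta: "\<forall>\<^sub>F x in nhds 0. \<theta>' (\<theta> x) = x"
proof -
  have cs: "filterlim (\<lambda>x::'n segre_param. conj_point (snd x)) (nhds 0) (nhds 0)"
    by (rule filterlim_compose[OF filterlim_conjugation[OF conjugation_conj_point conj_point(6)]
          holomorphic_at_filterlim[OF holomorphic_at_snd snd_zero]])
  show ?thesis
    using point_theta eventually_holomorphic_compose[OF GH src.segre_point_hol src.segre_point_0]
      eventually_compose_filterlim[OF GH cs]
  proof eventually_elim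
    case (elim x)
    have "snd (\<theta> x) = conj_point (H (conj_point (snd x)))" by (simp add: theta_eq)
    then show ?case
      using elim by (simp add: theta'_eq[of "\<theta> x"] conj_point src.segre_point_def)
  qed
qed

text \<open>The Jacobian matrix in \<open>z\<close> of the first component of \<open>\<theta>\<close>, with the rows indexed by the
  direction of differentiation.\<close>

definition P :: "'n \<Rightarrow> 'n \<Rightarrow> 'n segre_param \<Rightarrow> complex"
  where "P j i = dd (zdir j) (\<lambda>x. fst (H (src.segre_point x)) $ i)"

lemma fst_H_hol: "holomorphic_at (\<lambda>Z. fst (H Z) $ i) 0"
  by (intro holomorphic_intros H_hol)

lemma snd_H_hol: "holomorphic_at (\<lambda>Z. snd (H Z)) 0"
  by (intro holomorphic_intros H_hol)

lemma P_hol: "holomorphic_at (P j i) 0"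
  unfolding P_def by (rule src.tangential_hol[OF fst_H_hol])

text \<open>The second component of \<open>\<theta>\<close> does not depend on \<open>z\<close>, so only derivatives of \<open>f\<close> in \<open>z\<close>
  contribute.\<close>

lemma chain:
  fixes f :: "'n segre_param \<Rightarrow> complex"
  assumes f: "holomorphic_at f 0"
  shows "\<forall>\<^sub>F x in nhds 0. dd (zdir j) (\<lambda>x. f (\<theta> x)) x = (\<Sum>i\<in>UNIV. P j i x * dd (zdir i) f (\<theta> x))"
proof -
  have 1: "holomorphic_at (\<lambda>x. fst (H (src.segre_point x))) 0"
    by (intro holomorphic_intros holomorphic_at_compose[OF H_hol src.segre_point_hol src.segre_point_0])
  have ev2: "\<forall>\<^sub>F x in nhds (0::'n segre_param). cdiff (\<lambda>\<zeta>. conj_point (H (conj_point \<zeta>))) (snd x)"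
    by (rule eventually_holomorphic_compose[OF conj_H(1)[unfolded holomorphic_at_iff] holomorphic_at_snd snd_zero])
  show ?thesis
    using 1[unfolded holomorphic_at_iff] ev2
      eventually_holomorphic_compose[OF f[unfolded holomorphic_at_iff] theta_hol theta_0]
      theta_hol[unfolded holomorphic_at_iff]
  proof eventually_elim
    case (elim x)
    have c2: "cdiff (\<lambda>x. conj_point (H (conj_point (snd x)))) x"
      "dd (zdir j) (\<lambda>x. conj_point (H (conj_point (snd x)))) x = 0"
      using cdiff_compose[OF cdiff_snd elim(2)] dd_zero_dir[OF elim(2)] by simp_all
    have c1: "dd (zdir j) (\<lambda>x. fst (H (src.segre_point x))) x $ i = P j i x" for i
      unfolding P_def using cdiff_compose(2)[OF elim(1) cdiff_vec_nth, of "zdir j" i] by simp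
    have d\<theta>: "dd (zdir j) \<theta> x = (\<chi> i. P j i x, 0)"
      unfolding theta_eq[abs_def] using cdiff_Pair(2)[OF elim(1) c2(1), of "zdir j"] c1 c2(2)
      by (simp add: vec_eq_iff)
    have "dd (zdir j) (\<lambda>x. f (\<theta> x)) x = dd (\<chi> i. P j i x, 0) f (\<theta> x)"
      unfolding d\<theta>[symmetric] by (rule cdiff_compose(2)[OF elim(4,3)])
    also have "\<dots> = (\<Sum>i\<in>UNIV. P j i x * dd (zdir i) f (\<theta> x))"
      using dd_z_direction[OF elim(3), of "\<chi> i. P j i x"] by simp
    finally show ?case .
  qed
qed

lemma slope_hol: "holomorphic_at (\<lambda>x. dd v \<rho>' (\<theta> x)) 0"
  by (rule holomorphic_at_compose[OF tgt.rho_z_hol theta_hol theta_0])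

lemma curvature_hol: "holomorphic_at (\<lambda>x. dd u (dd v \<rho>') (\<theta> x)) 0"
  by (rule holomorphic_at_compose[OF tgt.rho_zz_hol theta_hol theta_0])

text \<open>The identity \<open>correspondence\<close>, differentiated along \<open>z\<close> once and, in \<open>second_order\<close>, twice.\<close>

lemma first_order: "\<forall>\<^sub>F x in nhds 0. dd (zdir j) (\<lambda>x. snd (H (src.segre_point x))) x
    = (\<Sum>i\<in>UNIV. P j i x * dd (zdir i) \<rho>' (\<theta> x))"
  using eventually_dd_cong[OF correspondence, of "zdir j"] chain[OF tgt.rho_hol, of j]
  by eventually_elim simp

lemma second_order: "\<forall>\<^sub>F x in nhds 0. dd (zdir k) (dd (zdir j) (\<lambda>x. snd (H (src.segre_point x)))) x
    = (\<Sum>i\<in>UNIV. dd (zdir k) (P j i) x * dd (zdir i) \<rho>' (\<theta> x)) +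
      (\<Sum>i\<in>UNIV. P j i x * (\<Sum>l\<in>UNIV. P k l x * dd (zdir l) (dd (zdir i) \<rho>') (\<theta> x)))"
proof -
  have "\<forall>\<^sub>F x in nhds 0. \<forall>i. cdiff (P j i) x \<and> cdiff (\<lambda>x. dd (zdir i) \<rho>' (\<theta> x)) x"
    using P_hol slope_hol by (simp add: eventually_all_finite eventually_conj holomorphic_at_iff)
  moreover have "\<forall>\<^sub>F x in nhds 0. \<forall>i. dd (zdir k) (\<lambda>x. dd (zdir i) \<rho>' (\<theta> x)) x
      = (\<Sum>l\<in>UNIV. P k l x * dd (zdir l) (dd (zdir i) \<rho>') (\<theta> x))"
    using chain[OF tgt.rho_z_hol] by (simp add: eventually_all_finite)
  ultimately show ?thesis
    using eventually_dd_cong[OF first_order[of j], of "zdir k"]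
    by eventually_elim (simp add: cdiff_sum cdiff_mult sum.distrib)
qed

definition Q :: "'n \<Rightarrow> 'n \<Rightarrow> 'n segre_param \<Rightarrow> complex"
  where "Q i m x = dd (zdir i) (\<lambda>x. fst (\<theta>' x) $ m) (\<theta> x)"

lemma fst_theta'_hol: "holomorphic_at (\<lambda>x. fst (\<theta>' x) $ m) 0"
  by (intro holomorphic_intros theta'_hol)

lemma Q_hol: "holomorphic_at (Q i m) 0"
  unfolding Q_def[abs_def]
  by (rule holomorphic_at_compose[OF holomorphic_at_dd(1)[OF fst_theta'_hol] theta_hol theta_0])

text \<open>The matrices \<open>P\<close> and \<open>Q\<close> are the Jacobian matrices of \<open>\<theta>\<close> and of its inverse, taken along the
  first component.\<close>

lemma PQ: "\<forall>\<^sub>F x in nhds 0. (\<Sum>i\<in>UNIV. P j i x * Q i m x) = (if j = m then 1 else 0)"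
proof -
  have "\<forall>\<^sub>F x in nhds 0. fst (\<theta>' (\<theta> x)) $ m = fst x $ m"
    using theta'_theta by eventually_elim simp
  from eventually_dd_cong[OF this, of "zdir j"] chain[OF fst_theta'_hol, of j m]
  show ?thesis
  proof eventually_elim
    case (elim x)
    have "dd (zdir j) (\<lambda>x::'n segre_param. fst x $ m) x = axis j 1 $ m"
      by (simp add: cdiff_compose(2)[OF cdiff_fst cdiff_vec_nth])
    then show ?case using elim by (simp add: Q_def axis_def eq_commute)
  qed
qed

abbreviation "Pm \<equiv> (\<chi> j i. src.jet_germ (P j i))"

lemma Pm_inverse: "Pm ** (\<chi> i m. src.jet_germ (Q i m)) = mat 1"
proof -
  have "(\<Sum>i\<in>UNIV. src.jet_germ (P j i) * src.jet_germ (Q i m)) = (if j = m then 1 else 0)" for j m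
  proof -
    have "(\<Sum>i\<in>UNIV. src.jet_germ (P j i) * src.jet_germ (Q i m)) = src.jet_germ (\<lambda>x. \<Sum>i\<in>UNIV. P j i x * Q i m x)"
      by (simp add: src.jet_germ_sum src.jet_germ_mult P_hol Q_hol holomorphic_at_mult)
    also have "\<dots> = src.jet_germ (\<lambda>x. if j = m then 1 else 0)"
      by (rule src.jet_germ_cong[OF _ PQ]) (intro holomorphic_intros P_hol Q_hol)
    finally show ?thesis by (simp add: src.jet_germ_const)
  qed
  then show ?thesis by (simp add: matrix_matrix_mult_def mat_def vec_eq_iff)
qed

lemma P_K: "src.jet_germ (P j i) \<in> src.K"
  unfolding P_def by (rule src.jet_germ_tangential_K[OF fst_H_hol])

text \<open>The slopes of the image Segre variety solve the linear system \<open>first_order\<close> over the field \<open>K\<close>.\<close>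

lemma slope_K: "src.jet_germ (\<lambda>x. dd (zdir i) \<rho>' (\<theta> x)) \<in> src.K"
proof -
  let ?x = "\<chi> i. src.jet_germ (\<lambda>x. dd (zdir i) \<rho>' (\<theta> x))"
  have "(Pm *v ?x) $ j \<in> src.K" for j
  proof -
    have "(Pm *v ?x) $ j = (\<Sum>i\<in>UNIV. src.jet_germ (P j i) * src.jet_germ (\<lambda>x. dd (zdir i) \<rho>' (\<theta> x)))"
      by (simp add: matrix_vector_mult_def)
    also have "\<dots> = src.jet_germ (\<lambda>x. \<Sum>i\<in>UNIV. P j i x * dd (zdir i) \<rho>' (\<theta> x))"
      by (simp add: src.jet_germ_sum src.jet_germ_mult P_hol slope_hol holomorphic_at_mult)
    also have "\<dots> = src.jet_germ (dd (zdir j) (\<lambda>x. snd (H (src.segre_point x))))"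
      by (rule src.jet_germ_cong[symmetric, OF src.tangential_hol[OF snd_H_hol] first_order])
    also have "\<dots> \<in> src.K" by (rule src.jet_germ_tangential_K[OF snd_H_hol])
    finally show ?thesis .
  qed
  from subfield_linear_solution[OF src.subK _ Pm_inverse this, of i] show ?thesis
    by (simp add: P_K)
qed

text \<open>By \<open>second_order\<close>, the matrix of second derivatives of \<open>\<rho>'\<close> is multiplied by \<open>P\<close> from both sides.
  The two factors are removed one after the other; \<open>y k\<close> is the vector that remains after the
  first step.\<close>

lemma curvature_L: "src.jet_germ (\<lambda>x. dd (zdir l) (dd (zdir i) \<rho>') (\<theta> x)) \<in> src.L"
proof -
  define y where "y k i = src.jet_germ (\<lambda>x. \<Sum>l\<in>UNIV. P k l x * dd (zdir l) (dd (zdir i) \<rho>') (\<theta> x))" for k i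
  have hy: "holomorphic_at (\<lambda>x. \<Sum>l\<in>UNIV. P k l x * dd (zdir l) (dd (zdir i) \<rho>') (\<theta> x)) 0" for k i
    by (intro holomorphic_intros P_hol curvature_hol)
  have PL: "Pm $ j $ i \<in> src.L" for j i using P_K src.K_L by auto
  have yL: "y k i \<in> src.L" for k i
  proof -
    have "(Pm *v (\<chi> i. y k i)) $ j \<in> src.L" for j
    proof -
      let ?D = "src.jet_germ (dd (zdir k) (dd (zdir j) (\<lambda>x. snd (H (src.segre_point x)))))"
      let ?E = "\<Sum>i\<in>UNIV. src.jet_germ (dd (zdir k) (P j i)) * src.jet_germ (\<lambda>x. dd (zdir i) \<rho>' (\<theta> x))"
      have "?D = ?E + (\<Sum>i\<in>UNIV. src.jet_germ (P j i) * y k i)"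
        by (subst src.jet_germ_cong[OF holomorphic_at_dd(1)[OF src.tangential_hol[OF snd_H_hol]] second_order])
          (simp add: src.jet_germ_add src.jet_germ_sum src.jet_germ_mult y_def P_hol slope_hol hy holomorphic_at_dd(1)
            holomorphic_at_mult holomorphic_at_sum curvature_hol)
      then have "(Pm *v (\<chi> i. y k i)) $ j = ?D - ?E" by (simp add: matrix_vector_mult_def)
      moreover have "?D \<in> src.L" by (rule src.jet_germ_tangential2_L[OF snd_H_hol])
      moreover have "?E \<in> src.L"
        using src.jet_germ_tangential2_L[OF fst_H_hol] slope_K src.K_L
        by (intro is_subfieldD(9,5)[OF src.subL]) (auto simp: P_def)
      ultimately show ?thesis using is_subfieldD(3)[OF src.subL] by simp
    qed
    from subfield_linear_solution[OF src.subL PL Pm_inverse this, of i] show ?thesis by simp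
  qed
  let ?x = "\<chi> l. src.jet_germ (\<lambda>x. dd (zdir l) (dd (zdir i) \<rho>') (\<theta> x))"
  have "(Pm *v ?x) $ k \<in> src.L" for k
  proof -
    have "(Pm *v ?x) $ k = y k i"
      by (simp add: matrix_vector_mult_def y_def src.jet_germ_sum src.jet_germ_mult P_hol curvature_hol holomorphic_at_mult)
    then show ?thesis using yL by simp
  qed
  from subfield_linear_solution[OF src.subL PL Pm_inverse this, of l] show ?thesis by simp
qed

text \<open>The map of jets induced by \<open>H\<close>.\<close>

definition prolongation :: "'n jet \<Rightarrow> 'n jet"
  where "prolongation q = tgt.jet_map (\<theta> (src.S q))"

lemma theta_S_hol: "holomorphic_at (\<lambda>q. \<theta> (src.S q)) src.p0"
  by (rule src.comp_S_hol[OF theta_hol])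

lemma prolongation_hol: "holomorphic_at prolongation src.p0" and prolongation_p0: "prolongation src.p0 = tgt.p0"
  unfolding prolongation_def[abs_def]
  by (rule holomorphic_at_compose[OF tgt.jet_map_hol theta_S_hol]) (simp_all add: src.S_0 theta_0)

lemma fst_prolongation: "\<forall>\<^sub>F q in nhds src.p0. fst (prolongation q) = H (fst q)"
  using eventually_holomorphic_compose[OF point_theta src.S_hol src.S_0] src.point_S
  by eventually_elim (simp add: prolongation_def tgt.jet_map_def)

lemma snd_prolongation_K: "mero_germ src.p0 (\<lambda>q. snd (prolongation q) $ i) \<in> src.K"
  using slope_K[of i] by (simp add: src.jet_germ_def prolongation_def tgt.jet_map_def)

text \<open>The prolongation is \<open>H\<close> in the variables \<open>(z, w)\<close> and rational in \<open>w'\<close> in the remaining ones.\<close>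

lemma polynomial_prolongation_K:
  assumes "polynomial_in_y (fst tgt.p0) f"
  shows "mero_germ src.p0 (\<lambda>q. f (prolongation q)) \<in> src.K"
proof -
  have p0: "fst src.p0 = 0" "fst tgt.p0 = 0" by (simp_all add: src.jet_map_def tgt.jet_map_def)
  obtain C :: "('n \<Rightarrow> nat) set" and c where f: "finite C" "\<forall>\<alpha>\<in>C. holomorphic_at (c \<alpha>) 0"
    "f = (\<lambda>(x, y). \<Sum>\<alpha>\<in>C. c \<alpha> x * ymonom \<alpha> y)"
    using assms unfolding polynomial_in_y_def p0 by blast
  have hx: "holomorphic_at (\<lambda>q. c \<alpha> (fst (prolongation q))) src.p0" if "\<alpha> \<in> C" for \<alpha>
    by (rule holomorphic_at_compose[OF f(2)[rule_format, OF that] holomorphic_at_fst_comp[OF prolongation_hol]])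
      (simp add: prolongation_p0 p0)
  have hy: "holomorphic_at (\<lambda>q. snd (prolongation q) $ i) src.p0" for i
    by (intro holomorphic_intros prolongation_hol)
  have cK: "mero_germ src.p0 (\<lambda>q. c \<alpha> (fst (prolongation q))) \<in> src.K" if \<alpha>: "\<alpha> \<in> C" for \<alpha>
  proof -
    have "mero_germ src.p0 (\<lambda>q. c \<alpha> (fst (prolongation q))) = mero_germ src.p0 (\<lambda>(x, y). c \<alpha> (H x))"
      by (rule mero_germ_cong[OF hx[OF \<alpha>]])
        (use fst_prolongation in \<open>auto elim!: eventually_mono split: prod.split\<close>)
    moreover have "holomorphic_at (\<lambda>x. c \<alpha> (H x)) (fst src.p0)"
      unfolding p0 by (rule holomorphic_at_compose[OF f(2)[rule_format, OF \<alpha>] H_hol H_0])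
    ultimately show ?thesis using mero_germ_in_partially_rational_germs[OF polynomial_in_y_coeff] by metis
  qed
  have "mero_germ src.p0 (\<lambda>q. f (prolongation q)) =
      (\<Sum>\<alpha>\<in>C. mero_germ src.p0 (\<lambda>q. c \<alpha> (fst (prolongation q))) *
        (\<Prod>i\<in>UNIV. mero_germ src.p0 (\<lambda>q. snd (prolongation q) $ i) ^ \<alpha> i))"
    by (simp add: f(3) case_prod_beta' mero_germ_sum mero_germ_mult mero_germ_prod mero_germ_power hx hy
        holomorphic_at_mult holomorphic_at_prod holomorphic_at_power)
  also have "\<dots> \<in> src.K"
    by (intro is_subfieldD(5,9,10,11)[OF src.subK] cK snd_prolongation_K)
  finally show ?thesis .
qed

lemma pullback_prolongation_K:
  assumes \<sigma>: "field_hom \<sigma>"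
    "\<And>f. holomorphic_at f tgt.p0 \<Longrightarrow> \<sigma> (mero_germ tgt.p0 f) = mero_germ src.p0 (\<lambda>q. f (prolongation q))"
  shows "\<sigma> ` tgt.K \<subseteq> src.K"
proof
  fix x assume "x \<in> \<sigma> ` tgt.K"
  then obtain f g where f: "polynomial_in_y (fst tgt.p0) f" and g: "polynomial_in_y (fst tgt.p0) g"
    and x: "x = \<sigma> (mero_germ tgt.p0 f / mero_germ tgt.p0 g)"
    unfolding partially_rational_germs_alt by blast
  have "x = mero_germ src.p0 (\<lambda>q. f (prolongation q)) / mero_germ src.p0 (\<lambda>q. g (prolongation q))"
    using f g by (simp add: x field_homD(8)[OF \<sigma>(1)] \<sigma>(2) polynomial_in_y_holomorphic)
  then show "x \<in> src.K"
    using polynomial_prolongation_K f g is_subfieldD(8)[OF src.subK] by simp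
qed

text \<open>Along the prolongation, \<open>\<Phi>'\<^sub>k\<^sub>l\<close> is the second derivative of \<open>\<rho>'\<close> at \<open>\<theta>\<close>, because the Segre
  parameters invert the jet map.\<close>

lemma associated_system_prolongation_L:
  "mero_germ src.p0 (\<lambda>q. associated_system \<rho>' A' B' k l (prolongation q)) \<in> src.L"
proof -
  have "\<forall>\<^sub>F q in nhds src.p0. dd (zdir l) (dd (zdir k) \<rho>') (\<theta> (src.S q)) =
      associated_system \<rho>' A' B' k l (prolongation q)"
    using eventually_holomorphic_compose[OF tgt.associated_system_eq[of k l] prolongation_hol prolongation_p0]
      eventually_holomorphic_compose[OF tgt.S_jet theta_S_hol, unfolded src.S_0, OF theta_0]
    by eventually_elim (simp add: prolongation_def)
  from mero_germ_cong[OF src.comp_S_hol[OF curvature_hol] this] show ?thesis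
    using curvature_L[of l k] by (simp add: src.jet_germ_def)
qed

lemma associated_system_hol: "holomorphic_at (associated_system \<rho>' A' B' k l) tgt.p0"
  by (rule holomorphic_at_cong[OF tgt.associated_system_eq, THEN iffD2]) (rule tgt.comp_S_hol[OF tgt.rho_zz_hol])

definition prolongation_back :: "'n jet \<Rightarrow> 'n jet"
  where "prolongation_back q = src.jet_map (\<theta>' (tgt.S q))"

lemma prolongation_inverse: "\<forall>\<^sub>F q in nhds src.p0. prolongation_back (prolongation q) = q"
  using eventually_holomorphic_compose[OF tgt.S_jet theta_S_hol, unfolded src.S_0, OF theta_0]
    eventually_holomorphic_compose[OF theta'_theta src.S_hol src.S_0] src.jet_S
  by eventually_elim (simp add: prolongation_def prolongation_back_def)

end

section \<open>Invariance of the jet transcendence degree\<close>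

text \<open>The pullbacks along the two prolongations are mutually inverse, and both respect the fields of
  partially rational germs.\<close>

lemma jet_transcendence_le:
  fixes M M' :: "'n::finite ambient set"
  assumes "segre_map M U r R \<rho> A B M' U' r' R' \<rho>' A' B' H G"
    and "segre_map M' U' r' R' \<rho>' A' B' M U r R \<rho> A B G H"
  shows "transcendence_degree_in_y (jet_base_point \<rho>') {associated_system \<rho>' A' B' k l | k l. True}
    \<le> transcendence_degree_in_y (jet_base_point \<rho>) {associated_system \<rho> A B k l | k l. True}"
proof -
  interpret a: segre_map M U r R \<rho> A B M' U' r' R' \<rho>' A' B' H G by fact
  interpret b: segre_map M' U' r' R' \<rho>' A' B' M U r R \<rho> A B G H by fact
  have swap: "a.prolongation_back = b.prolongation" "b.prolongation_back = a.prolongation"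
    by (simp_all add: fun_eq_iff a.prolongation_back_def b.prolongation_def b.prolongation_back_def a.prolongation_def)
  define \<sigma> where "\<sigma> = map_fract (pullback a.prolongation a.src.p0 a.tgt.p0)"
  define \<tau> where "\<tau> = map_fract (pullback b.prolongation a.tgt.p0 a.src.p0)"
  note pa = a.prolongation_hol a.prolongation_p0 and pb = b.prolongation_hol b.prolongation_p0
  note \<sigma> = pullback_field_hom[OF pa pb b.prolongation_inverse[unfolded swap], folded \<sigma>_def]
  note \<tau> = pullback_field_hom[OF pb pa a.prolongation_inverse[unfolded swap], folded \<tau>_def]
  have \<sigma>K: "\<sigma> ` a.tgt.K \<subseteq> a.src.K" by (rule a.pullback_prolongation_K[OF \<sigma>])
  have \<tau>K: "\<tau> ` a.src.K \<subseteq> a.tgt.K" by (rule b.pullback_prolongation_K[OF \<tau>])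
  have \<sigma>L: "\<sigma> ` a.tgt.L \<subseteq> a.src.L"
    unfolding a.tgt.L_def
  proof (rule field_hom_image_adjoin[OF \<sigma>(1) a.src.subL])
    show "\<sigma> ` a.tgt.K \<subseteq> a.src.L" using \<sigma>K a.src.K_L by blast
    show "\<sigma> ` mero_germ a.tgt.p0 ` {associated_system \<rho>' A' B' k l |k l. True} \<subseteq> a.src.L"
      using a.associated_system_prolongation_L by (auto simp: \<sigma>(2) a.associated_system_hol)
  qed
  have inv: "\<tau> (\<sigma> x) = x" for x
  proof -
    have mero_germ: "\<tau> (\<sigma> (mero_germ a.tgt.p0 f)) = mero_germ a.tgt.p0 f" if f: "holomorphic_at f a.tgt.p0" for f
    proof -
      have "\<tau> (\<sigma> (mero_germ a.tgt.p0 f)) = mero_germ a.tgt.p0 (\<lambda>q. f (a.prolongation (b.prolongation q)))"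
        by (simp add: \<sigma>(2)[OF f] \<tau>(2)[OF holomorphic_at_compose[OF f pa]])
      also have "\<dots> = mero_germ a.tgt.p0 f"
        by (rule mero_germ_cong[symmetric, OF f]) (use b.prolongation_inverse[unfolded swap] in \<open>auto elim: eventually_mono\<close>)
      finally show ?thesis .
    qed
    obtain u v where x: "x = Fract u v" "v \<noteq> 0" by (cases x) blast
    obtain f where f: "holomorphic_at f a.tgt.p0" "u = germ_at a.tgt.p0 f" by (rule germ_at_cases)
    obtain g where g: "holomorphic_at g a.tgt.p0" "v = germ_at a.tgt.p0 g" by (rule germ_at_cases)
    have "x = mero_germ a.tgt.p0 f / mero_germ a.tgt.p0 g" using x f g Fract_eq_mero_germ by metis
    then show ?thesis by (simp add: field_homD(8)[OF \<sigma>(1)] field_homD(8)[OF \<tau>(1)] mero_germ f(1) g(1))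
  qed
  show ?thesis
    unfolding a.src.jet_transcendence a.tgt.jet_transcendence
    by (rule transcendence_degree_le[OF \<sigma>(1) \<tau>(1) inv \<sigma>L \<tau>K])
qed

text \<open>The chosen \<open>\<rho>\<close>, \<open>A\<close> and \<open>B\<close> in the definition of the degree exist, and only their defining
  properties matter.\<close>

lemma jet_transcendence_degree_eq:
  fixes M :: "'n::finite ambient set"
  assumes "0 \<in> M" "levi_nondegenerate M" "solvable_for_w M"
  obtains U r R \<rho> A B where "segre_jet M U r R \<rho> A B"
    "jet_transcendence_degree M =
      transcendence_degree_in_y (jet_base_point \<rho>) {associated_system \<rho> A B k l | k l. True}"
proof -
  define \<rho> where "\<rho> = (SOME \<rho>. complex_defining_function M \<rho>)"
  obtain \<rho>\<^sub>0 where "complex_defining_function M \<rho>\<^sub>0"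
    by (rule complex_defining_function_exists[OF assms(1,3)])
  then have \<rho>: "complex_defining_function M \<rho>" unfolding \<rho>_def
    by (rule someI[of "complex_defining_function M"])
  obtain U r R where S: "segre_family M U r R \<rho>"
    by (rule complex_defining_function_segre_family[OF \<rho> assms(1)])
  interpret segre_family M U r R \<rho> by fact
  define AB where "AB = (SOME (A, B). segre_parameters \<rho> A B)"
  obtain A B where AB: "AB = (A, B)" by (cases AB)
  obtain A0 B0 where "segre_parameters \<rho> A0 B0" by (rule segre_parameters_exist[OF assms(2)])
  then have "case AB of (A, B) \<Rightarrow> segre_parameters \<rho> A B"
    unfolding AB_def by (intro someI_ex[of "\<lambda>(A, B). segre_parameters \<rho> A B"]) auto
  then have params: "segre_parameters \<rho> A B" by (simp add: AB)
  show ?thesis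
  proof (rule that)
    show "segre_jet M U r R \<rho> A B" by unfold_locales (fact assms params)+
    show "jet_transcendence_degree M =
      transcendence_degree_in_y (jet_base_point \<rho>) {associated_system \<rho> A B k l | k l. True}"
      unfolding jet_transcendence_degree_def \<rho>_def[symmetric] Let_def AB_def[symmetric] AB by simp
  qed
qed

theorem proposition3:
  fixes M M' :: "'n::finite ambient set"
  assumes "0 \<in> M" and "real_analytic_hypersurface M" and "levi_nondegenerate M"
    and "solvable_for_w M"
    and "0 \<in> M'" and "real_analytic_hypersurface M'" and "levi_nondegenerate M'"
    and "solvable_for_w M'"
    and "\<exists>H U V. local_biholomorphism H U V \<and> H ` (M \<inter> U) = M' \<inter> V"
  shows "jet_transcendence_degree M = jet_transcendence_degree M'"
proof -
  obtain U r R \<rho> A B where S: "segre_jet M U r R \<rho> A B" and M_eq: "jet_transcendence_degree M =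
      transcendence_degree_in_y (jet_base_point \<rho>) {associated_system \<rho> A B k l | k l. True}"
    by (rule jet_transcendence_degree_eq[OF assms(1,3,4)])
  obtain U' r' R' \<rho>' A' B' where S': "segre_jet M' U' r' R' \<rho>' A' B'" and M'_eq: "jet_transcendence_degree M' =
      transcendence_degree_in_y (jet_base_point \<rho>') {associated_system \<rho>' A' B' k l | k l. True}"
    by (rule jet_transcendence_degree_eq[OF assms(5,7,8)])
  obtain H X Y where H: "local_biholomorphism H X Y" and HM: "H ` (M \<inter> X) = M' \<inter> Y"
    using assms(9) by blast
  define G where "G = inv_into X H"
  note H = H[unfolded local_biholomorphism_def, folded G_def]
  have X: "open X" "0 \<in> X" and Y: "open Y" "0 \<in> Y" and bij: "bij_betw H X Y" and H0: "H 0 = 0"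
    using H by (auto simp: bij_betw_def)
  have GH: "G (H Z) = Z" if "Z \<in> X" for Z
    unfolding G_def using bij_betw_inv_into_left[OF bij that] .
  have HG: "H (G Z) = Z" if "Z \<in> Y" for Z
    unfolding G_def using bij_betw_inv_into_right[OF bij that] .
  have G0: "G 0 = 0" using GH[OF X(2)] H0 by simp
  note nX = eventually_nhds_in_open[OF X] and nY = eventually_nhds_in_open[OF Y]
  have hol: "holomorphic_at H 0" "holomorphic_at G 0"
    using H X Y unfolding holomorphic_at_def by blast+
  have GM: "G Z \<in> M" if "Z \<in> Y" "Z \<in> M'" for Z
  proof -
    have "Z \<in> H ` (M \<inter> X)" using HM that by blast
    then show ?thesis using GH by auto
  qed
  have evH: "\<forall>\<^sub>F Z in nhds 0. Z \<in> M \<longrightarrow> H Z \<in> M'" using nX by eventually_elim (use HM in blast)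
  have evG: "\<forall>\<^sub>F Z in nhds 0. Z \<in> M' \<longrightarrow> G Z \<in> M" using nY by eventually_elim (use GM in blast)
  have evGH: "\<forall>\<^sub>F Z in nhds 0. G (H Z) = Z" using nX by eventually_elim (rule GH)
  have evHG: "\<forall>\<^sub>F Z in nhds 0. H (G Z) = Z" using nY by eventually_elim (rule HG)
  have a: "segre_map M U r R \<rho> A B M' U' r' R' \<rho>' A' B' H G"
    using S S' hol H0 evH evGH by (simp add: segre_map_def segre_map_axioms_def)
  have b: "segre_map M' U' r' R' \<rho>' A' B' M U r R \<rho> A B G H"
    using S S' hol G0 evG evHG by (simp add: segre_map_def segre_map_axioms_def)
  show ?thesis
    unfolding M_eq M'_eq by (intro antisym jet_transcendence_le[OF a b] jet_transcendence_le[OF b a])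
qed

end
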